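(* Let $(\mathcal M,X)$ be an irreducible concurrent system equipped with a valuation $f=(f_\alpha)_{\alpha\in X}$. Then there is a unique pair $(r,\Gamma)$, where $r>0$ is real and $\Gamma:X\times X\to\mathbb R_{>0}$ is a positive cocycle, such that the valuation $\widetilde f$ defined by $$\widetilde f_\alpha(x)=r^{|x|}\,\Gamma(\alpha,\alpha\cdot x)\,f_\alpha(x)\qquad(\alpha\in X,\ x\in\mathcal M_\alpha)$$ (and $\widetilde f_\alpha(x)=0$ if $\alpha\cdot x=\bot$) is a probabilistic valuation. This pair is $(\rho,\Delta)$, where $\rho$ is the common radius of convergence of the series $G_\alpha(s)=\sum_{x\in\mathcal M_\alpha}f_\alpha(x)s^{|x|}$ for $\alpha$ ranging over $X$, and $\Delta$ is the positive cocycle given by $\Delta(\alpha,\beta)=\lim_{s\to\rho^-}G_\beta(s)/G_\alpha(s)$.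
   Context: Trace monoids. Let $\Sigma$ be a finite set and $I\subseteq\Sigma\times\Sigma$ irreflexive and symmetric. The trace monoid $\mathcal M=\mathcal M(\Sigma,I)$ is presented by $\langle\Sigma\mid ab=ba\text{ for }(a,b)\in I\rangle$. Its elements are traces, $\varepsilon$ is the unit, $|x|$ is the length of $x$, and $x\leqslant y$ means $y=xz$ for some $z\in\mathcal M$. $\mathcal M$ is irreducible if the graph $(\Sigma,(\Sigma\times\Sigma)\setminus I)$ is connected. A clique is a trace $a_1\cdots a_k$ of letters with $(a_i,a_j)\in I$ for $i\neq j$ (the empty trace included); cliques are identified with subsets of $\Sigma$. For cliques write $c\to d$ if for every letter $b\in d$ there is a letter $a\in c$ with $(a,b)\notin I$. Infinite traces. An infinite trace is a sequence $\omega=(c_i)_{i\geqslant1}$ of non-empty cliques with $c_i\to c_{i+1}$ for all $i$; write $C_i(\omega)=c_i$. The set $\partial\mathcal M$ of infinite traces carries its Borel $\sigma$-algebra (as a subspace of a product of finite discrete sets). For $x\in\mathcal M$ and $\omega\in\partial\mathcal M$, $x\leqslant\omega$ means $x\leqslant C_1(\omega)\cdots C_n(\omega)$ for some $n$. Put ${\uparrow}x=\{\omega\in\partial\mathcal M:x\leqslant\omega\}$. Concurrent systems. A concurrent system is a pair $(\mathcal M,X)$, $X$ a finite set of states, with a right monoid action of $\mathcal M$ on $X\sqcup\{\bot\}$, where $\bot\cdot x=\bot$ for all $x$. Put $\mathcal M_\alpha=\{x\in\mathcal M:\alpha\cdot x\neq\bot\}$, $\mathcal M_{\alpha,\beta}=\{x:\alpha\cdot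 x=\beta\}$, and $\partial\mathcal M_\alpha=\{\omega\in\partial\mathcal M: x\in\mathcal M_\alpha\text{ for all }x\in\mathcal M\text{ with }x\leqslant\omega\}$. Non-trivial: $\alpha\cdot a\neq\bot$ for some $\alpha\in X$, $a\in\Sigma$. Transitive: $\mathcal M_{\alpha,\beta}\neq\emptyset$ for all $\alpha,\beta\in X$. Irreducible: (1) transitive and non-trivial; (2) $\mathcal M$ is irreducible; (3) for all $\alpha\in X$, $a\in\Sigma$ there is $u\in\mathcal M$ with $\alpha\cdot(ua)\neq\bot$. Valuations and Markov measures. A valuation is a family $f=(f_\alpha)_{\alpha\in X}$ of functions $f_\alpha:\mathcal M\to\mathbb R_{\geqslant0}$ with $f_\alpha(x)>0\iff\alpha\cdot x\neq\bot$ and $f_\alpha(xy)=f_\alpha(x)f_{\alpha\cdot x}(y)$ (right-hand side $0$ if $\alpha\cdot x=\bot$). A Markov measure is a family $m=(m_\alpha)_{\alpha\in X}$ of probability measures on $\partial\mathcal M$ with $m_\alpha(\partial\mathcal M_\alpha)=1$, $x\in\mathcal M_\alpha\iff m_\alpha({\uparrow}x)>0$, and $m_\alpha({\uparrow}(xy))=m_\alpha({\uparrow}x)\,m_{\alpha\cdot x}({\uparrow}y)$ for all $\alpha,x,y$. A valuation $f$ is probabilistic if $f_\alpha(x)=m_\alpha({\uparrow}x)$ for all $(\alpha,x)\in X\times\mathcal M$, for some Markov measure $m$. Cocycles. A cocycle on $X$ is a function $\Delta:X\times X\to\mathbb R_{\geqslant0}$ with $\Delta(\alpha,\gamma)=\Delta(\alpha,\beta)\Delta(\beta,\gamma)$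 for all $\alpha,\beta,\gamma$; it is positive if all its values are positive. *)

theory Defs
  imports "HOL-Probability.Probability_Measure" "HOL-Algebra.Group"
begin

section \<open>Trace monoids\<close>

text \<open>
  The alphabet is the type \<open>'a :: finite\<close> and the independence relation is \<open>I\<close>. Irreflexivity and
  symmetry of \<open>I\<close> are required in \<open>concurrent_system\<close> below.
\<close>

inductive_set trace_cong :: "'a rel \<Rightarrow> 'a list rel" for I :: "'a rel" where
  swap: "(a, b) \<in> I \<Longrightarrow> ([a, b], [b, a]) \<in> trace_cong I"
| refl: "(u, u) \<in> trace_cong I"
| sym: "(u, v) \<in> trace_cong I \<Longrightarrow> (v, u) \<in> trace_cong I"
| trans: "(u, v) \<in> trace_cong I \<Longrightarrow> (v, w) \<in> trace_cong I \<Longrightarrow> (u, w) \<in> trace_cong I"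
| append: "(u, u') \<in> trace_cong I \<Longrightarrow> (v, v') \<in> trace_cong I \<Longrightarrow> (u @ v, u' @ v') \<in> trace_cong I"

definition trace_of :: "'a rel \<Rightarrow> 'a list \<Rightarrow> 'a list set" where
  "trace_of I w = trace_cong I `` {w}"

definition trace_monoid :: "'a rel \<Rightarrow> 'a list set monoid" where
  "trace_monoid I =
    \<lparr> carrier = UNIV // trace_cong I,
      mult = (\<lambda>x y. \<Union>u\<in>x. \<Union>v\<in>y. trace_of I (u @ v)),
      one = trace_of I [] \<rparr>"

text \<open>Congruent words have the same length, so the choice of representative is immaterial.\<close>

definition trace_length :: "'a list set \<Rightarrow> nat" where
  "trace_length x = length (SOME w. w \<in> x)"

definition trace_le :: "'a rel \<Rightarrow> 'a list set \<Rightarrow> 'a list set \<Rightarrow> bool" where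
  "trace_le I x y \<longleftrightarrow> (\<exists>z\<in>carrier (trace_monoid I). y = x \<otimes>\<^bsub>trace_monoid I\<^esub> z)"

definition irreducible_trace_monoid :: "'a rel \<Rightarrow> bool" where
  "irreducible_trace_monoid I \<longleftrightarrow> (\<forall>a b. (a, b) \<in> (UNIV - I)\<^sup>*)"

text \<open>
  Cliques are identified with sets of letters. The trace \<open>clique_trace I c\<close> is the product of the
  letters of \<open>c\<close>; for a clique the order of enumeration is immaterial.
\<close>

definition cliques :: "'a rel \<Rightarrow> 'a set set" where
  "cliques I = {c. \<forall>a\<in>c. \<forall>b\<in>c. a \<noteq> b \<longrightarrow> (a, b) \<in> I}"

definition clique_trace :: "'a::finite rel \<Rightarrow> 'a set \<Rightarrow> 'a list set" where
  "clique_trace I c = trace_of I (SOME w. distinct w \<and> set w = c)"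

definition clique_arrow :: "'a rel \<Rightarrow> 'a set \<Rightarrow> 'a set \<Rightarrow> bool" where
  "clique_arrow I c d \<longleftrightarrow> (\<forall>b\<in>d. \<exists>a\<in>c. (a, b) \<notin> I)"


section \<open>Infinite traces\<close>

text \<open>Sequences are indexed from \<open>0\<close>: the clique \<open>C\<^sub>i(\<omega>)\<close>, for \<open>i \<ge> 1\<close>, is \<open>\<omega> (i - 1)\<close>.\<close>

definition infinite_traces :: "'a rel \<Rightarrow> (nat \<Rightarrow> 'a set) set" where
  "infinite_traces I =
    {\<omega>. (\<forall>i. \<omega> i \<in> cliques I \<and> \<omega> i \<noteq> {}) \<and> (\<forall>i. clique_arrow I (\<omega> i) (\<omega> (Suc i)))}"

definition infinite_traces_topology :: "'a rel \<Rightarrow> (nat \<Rightarrow> 'a set) topology" where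
  "infinite_traces_topology I =
    subtopology (product_topology (\<lambda>_. discrete_topology (cliques I - {{}})) UNIV)
      (infinite_traces I)"

definition infinite_traces_borel :: "'a rel \<Rightarrow> (nat \<Rightarrow> 'a set) measure" where
  "infinite_traces_borel I = sigma (infinite_traces I) {U. openin (infinite_traces_topology I) U}"

primrec clique_prefix :: "'a::finite rel \<Rightarrow> (nat \<Rightarrow> 'a set) \<Rightarrow> nat \<Rightarrow> 'a list set" where
  "clique_prefix I \<omega> 0 = \<one>\<^bsub>trace_monoid I\<^esub>"
| "clique_prefix I \<omega> (Suc n) = clique_prefix I \<omega> n \<otimes>\<^bsub>trace_monoid I\<^esub> clique_trace I (\<omega> n)"

definition trace_le_inf :: "'a::finite rel \<Rightarrow> 'a list set \<Rightarrow> (nat \<Rightarrow> 'a set) \<Rightarrow> bool" where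
  "trace_le_inf I x \<omega> \<longleftrightarrow> (\<exists>n. trace_le I x (clique_prefix I \<omega> n))"

definition up :: "'a::finite rel \<Rightarrow> 'a list set \<Rightarrow> (nat \<Rightarrow> 'a set) set" where
  "up I x = {\<omega> \<in> infinite_traces I. trace_le_inf I x \<omega>}"


section \<open>Concurrent systems\<close>

text \<open>
  The set of states is the type \<open>'s :: finite\<close>, and \<open>None\<close> plays the role of \<open>\<bottom>\<close>. The action is only
  constrained on (and only ever used on) the carrier of the trace monoid.
\<close>

definition concurrent_system ::
  "'a::finite rel \<Rightarrow> ('s::finite option \<Rightarrow> 'a list set \<Rightarrow> 's option) \<Rightarrow> bool" where
  "concurrent_system I act \<longleftrightarrow>
     irrefl I \<and> sym I \<and>
     (\<forall>s. act s \<one>\<^bsub>trace_monoid I\<^esub> = s) \<and>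
     (\<forall>s. \<forall>x\<in>carrier (trace_monoid I). \<forall>y\<in>carrier (trace_monoid I).
        act s (x \<otimes>\<^bsub>trace_monoid I\<^esub> y) = act (act s x) y) \<and>
     (\<forall>x\<in>carrier (trace_monoid I). act None x = None)"

definition traces_from ::
  "'a rel \<Rightarrow> ('s option \<Rightarrow> 'a list set \<Rightarrow> 's option) \<Rightarrow> 's \<Rightarrow> 'a list set set" where
  "traces_from I act \<alpha> = {x \<in> carrier (trace_monoid I). act (Some \<alpha>) x \<noteq> None}"

definition traces_between ::
  "'a rel \<Rightarrow> ('s option \<Rightarrow> 'a list set \<Rightarrow> 's option) \<Rightarrow> 's \<Rightarrow> 's \<Rightarrow> 'a list set set" where
  "traces_between I act \<alpha> \<beta> = {x \<in> carrier (trace_monoid I). act (Some \<alpha>) x = Some \<beta>}"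

definition infinite_traces_from ::
  "'a::finite rel \<Rightarrow> ('s option \<Rightarrow> 'a list set \<Rightarrow> 's option) \<Rightarrow> 's \<Rightarrow> (nat \<Rightarrow> 'a set) set" where
  "infinite_traces_from I act \<alpha> =
    {\<omega> \<in> infinite_traces I.
       \<forall>x\<in>carrier (trace_monoid I). trace_le_inf I x \<omega> \<longrightarrow> x \<in> traces_from I act \<alpha>}"

definition nontrivial_system ::
  "'a rel \<Rightarrow> ('s option \<Rightarrow> 'a list set \<Rightarrow> 's option) \<Rightarrow> bool" where
  "nontrivial_system I act \<longleftrightarrow> (\<exists>\<alpha> a. act (Some \<alpha>) (trace_of I [a]) \<noteq> None)"

definition transitive_system ::
  "'a rel \<Rightarrow> ('s option \<Rightarrow> 'a list set \<Rightarrow> 's option) \<Rightarrow> bool" where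
  "transitive_system I act \<longleftrightarrow> (\<forall>\<alpha> \<beta>. traces_between I act \<alpha> \<beta> \<noteq> {})"

definition irreducible_concurrent_system ::
  "'a::finite rel \<Rightarrow> ('s::finite option \<Rightarrow> 'a list set \<Rightarrow> 's option) \<Rightarrow> bool" where
  "irreducible_concurrent_system I act \<longleftrightarrow>
     concurrent_system I act \<and>
     transitive_system I act \<and> nontrivial_system I act \<and>
     irreducible_trace_monoid I \<and>
     (\<forall>\<alpha> a. \<exists>u\<in>carrier (trace_monoid I).
        act (Some \<alpha>) (u \<otimes>\<^bsub>trace_monoid I\<^esub> trace_of I [a]) \<noteq> None)"


section \<open>Valuations, Markov measures and cocycles\<close>

definition valuation ::
  "'a rel \<Rightarrow> ('s option \<Rightarrow> 'a list set \<Rightarrow> 's option) \<Rightarrow> ('s \<Rightarrow> 'a list set \<Rightarrow> real) \<Rightarrow> bool" where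
  "valuation I act f \<longleftrightarrow>
     (\<forall>\<alpha>. \<forall>x\<in>carrier (trace_monoid I). f \<alpha> x \<ge> 0) \<and>
     (\<forall>\<alpha>. \<forall>x\<in>carrier (trace_monoid I). f \<alpha> x > 0 \<longleftrightarrow> act (Some \<alpha>) x \<noteq> None) \<and>
     (\<forall>\<alpha>. \<forall>x\<in>carrier (trace_monoid I). \<forall>y\<in>carrier (trace_monoid I).
        f \<alpha> (x \<otimes>\<^bsub>trace_monoid I\<^esub> y) =
          (case act (Some \<alpha>) x of None \<Rightarrow> 0 | Some \<beta> \<Rightarrow> f \<alpha> x * f \<beta> y))"

definition markov_measure ::
  "'a::finite rel \<Rightarrow> ('s option \<Rightarrow> 'a list set \<Rightarrow> 's option) \<Rightarrow>
   ('s \<Rightarrow> (nat \<Rightarrow> 'a set) measure) \<Rightarrow> bool" where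
  "markov_measure I act m \<longleftrightarrow>
     (\<forall>\<alpha>. prob_space (m \<alpha>) \<and> sets (m \<alpha>) = sets (infinite_traces_borel I)) \<and>
     (\<forall>\<alpha>. measure (m \<alpha>) (infinite_traces_from I act \<alpha>) = 1) \<and>
     (\<forall>\<alpha>. \<forall>x\<in>carrier (trace_monoid I).
        x \<in> traces_from I act \<alpha> \<longleftrightarrow> measure (m \<alpha>) (up I x) > 0) \<and>
     (\<forall>\<alpha>. \<forall>x\<in>carrier (trace_monoid I). \<forall>y\<in>carrier (trace_monoid I).
        measure (m \<alpha>) (up I (x \<otimes>\<^bsub>trace_monoid I\<^esub> y)) =
          (case act (Some \<alpha>) x of
             None \<Rightarrow> 0
           | Some \<beta> \<Rightarrow> measure (m \<alpha>) (up I x) * measure (m \<beta>) (up I y)))"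

definition probabilistic_valuation ::
  "'a::finite rel \<Rightarrow> ('s option \<Rightarrow> 'a list set \<Rightarrow> 's option) \<Rightarrow>
   ('s \<Rightarrow> 'a list set \<Rightarrow> real) \<Rightarrow> bool" where
  "probabilistic_valuation I act f \<longleftrightarrow>
     valuation I act f \<and>
     (\<exists>m. markov_measure I act m \<and>
        (\<forall>\<alpha>. \<forall>x\<in>carrier (trace_monoid I). f \<alpha> x = measure (m \<alpha>) (up I x)))"

definition cocycle :: "('s \<Rightarrow> 's \<Rightarrow> real) \<Rightarrow> bool" where
  "cocycle \<Delta> \<longleftrightarrow>
     (\<forall>\<alpha> \<beta>. \<Delta> \<alpha> \<beta> \<ge> 0) \<and> (\<forall>\<alpha> \<beta> \<gamma>. \<Delta> \<alpha> \<gamma> = \<Delta> \<alpha> \<beta> * \<Delta> \<beta> \<gamma>)"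

definition positive_cocycle :: "('s \<Rightarrow> 's \<Rightarrow> real) \<Rightarrow> bool" where
  "positive_cocycle \<Delta> \<longleftrightarrow> cocycle \<Delta> \<and> (\<forall>\<alpha> \<beta>. \<Delta> \<alpha> \<beta> > 0)"

definition twisted_valuation ::
  "('s option \<Rightarrow> 'a list set \<Rightarrow> 's option) \<Rightarrow> ('s \<Rightarrow> 'a list set \<Rightarrow> real) \<Rightarrow>
   real \<Rightarrow> ('s \<Rightarrow> 's \<Rightarrow> real) \<Rightarrow> 's \<Rightarrow> 'a list set \<Rightarrow> real" where
  "twisted_valuation act f r \<Gamma> \<alpha> x =
     (case act (Some \<alpha>) x of
        None \<Rightarrow> 0
      | Some \<beta> \<Rightarrow> r ^ trace_length x * \<Gamma> \<alpha> \<beta> * f \<alpha> x)"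


section \<open>Generating series\<close>

definition gen_series ::
  "'a rel \<Rightarrow> ('s option \<Rightarrow> 'a list set \<Rightarrow> 's option) \<Rightarrow> ('s \<Rightarrow> 'a list set \<Rightarrow> real) \<Rightarrow>
   's \<Rightarrow> real \<Rightarrow> real" where
  "gen_series I act f \<alpha> s = (\<Sum>\<^sub>\<infinity>x\<in>traces_from I act \<alpha>. f \<alpha> x * s ^ trace_length x)"

text \<open>
  The \<open>n\<close>-th coefficient of the power series above. The sum is finite, since there are only finitely
  many traces of length \<open>n\<close> over a finite alphabet.
\<close>

definition gen_series_coeff ::
  "'a::finite rel \<Rightarrow> ('s option \<Rightarrow> 'a list set \<Rightarrow> 's option) \<Rightarrow> ('s \<Rightarrow> 'a list set \<Rightarrow> real) \<Rightarrow>
   's \<Rightarrow> nat \<Rightarrow> real" where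
  "gen_series_coeff I act f \<alpha> n = (\<Sum>x | x \<in> traces_from I act \<alpha> \<and> trace_length x = n. f \<alpha> x)"

end

theory Submission
  imports Defs "HOL-Library.Sublist"
begin

text \<open>
  Write \<open>G\<^sub>\<alpha>(s)\<close> for the generating series of \<open>f\<^sub>\<alpha>\<close> and \<open>\<rho>\<close> for its radius of convergence. For
  \<open>0 \<le> s < \<rho>\<close>, choose a finite trace \<open>x\<close> at random with probability \<open>f\<^sub>\<alpha>(x) s\<^bsup>|x|\<^esup> / G\<^sub>\<alpha>(s)\<close>. Since
  \<open>z \<mapsto> x z\<close> is a bijection from \<open>\<M>\<close> onto the traces above \<open>x\<close>, the random trace extends \<open>x\<close> with
  probability exactly \<open>s\<^bsup>|x|\<^esup> (G\<^sub>\<beta>(s) / G\<^sub>\<alpha>(s)) f\<^sub>\<alpha>(x)\<close>, where \<open>\<beta> = \<alpha> \<cdot> x\<close>. This is already of the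
  required form, and a Markov measure arises by letting \<open>s\<close> tend to \<open>\<rho>\<close>.

  \<^emph>\<open>Existence.\<close> The sums over \<open>\<alpha>\<close> of the \<open>n\<close>-th coefficients are submultiplicative in \<open>n\<close>, because
  every trace of length \<open>m + n\<close> is a product of traces of lengths \<open>m\<close> and \<open>n\<close>. Hence, multiplied by
  \<open>\<rho>\<^sup>n\<close>, they stay at least \<open>1\<close> (\<open>total_rad_ge\<close>), and \<open>G\<^sub>\<alpha>(s)\<close> tends to infinity at \<open>\<rho>\<close>
  (\<open>G_at_top\<close>). Transitivity makes the series of all states comparable (\<open>G_comparable\<close>). By
  compactness, along a subsequence of any sequence increasing to \<open>\<rho>\<close> the distributions of all initial
  segments of the clique normal form converge, and so do the ratios \<open>G\<^sub>\<beta> / G\<^sub>\<alpha>\<close>. Each given finite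
  trace has vanishing probability in the limit, so that the limit lives on infinite traces. Whether
  \<open>x \<le> y\<close> holds depends only on the first \<open>|x|\<close> cliques of \<open>y\<close> (\<open>le_normal_form\<close>,
  \<open>trace_le_inf_iff\<close>); hence the formula for the probability of extending \<open>x\<close> passes to the limit
  (\<open>subsequential_limit_probabilistic\<close>).

  \<^emph>\<open>Uniqueness.\<close> For a letter \<open>a\<close>, the minimal traces containing \<open>a\<close> are pairwise without common
  upper bound, so the sets \<open>\<up>x\<close> of these traces are disjoint, and they cover all infinite traces in which \<open>a\<close>
  occurs. Under any Markov measure, every letter occurs almost surely (\<open>AE_every_letter\<close>), so a
  probabilistic valuation sums to \<open>1\<close> over these traces (\<open>first_hits_total\<close>). Given two probabilistic
  valuations related by a twist \<open>(r, \<Gamma>)\<close>, where \<open>r \<le> 1\<close> by symmetry, write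
  \<open>\<Gamma>(\<alpha>, \<beta>) = \<lambda>(\<beta>) / \<lambda>(\<alpha>)\<close>. At a state \<open>\<alpha>\<close> where \<open>\<lambda>\<close> is maximal, the twisted valuation is
  termwise at most the other one while both sums equal \<open>1\<close>, so they agree on the minimal traces
  containing \<open>a\<close>. The letter \<open>a\<close> itself is such a trace; therefore \<open>r = 1\<close> and \<open>\<lambda>\<close> is again maximal
  at \<open>\<alpha> \<cdot> a\<close>. By transitivity \<open>\<lambda>\<close> is constant (\<open>twist_between_probabilistic_trivial\<close>).

  Since all subsequential limits of the ratios are thus equal, the limit as \<open>s\<close> tends to \<open>\<rho>\<close> exists.

  \<^emph>\<open>Occurrence of letters.\<close> This is where connectedness of the dependence graph and the reachability
  of every letter enter. If \<open>a\<close> and \<open>b\<close> are dependent, then from every state there is an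
  enabled trace in which an occurrence of \<open>a\<close> precedes an occurrence of \<open>b\<close>. Cutting an infinite
  trace at its successive occurrences of \<open>b\<close>, where it starts afresh by the Markov property, shows
  that the probability of seeing \<open>n\<close> occurrences of \<open>b\<close> with no \<open>a\<close> below them decays
  geometrically in \<open>n\<close>. So if \<open>b\<close> occurs infinitely often, then so does \<open>a\<close>; some letter occurs
  infinitely often, and connectedness propagates this to all letters.

  The combinatorics of traces is handled through projections. For dependent \<open>a\<close>, \<open>b\<close>, deleting all
  other letters from a word respects the congruence, and these projections determine a trace as well
  as the prefix order (\<open>le_iff_proj\<close>).
\<close>


section \<open>Traces and their projections to pairs of dependent letters\<close>

locale independence =
  fixes I :: "'a::finite rel"
  assumes irrefl_I: "irrefl I" and sym_I: "sym I"
begin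

abbreviation traces ("\<M>") where "\<M> \<equiv> carrier (trace_monoid I)"
abbreviation concat_trace (infixl "\<odot>" 70) where "x \<odot> y \<equiv> x \<otimes>\<^bsub>trace_monoid I\<^esub> y"
abbreviation empty_trace ("\<epsilon>") where "\<epsilon> \<equiv> \<one>\<^bsub>trace_monoid I\<^esub>"
abbreviation prefix_trace (infix "\<preceq>" 50) where "x \<preceq> y \<equiv> trace_le I x y"
abbreviation word_trace ("\<tau>") where "\<tau> w \<equiv> trace_of I w"
abbreviation len ("\<ell>") where "\<ell> \<equiv> trace_length"

lemma equiv_trace_cong: "equiv UNIV (trace_cong I)"
proof (intro equivI refl_onI symI transI)
  fix u v w
  show "(u, u) \<in> trace_cong I" by (rule trace_cong.refl)
  show "(v, u) \<in> trace_cong I" if "(u, v) \<in> trace_cong I" using that by (rule trace_cong.sym)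
  show "(u, w) \<in> trace_cong I" if "(u, v) \<in> trace_cong I" "(v, w) \<in> trace_cong I"
    using that by (rule trace_cong.trans)
qed auto

lemma trace_of_eq_iff: "\<tau> u = \<tau> v \<longleftrightarrow> (u, v) \<in> trace_cong I"
  unfolding trace_of_def using eq_equiv_class_iff[OF equiv_trace_cong] by blast

lemma mem_trace_of: "v \<in> \<tau> w \<longleftrightarrow> (w, v) \<in> trace_cong I"
  by (simp add: trace_of_def)

lemma traces_eq: "\<M> = range \<tau>"
  by (auto simp: trace_monoid_def quotient_def trace_of_def)

lemma trace_of_in [simp]: "\<tau> w \<in> \<M>"
  by (simp add: traces_eq)

lemma trace_cases: assumes "x \<in> \<M>" obtains w where "x = \<tau> w"
  using assms by (auto simp: traces_eq)

lemma one_eq: "\<epsilon> = \<tau> []"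
  by (simp add: trace_monoid_def)

lemma mult_trace_of: "\<tau> u \<odot> \<tau> v = \<tau> (u @ v)"
proof -
  have "\<tau> (u' @ v') = \<tau> (u @ v)" if "u' \<in> \<tau> u" "v' \<in> \<tau> v" for u' v'
    using that by (intro trace_of_eq_iff[THEN iffD2] trace_cong.append)
      (simp_all add: mem_trace_of trace_cong.sym)
  moreover have "u \<in> \<tau> u" "v \<in> \<tau> v"
    by (simp_all add: mem_trace_of trace_cong.refl)
  ultimately have "(\<Union>u'\<in>\<tau> u. \<Union>v'\<in>\<tau> v. \<tau> (u' @ v')) = \<tau> (u @ v)"
    by blast
  then show ?thesis
    by (simp add: trace_monoid_def)
qed

lemma mult_in [simp]: "x \<in> \<M> \<Longrightarrow> y \<in> \<M> \<Longrightarrow> x \<odot> y \<in> \<M>"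
  by (metis mult_trace_of trace_cases trace_of_in)

lemma one_in [simp]: "\<epsilon> \<in> \<M>"
  by (simp add: one_eq)

lemma mult_assoc: "x \<in> \<M> \<Longrightarrow> y \<in> \<M> \<Longrightarrow> z \<in> \<M> \<Longrightarrow> x \<odot> y \<odot> z = x \<odot> (y \<odot> z)"
  by (elim trace_cases) (simp add: mult_trace_of)

lemma one_mult [simp]: "x \<in> \<M> \<Longrightarrow> \<epsilon> \<odot> x = x"
  by (elim trace_cases) (simp add: mult_trace_of one_eq)

lemma mult_one [simp]: "x \<in> \<M> \<Longrightarrow> x \<odot> \<epsilon> = x"
  by (elim trace_cases) (simp add: mult_trace_of one_eq)

text \<open>
  Only pairs \<open>(a, b) \<notin> I\<close> are of interest: for these, deleting all letters other than \<open>a\<close> and \<open>b\<close> gives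
  the same word for congruent words. The case \<open>a = b\<close> is included, since \<open>I\<close> is irreflexive, and counts the occurrences of
  \<open>a\<close>.
\<close>

definition word_proj :: "'a \<Rightarrow> 'a \<Rightarrow> 'a list \<Rightarrow> 'a list" where
  "word_proj a b = filter (\<lambda>c. c = a \<or> c = b)"

definition proj :: "'a \<Rightarrow> 'a \<Rightarrow> 'a list set \<Rightarrow> 'a list" where
  "proj a b x = word_proj a b (SOME w. w \<in> x)"

lemma indep_neq: "(a, b) \<in> I \<Longrightarrow> a \<noteq> b"
  using irrefl_I by (auto simp: irrefl_def)

lemma indep_sym: "(a, b) \<in> I \<longleftrightarrow> (b, a) \<in> I"
  using sym_I by (auto simp: sym_def)

lemma self_dep [simp]: "(a, a) \<notin> I"
  using indep_neq by blast

lemma word_proj_cong: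
  assumes "(u, v) \<in> trace_cong I" "(a, b) \<notin> I"
  shows "word_proj a b u = word_proj a b v"
  using assms(1)
proof induction
  case (swap c d)
  then show ?case using assms(2) indep_neq[OF swap] indep_sym
    by (auto simp: word_proj_def)
qed (auto simp: word_proj_def)

lemma length_cong: "(u, v) \<in> trace_cong I \<Longrightarrow> length u = length v"
  by (induction rule: trace_cong.induct) auto

lemma proj_trace_of: "(a, b) \<notin> I \<Longrightarrow> proj a b (\<tau> w) = word_proj a b w"
  unfolding proj_def
  by (metis (mono_tags, lifting) mem_trace_of someI trace_cong.refl word_proj_cong)

lemma length_trace_of [simp]: "\<ell> (\<tau> w) = length w"
  unfolding trace_length_def
  by (metis (mono_tags, lifting) mem_trace_of someI trace_cong.refl length_cong)

lemma length_mult [simp]: "x \<in> \<M> \<Longrightarrow> y \<in> \<M> \<Longrightarrow> \<ell> (x \<odot> y) = \<ell> x + \<ell> y"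
  by (elim trace_cases) (simp add: mult_trace_of)

lemma length_one [simp]: "\<ell> \<epsilon> = 0"
  by (simp add: one_eq)

lemma length_0_iff: "x \<in> \<M> \<Longrightarrow> \<ell> x = 0 \<longleftrightarrow> x = \<epsilon>"
  by (metis length_0_conv length_one length_trace_of one_eq trace_cases)

lemma proj_mult:
  "(a, b) \<notin> I \<Longrightarrow> x \<in> \<M> \<Longrightarrow> y \<in> \<M> \<Longrightarrow> proj a b (x \<odot> y) = proj a b x @ proj a b y"
  by (elim trace_cases) (simp add: mult_trace_of proj_trace_of word_proj_def)

lemma proj_one [simp]: "(a, b) \<notin> I \<Longrightarrow> proj a b \<epsilon> = []"
  by (simp add: one_eq proj_trace_of word_proj_def)

lemma set_proj: "x \<in> \<M> \<Longrightarrow> (a, b) \<notin> I \<Longrightarrow> set (proj a b x) \<subseteq> {a, b}"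
  by (elim trace_cases) (auto simp: proj_trace_of word_proj_def)

lemma proj_commute: "proj a b x = proj b a x"
  unfolding proj_def word_proj_def by (metis disj_commute)

text \<open>
  A letter that comes first in all its projections commutes with everything to the left of its first
  occurrence, so it can be moved to the front of the word.
\<close>

lemma pull_letter:
  assumes "\<And>b. (a, b) \<notin> I \<Longrightarrow> \<exists>r. word_proj a b w = a # r"
  shows "\<exists>w'. (w, a # w') \<in> trace_cong I"
  using assms
proof (induction w)
  case Nil
  from Nil[of a] show ?case by (simp add: word_proj_def)
next
  case (Cons c w)
  show ?case
  proof (cases "c = a")
    case True
    then show ?thesis using trace_cong.refl by blast
  next
    case False
    have ac: "(a, c) \<in> I"
      using Cons.prems[of c] False by (cases "(a, c) \<in> I") (auto simp: word_proj_def)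
    have "\<exists>r. word_proj a b w = a # r" if "(a, b) \<notin> I" for b
      using Cons.prems[OF that] that ac False by (auto simp: word_proj_def split: if_splits)
    then obtain w' where w': "(w, a # w') \<in> trace_cong I"
      using Cons.IH by blast
    have "([c] @ w, [c] @ (a # w')) \<in> trace_cong I"
      by (intro trace_cong.append trace_cong.refl w')
    moreover have "([c, a] @ w', [a, c] @ w') \<in> trace_cong I"
      using ac by (intro trace_cong.append trace_cong.refl trace_cong.swap) (simp add: indep_sym)
    ultimately have "(c # w, a # c # w') \<in> trace_cong I"
      using trace_cong.trans by fastforce
    then show ?thesis by blast
  qed
qed

lemma word_prefix_if_proj_prefix:
  assumes "\<And>a b. (a, b) \<notin> I \<Longrightarrow> prefix (word_proj a b w) (word_proj a b v)"
  shows "\<exists>u. (v, w @ u) \<in> trace_cong I"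
  using assms
proof (induction w arbitrary: v)
  case Nil
  show ?case by (rule exI[of _ v]) (simp add: trace_cong.refl)
next
  case (Cons c w)
  have "\<exists>r. word_proj c b v = c # r" if "(c, b) \<notin> I" for b
    using Cons.prems[OF that] by (auto simp: word_proj_def prefix_def)
  then obtain v' where v': "(v, c # v') \<in> trace_cong I"
    using pull_letter by blast
  have "prefix (word_proj a b w) (word_proj a b v')" if "(a, b) \<notin> I" for a b
    using Cons.prems[OF that] word_proj_cong[OF v' that]
    by (auto simp: word_proj_def split: if_splits)
  then obtain u where "(v', w @ u) \<in> trace_cong I"
    using Cons.IH by blast
  then have "([c] @ v', [c] @ (w @ u)) \<in> trace_cong I"
    by (intro trace_cong.append trace_cong.refl)
  then have "(v, (c # w) @ u) \<in> trace_cong I"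
    using v' trace_cong.trans by fastforce
  then show ?case by blast
qed

lemma leI: "x \<in> \<M> \<Longrightarrow> y \<in> \<M> \<Longrightarrow> x \<preceq> x \<odot> y"
  unfolding trace_le_def by blast

lemma leE:
  assumes "x \<preceq> y" obtains z where "z \<in> \<M>" "y = x \<odot> z"
  using assms unfolding trace_le_def by blast

text \<open>
  The fundamental tool of this section: it turns questions about traces into questions about prefixes of
  words. Left cancellation, for instance, becomes immediate.
\<close>

lemma le_iff_proj:
  assumes "x \<in> \<M>" "y \<in> \<M>"
  shows "x \<preceq> y \<longleftrightarrow> (\<forall>a b. (a, b) \<notin> I \<longrightarrow> prefix (proj a b x) (proj a b y))"
proof
  assume "x \<preceq> y"
  then show "\<forall>a b. (a, b) \<notin> I \<longrightarrow> prefix (proj a b x) (proj a b y)"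
    using assms by (auto elim!: leE simp: proj_mult)
next
  assume *: "\<forall>a b. (a, b) \<notin> I \<longrightarrow> prefix (proj a b x) (proj a b y)"
  obtain u v where [simp]: "x = \<tau> u" "y = \<tau> v"
    using assms by (metis trace_cases)
  obtain r where "(v, u @ r) \<in> trace_cong I"
    using word_prefix_if_proj_prefix[of u v] * by (auto simp: proj_trace_of)
  then have "y = x \<odot> \<tau> r"
    by (simp add: mult_trace_of trace_of_eq_iff)
  then show "x \<preceq> y" using leI by simp
qed

lemma le_length: "x \<in> \<M> \<Longrightarrow> x \<preceq> y \<Longrightarrow> \<ell> x \<le> \<ell> y"
  by (auto elim!: leE)

lemma le_length_eq: "x \<in> \<M> \<Longrightarrow> x \<preceq> y \<Longrightarrow> \<ell> y \<le> \<ell> x \<Longrightarrow> x = y"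
  by (auto elim!: leE simp: length_0_iff)

lemma le_refl [simp]: "x \<in> \<M> \<Longrightarrow> x \<preceq> x"
  using leI[of x \<epsilon>] by simp

lemma one_le [simp]: "x \<in> \<M> \<Longrightarrow> \<epsilon> \<preceq> x"
  using leI[of \<epsilon> x] by simp

lemma le_in: "x \<in> \<M> \<Longrightarrow> x \<preceq> y \<Longrightarrow> y \<in> \<M>"
  by (auto elim!: leE)

lemma le_trans: "x \<in> \<M> \<Longrightarrow> x \<preceq> y \<Longrightarrow> y \<preceq> z \<Longrightarrow> x \<preceq> z"
  by (auto elim!: leE simp: mult_assoc leI)

lemma mult_mono: "x \<in> \<M> \<Longrightarrow> y \<in> \<M> \<Longrightarrow> y \<preceq> z \<Longrightarrow> x \<odot> y \<preceq> x \<odot> z"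
  by (auto elim!: leE simp: mult_assoc[symmetric] leI)

lemma trace_eqI:
  assumes "x \<in> \<M>" "y \<in> \<M>" "\<And>a b. (a, b) \<notin> I \<Longrightarrow> proj a b x = proj a b y"
  shows "x = y"
proof -
  have "x \<preceq> y" "y \<preceq> x" using assms by (simp_all add: le_iff_proj)
  then show ?thesis using assms le_length le_length_eq by blast
qed

lemma left_cancel:
  assumes "x \<in> \<M>" "y \<in> \<M>" "z \<in> \<M>" "x \<odot> y = x \<odot> z" shows "y = z"
proof (rule trace_eqI[OF assms(2,3)])
  fix a b assume "(a, b) \<notin> I"
  with assms show "proj a b y = proj a b z"
    by (metis proj_mult same_append_eq)
qed

lemma left_cancel_le:
  assumes "x \<in> \<M>" "y \<in> \<M>" "z \<in> \<M>" "x \<odot> y \<preceq> x \<odot> z" shows "y \<preceq> z"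
  using assms by (simp add: le_iff_proj proj_mult)

lemma inj_mult: "x \<in> \<M> \<Longrightarrow> inj_on ((\<odot>) x) \<M>"
  by (auto intro!: inj_onI dest: left_cancel)

definition cnt :: "'a \<Rightarrow> 'a list set \<Rightarrow> nat" where
  "cnt a x = length (proj a a x)"

lemma cnt_trace_of: "cnt a (\<tau> w) = count_list w a"
  by (simp add: cnt_def proj_trace_of word_proj_def count_list_eq_length_filter) (metis)

lemma cnt_mult [simp]: "x \<in> \<M> \<Longrightarrow> y \<in> \<M> \<Longrightarrow> cnt a (x \<odot> y) = cnt a x + cnt a y"
  by (simp add: cnt_def proj_mult)

lemma cnt_one [simp]: "cnt a \<epsilon> = 0"
  by (simp add: cnt_def)

lemma cnt_letter [simp]: "cnt a (\<tau> [b]) = (if a = b then 1 else 0)"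
  by (simp add: cnt_trace_of)

lemma length_eq_sum_cnt: "x \<in> \<M> \<Longrightarrow> \<ell> x = (\<Sum>a\<in>UNIV. cnt a x)"
proof (elim trace_cases)
  fix w assume "x = \<tau> w"
  then show ?thesis using sum_count_set[of w UNIV] by (simp add: cnt_trace_of)
qed

lemma cnt_pos_iff:
  assumes "x \<in> \<M>" "(a, b) \<notin> I" shows "cnt a x > 0 \<longleftrightarrow> a \<in> set (proj a b x)"
  using assms(1)
proof (elim trace_cases)
  fix w assume [simp]: "x = \<tau> w"
  show ?thesis using assms(2) count_notin[of a w] count_list_0_iff[of w a]
    by (auto simp: cnt_trace_of proj_trace_of word_proj_def)
qed

lemma cnt_mono: "x \<in> \<M> \<Longrightarrow> x \<preceq> y \<Longrightarrow> cnt a x \<le> cnt a y"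
  by (auto elim!: leE)

text \<open>
  As \<open>(a, a) \<notin> I\<close>, this also says that \<open>a\<close> does not occur in \<open>x\<close>.
\<close>

definition free_of :: "'a \<Rightarrow> 'a list set \<Rightarrow> bool" where
  "free_of a x \<longleftrightarrow> (\<forall>b. (a, b) \<notin> I \<longrightarrow> cnt b x = 0)"

lemma proj_letter: "(b, c) \<notin> I \<Longrightarrow> proj b c (\<tau> [a]) = (if a = b \<or> a = c then [a] else [])"
  by (simp add: proj_trace_of word_proj_def)

lemma letter_le_iff:
  assumes "x \<in> \<M>"
  shows "\<tau> [a] \<preceq> x \<longleftrightarrow> (\<forall>b. (a, b) \<notin> I \<longrightarrow> (\<exists>r. proj a b x = a # r))"
proof
  assume *: "\<tau> [a] \<preceq> x"
  show "\<forall>b. (a, b) \<notin> I \<longrightarrow> (\<exists>r. proj a b x = a # r)"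
    using * assms by (auto elim!: leE simp: proj_mult proj_letter)
next
  assume *: "\<forall>b. (a, b) \<notin> I \<longrightarrow> (\<exists>r. proj a b x = a # r)"
  have "prefix (proj b c (\<tau> [a])) (proj b c x)" if bc: "(b, c) \<notin> I" for b c
  proof -
    have "\<exists>r. proj b c x = a # r" if "a = b \<or> a = c"
      using that bc * proj_commute[of b c x] indep_sym[of b c] by metis
    then show ?thesis using bc by (auto simp: proj_letter)
  qed
  then show "\<tau> [a] \<preceq> x" using assms by (simp add: le_iff_proj)
qed

lemma free_of_proj:
  assumes "x \<in> \<M>" "free_of a x" "(a, b) \<notin> I" shows "proj a b x = []"
proof -
  have "(b, a) \<notin> I" using assms(3) indep_sym by blast
  then have "a \<notin> set (proj a b x)" "b \<notin> set (proj a b x)"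
    using assms cnt_pos_iff[of x a b] cnt_pos_iff[of x b a] proj_commute[of a b x]
    by (auto simp: free_of_def)
  then show ?thesis using set_proj[OF assms(1,3)] by (cases "proj a b x") auto
qed

lemma free_of_commute:
  assumes "x \<in> \<M>" "free_of a x" shows "\<tau> [a] \<odot> x = x \<odot> \<tau> [a]"
proof (rule trace_eqI)
  fix b c assume bc: "(b, c) \<notin> I"
  show "proj b c (\<tau> [a] \<odot> x) = proj b c (x \<odot> \<tau> [a])"
  proof (cases "a = b \<or> a = c")
    case True
    then have "proj b c x = []"
      using bc free_of_proj[OF assms] proj_commute[of b c x] indep_sym[of b c] by metis
    then show ?thesis using assms bc by (simp add: proj_mult)
  next
    case False
    then show ?thesis using assms bc by (simp add: proj_mult proj_letter)
  qed
qed (use assms in auto)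

text \<open>
  Levi's lemma for traces, in the special case of a single letter on the left.
\<close>

lemma letter_le_mult:
  assumes "x \<in> \<M>" "y \<in> \<M>" "\<tau> [a] \<preceq> x \<odot> y"
  shows "\<tau> [a] \<preceq> x \<or> free_of a x \<and> \<tau> [a] \<preceq> y"
proof -
  have p: "\<exists>r. proj a b x @ proj a b y = a # r" if "(a, b) \<notin> I" for b
    using assms that by (simp add: letter_le_iff proj_mult)
  show ?thesis
  proof (cases "cnt a x > 0")
    case True
    have "\<exists>r. proj a b x = a # r" if "(a, b) \<notin> I" for b
      using p[OF that] True cnt_pos_iff[OF assms(1) that] by (cases "proj a b x") auto
    then show ?thesis using assms by (simp add: letter_le_iff)
  next
    case False
    have e: "proj a b x = []" if "(a, b) \<notin> I" for b
      using p[OF that] False cnt_pos_iff[OF assms(1) that] by (cases "proj a b x") auto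
    have "cnt b x = 0" if "(a, b) \<notin> I" for b
      using e[OF that] cnt_pos_iff[of x b a] assms that indep_sym[of a b] proj_commute[of a b x] by auto
    then have "free_of a x" by (simp add: free_of_def)
    moreover have "\<tau> [a] \<preceq> y"
      using p e assms by (auto simp: letter_le_iff)
    ultimately show ?thesis by blast
  qed
qed

lemma free_of_le: "x \<in> \<M> \<Longrightarrow> x \<preceq> y \<Longrightarrow> free_of a y \<Longrightarrow> free_of a x"
  unfolding free_of_def using cnt_mono by (metis le_0_eq)

lemma trace_induct [consumes 1, case_names one cons]:
  assumes "x \<in> \<M>" "P \<epsilon>" "\<And>a x. x \<in> \<M> \<Longrightarrow> P x \<Longrightarrow> P (\<tau> [a] \<odot> x)"
  shows "P x"
proof -
  have "P (\<tau> w)" for w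
  proof (induction w)
    case Nil show ?case using assms(2) by (simp add: one_eq)
  next
    case (Cons a w)
    from assms(3)[OF _ Cons, of a] show ?case by (simp add: mult_trace_of)
  qed
  then show ?thesis using assms(1) by (metis trace_cases)
qed

lemma trace_rev_cases:
  assumes "x \<in> \<M>" "x \<noteq> \<epsilon>" obtains y a where "y \<in> \<M>" "x = y \<odot> \<tau> [a]"
proof -
  obtain w where w: "x = \<tau> w" using assms trace_cases by blast
  with assms(2) obtain v a where "w = v @ [a]" by (metis one_eq rev_exhaust)
  with w that[of "\<tau> v" a] show ?thesis by (simp add: mult_trace_of)
qed

lemma prefix_of_length:
  assumes "y \<in> \<M>" "n \<le> \<ell> y" shows "\<exists>x\<in>\<M>. x \<preceq> y \<and> \<ell> x = n"
proof -
  obtain w where w: "y = \<tau> w" using assms trace_cases by blast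
  have "\<tau> (take n w) \<preceq> y" using leI[of "\<tau> (take n w)" "\<tau> (drop n w)"] w by (simp add: mult_trace_of)
  then show ?thesis using assms w by (intro bexI[of _ "\<tau> (take n w)"]) auto
qed

text \<open>
  Two traces below \<open>z\<close> are down-closed sets of letter occurrences of \<open>z\<close>, and \<open>w\<close> is their
  intersection. The occurrences of one letter \<open>b\<close> in \<open>z\<close> are linearly ordered, whence the minimum.
  The induction peels off the first letter \<open>a\<close> of \<open>x\<close>: either \<open>y\<close> starts with \<open>a\<close> too, or \<open>a\<close> commutes
  with all of \<open>y\<close>.
\<close>

lemma meet:
  assumes "x \<in> \<M>" "y \<in> \<M>" "x \<preceq> z" "y \<preceq> z"
  shows "\<exists>w\<in>\<M>. w \<preceq> x \<and> w \<preceq> y \<and> (\<forall>b. cnt b w = min (cnt b x) (cnt b y))"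
  using assms
proof (induction arbitrary: y z rule: trace_induct)
  case one
  then show ?case by (intro bexI[of _ \<epsilon>]) auto
next
  case (cons a x)
  from cons.prems(2) cons.hyps obtain z' where z': "z' \<in> \<M>" "z = \<tau> [a] \<odot> x \<odot> z'"
    by (auto elim: leE)
  define z1 where "z1 = x \<odot> z'"
  have z: "z = \<tau> [a] \<odot> z1" "z1 \<in> \<M>" "x \<preceq> z1"
    using z' cons.hyps by (simp_all add: z1_def mult_assoc leI)
  from cons.prems(3) obtain y' where y': "y' \<in> \<M>" "z = y \<odot> y'"
    by (auto elim: leE)
  have "\<tau> [a] \<preceq> y \<odot> y'" using leI[of "\<tau> [a]" z1] y' z by simp
  from letter_le_mult[OF cons.prems(1) y'(1) this] show ?case
  proof
    assume "\<tau> [a] \<preceq> y"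
    then obtain y1 where y1: "y1 \<in> \<M>" "y = \<tau> [a] \<odot> y1" by (auto elim: leE)
    then have "y1 \<preceq> z1"
      using cons.prems(3) z left_cancel_le[of "\<tau> [a]" y1 z1] by simp
    from cons.IH[OF y1(1) z(3) this] obtain w where
      "w \<in> \<M>" "w \<preceq> x" "w \<preceq> y1" "\<forall>b. cnt b w = min (cnt b x) (cnt b y1)" by blast
    then have "\<tau> [a] \<odot> w \<preceq> \<tau> [a] \<odot> x" "\<tau> [a] \<odot> w \<preceq> y" 
      "\<forall>b. cnt b (\<tau> [a] \<odot> w) = min (cnt b (\<tau> [a] \<odot> x)) (cnt b y)" "\<tau> [a] \<odot> w \<in> \<M>"
      using y1 cons.hyps by (simp_all add: mult_mono)
    then show ?thesis by blast
  next
    assume "free_of a y \<and> \<tau> [a] \<preceq> y'"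
    then have fa: "free_of a y" and "\<tau> [a] \<preceq> y'" by auto
    then obtain y1 where y1: "y1 \<in> \<M>" "y' = \<tau> [a] \<odot> y1" by (auto elim: leE)
    have "\<tau> [a] \<odot> z1 = \<tau> [a] \<odot> (y \<odot> y1)"
      using y' y1 z free_of_commute[OF cons.prems(1) fa] cons.prems(1) by (simp add: mult_assoc[symmetric])
    then have "z1 = y \<odot> y1"
      using left_cancel z y1 cons.prems(1) by (metis mult_in trace_of_in)
    then have "y \<preceq> z1" using cons.prems(1) y1 leI by simp
    from cons.IH[OF cons.prems(1) z(3) this] obtain w where
      w: "w \<in> \<M>" "w \<preceq> x" "w \<preceq> y" "\<forall>b. cnt b w = min (cnt b x) (cnt b y)" by blast
    obtain x' where x': "x' \<in> \<M>" "x = w \<odot> x'" using w by (auto elim: leE)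
    have "\<tau> [a] \<odot> x = w \<odot> (\<tau> [a] \<odot> x')"
      using x' w free_of_commute[OF w(1) free_of_le[OF w(1,3) fa]] by (simp add: mult_assoc[symmetric])
    then have "w \<preceq> \<tau> [a] \<odot> x" using w x' leI by simp
    moreover have "cnt a y = 0" using fa by (simp add: free_of_def)
    ultimately have "\<forall>b. cnt b w = min (cnt b (\<tau> [a] \<odot> x)) (cnt b y)"
      using w cons.hyps by simp
    then show ?thesis using w \<open>w \<preceq> \<tau> [a] \<odot> x\<close> by blast
  qed
qed

lemma finite_traces_of_length: "finite {x \<in> \<M>. \<ell> x = n}"
proof -
  have "{x \<in> \<M>. \<ell> x = n} \<subseteq> \<tau> ` {w. set w \<subseteq> UNIV \<and> length w = n}"
    by (auto elim!: trace_cases)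
  then show ?thesis by (rule finite_surj[rotated]) (rule finite_lists_length_eq, simp)
qed

lemma countable_traces: "countable \<M>"
  by (simp add: traces_eq)

end

section \<open>The clique normal form\<close>

context independence begin

definition first_letters :: "'a list set \<Rightarrow> 'a set" where
  "first_letters x = {a. \<tau> [a] \<preceq> x}"

lemma clique_trace_in [simp]: "clique_trace I c \<in> \<M>"
  by (simp add: clique_trace_def)

lemma clique_word:
  obtains w where "distinct w" "set w = c" "clique_trace I c = \<tau> w"
proof -
  have "\<exists>w. distinct w \<and> set w = c"
    using finite_distinct_list[of c] by auto
  from someI_ex[OF this] show thesis by (intro that) (auto simp: clique_trace_def)
qed

lemma cnt_clique: "cnt a (clique_trace I c) = (if a \<in> c then 1 else 0)"
proof -
  obtain w where "distinct w" "set w = c" "clique_trace I c = \<tau> w" by (rule clique_word)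
  moreover have "distinct v \<Longrightarrow> count_list v a = (if a \<in> set v then 1 else 0)" for v
    by (induction v) auto
  ultimately show ?thesis by (simp add: cnt_trace_of)
qed

lemma proj_clique:
  assumes "c \<in> cliques I" "(a, b) \<notin> I"
  shows "proj a b (clique_trace I c) = (if a \<in> c then [a] else if b \<in> c then [b] else [])"
proof -
  obtain w where w: "distinct w" "set w = c" "clique_trace I c = \<tau> w" by (rule clique_word)
  let ?f = "filter (\<lambda>d. d = a \<or> d = b) w"
  have d: "distinct ?f" using w(1) by (rule distinct_filter)
  have single: "xs = [z]" if xs: "distinct xs" "set xs = {z}" for xs :: "'a list" and z
  proof -
    have "length xs = 1" using distinct_card[OF xs(1)] xs(2) by simp
    with xs(2) show ?thesis by (cases xs) simp_all
  qed
  have s: "set ?f = (if a \<in> c then {a} else if b \<in> c then {b} else {})"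
    using assms w(2) by (auto simp: cliques_def)
  have "?f = (if a \<in> c then [a] else if b \<in> c then [b] else [])"
  proof (cases "a \<in> c \<or> b \<in> c")
    case True
    then show ?thesis using single[OF d, of a] single[OF d, of b] s by presburger
  next
    case False
    then have "set ?f = {}" using s by simp
    then have "?f = []" unfolding set_empty .
    with False show ?thesis by presburger
  qed
  then show ?thesis
    using w assms by (simp add: proj_trace_of word_proj_def)
qed

lemma first_letters_clique: "x \<in> \<M> \<Longrightarrow> first_letters x \<in> cliques I"
proof -
  assume x: "x \<in> \<M>"
  { fix a b assume ab: "a \<in> first_letters x" "b \<in> first_letters x" "a \<noteq> b"
    have "(a, b) \<in> I"
    proof (rule ccontr)
      assume dep: "(a, b) \<notin> I"
      then have "\<exists>r. proj a b x = a # r"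
        using ab(1) x by (simp add: first_letters_def letter_le_iff)
      moreover have "\<exists>s. proj b a x = b # s"
        using ab(2) x dep indep_sym[of a b] by (simp add: first_letters_def letter_le_iff)
      ultimately show False using ab(3) proj_commute[of a b x] by auto
    qed }
  then show ?thesis by (auto simp: cliques_def)
qed

lemma clique_trace_le:
  assumes "c \<in> cliques I" "x \<in> \<M>" "c \<subseteq> first_letters x"
  shows "clique_trace I c \<preceq> x"
proof -
  have "prefix (proj a b (clique_trace I c)) (proj a b x)" if "(a, b) \<notin> I" for a b
  proof -
    have "\<exists>r. proj a b x = a # r" if "a \<in> c"
      using that assms \<open>(a, b) \<notin> I\<close> by (auto simp: first_letters_def letter_le_iff)
    moreover have "\<exists>r. proj b a x = b # r" if "b \<in> c"
      using that assms \<open>(a, b) \<notin> I\<close> indep_sym[of a b]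
      by (auto simp: first_letters_def letter_le_iff)
    ultimately show ?thesis
      using proj_clique[OF assms(1) that] proj_commute[of a b x] by auto
  qed
  then show ?thesis using assms by (simp add: le_iff_proj)
qed

lemma letter_le_clique: "a \<in> c \<Longrightarrow> c \<in> cliques I \<Longrightarrow> \<tau> [a] \<preceq> clique_trace I c"
  by (simp add: letter_le_iff proj_clique)

lemma letter_le_cnt: "x \<in> \<M> \<Longrightarrow> \<tau> [a] \<preceq> x \<Longrightarrow> cnt a x > 0"
  using cnt_mono[of "\<tau> [a]" x a] by simp

lemma first_letters_of_clique: "c \<in> cliques I \<Longrightarrow> first_letters (clique_trace I c) = c"
  using letter_le_clique letter_le_cnt[of "clique_trace I c"]
  by (fastforce simp: first_letters_def cnt_clique split: if_splits)

lemma first_letters_eq_empty: "x \<in> \<M> \<Longrightarrow> first_letters x = {} \<longleftrightarrow> x = \<epsilon>"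
proof
  assume x: "x \<in> \<M>" "first_letters x = {}"
  obtain w where w: "x = \<tau> w" using x trace_cases by blast
  show "x = \<epsilon>"
  proof (cases w)
    case (Cons a v)
    then have "\<tau> [a] \<preceq> x" using leI[of "\<tau> [a]" "\<tau> v"] w by (simp add: mult_trace_of)
    with x show ?thesis by (auto simp: first_letters_def)
  qed (simp add: w one_eq)
next
  assume "x = \<epsilon>"
  then show "first_letters x = {}"
    using letter_le_cnt[of \<epsilon>] by (auto simp: first_letters_def)
qed

text \<open>
  The sets \<open>first_letters x\<close>, \<open>first_letters (rest x)\<close>, \<open>\<dots>\<close> are the successive cliques of the
  normal form of \<open>x\<close>; they are eventually empty.
\<close>

definition rest :: "'a list set \<Rightarrow> 'a list set" where
  "rest x = (SOME z. z \<in> \<M> \<and> x = clique_trace I (first_letters x) \<odot> z)"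

lemma rest:
  assumes "x \<in> \<M>" shows "rest x \<in> \<M>" "clique_trace I (first_letters x) \<odot> rest x = x"
proof -
  have "\<exists>z. z \<in> \<M> \<and> x = clique_trace I (first_letters x) \<odot> z"
    using clique_trace_le[OF first_letters_clique[OF assms] assms] by (auto elim: leE)
  from someI_ex[OF this] show "rest x \<in> \<M>" "clique_trace I (first_letters x) \<odot> rest x = x"
    unfolding rest_def by metis+
qed

lemma rest_funpow_in [simp]: "x \<in> \<M> \<Longrightarrow> (rest ^^ n) x \<in> \<M>"
  by (induction n) (auto simp: rest)

lemma rest_eqI: "x \<in> \<M> \<Longrightarrow> z \<in> \<M> \<Longrightarrow> x = clique_trace I (first_letters x) \<odot> z \<Longrightarrow> rest x = z"
  using rest[of x] left_cancel[of "clique_trace I (first_letters x)" "rest x" z] by simp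

lemma rest_one: "rest \<epsilon> = \<epsilon>"
proof -
  have "clique_trace I {} = \<epsilon>"
    by (rule trace_eqI) (auto simp: proj_clique cliques_def)
  then show ?thesis
    using rest[of \<epsilon>] first_letters_eq_empty[of \<epsilon>] by simp
qed

text \<open>
  A first letter of the remainder that is independent of the whole clique could be moved in front of it;
  it would then belong to the clique and be independent of itself.
\<close>

lemma arrow_rest:
  assumes "x \<in> \<M>" shows "clique_arrow I (first_letters x) (first_letters (rest x))"
proof -
  let ?c = "clique_trace I (first_letters x)"
  { fix b assume b: "b \<in> first_letters (rest x)" and *: "\<forall>a\<in>first_letters x. (a, b) \<in> I"
    then obtain z where z: "z \<in> \<M>" "rest x = \<tau> [b] \<odot> z"
      by (auto simp: first_letters_def elim: leE)
    have "free_of b ?c"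
      using * indep_sym by (auto simp: free_of_def cnt_clique)
    then have "x = \<tau> [b] \<odot> (?c \<odot> z)"
      using rest[OF assms] z free_of_commute[of ?c b] by (simp add: mult_assoc[symmetric])
    then have "b \<in> first_letters x"
      using z leI[of "\<tau> [b]" "?c \<odot> z"] by (simp add: first_letters_def)
    with * have False by auto }
  then show ?thesis unfolding clique_arrow_def by blast
qed

primrec clique_product :: "'a set list \<Rightarrow> 'a list set" where
  "clique_product [] = \<epsilon>"
| "clique_product (c # cs) = clique_trace I c \<odot> clique_product cs"

lemma clique_product_in [simp]: "clique_product cs \<in> \<M>"
  by (induction cs) auto

lemma clique_product_append: "clique_product (cs @ ds) = clique_product cs \<odot> clique_product ds"
  by (induction cs) (auto simp: mult_assoc)

definition normal_form :: "nat \<Rightarrow> 'a list set \<Rightarrow> 'a set list" where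
  "normal_form n x = map (\<lambda>i. first_letters ((rest ^^ i) x)) [0..<n]"

lemma length_normal_form [simp]: "length (normal_form n x) = n"
  by (simp add: normal_form_def)

lemma normal_form_0 [simp]: "normal_form 0 x = []"
  by (simp add: normal_form_def)

lemma normal_form_Suc: "normal_form (Suc n) x = normal_form n x @ [first_letters ((rest ^^ n) x)]"
  by (simp add: normal_form_def)

lemma normal_form_Suc_Cons: "normal_form (Suc n) x = first_letters x # normal_form n (rest x)"
  unfolding normal_form_def map_upt_Suc by (simp add: funpow_swap1)

lemma normal_form_product:
  "x \<in> \<M> \<Longrightarrow> clique_product (normal_form n x) \<odot> (rest ^^ n) x = x"
proof (induction n)
  case (Suc n)
  then show ?case
    using rest[of "(rest ^^ n) x"]
    by (simp add: normal_form_Suc clique_product_append mult_assoc)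
qed auto

text \<open>
  This makes \<open>x \<le> y\<close> a condition on the first \<open>|x|\<close> cliques of \<open>y\<close>. Each letter of \<open>x\<close> needs at most
  one more clique: if \<open>x = x\<^sub>1 a\<close> and \<open>x\<^sub>1\<close> is below the first \<open>n\<close> cliques, then \<open>a\<close> is either available
  within these cliques already or commutes with the unused part of them and is then a letter of the next
  clique.
\<close>

lemma le_normal_form:
  assumes "x \<in> \<M>" "y \<in> \<M>" "x \<preceq> y" "\<ell> x \<le> n"
  shows "x \<preceq> clique_product (normal_form n y)"
  using assms(1,3,4)
proof (induction n arbitrary: x)
  case 0
  then show ?case by (simp add: length_0_iff)
next
  case (Suc n)
  show ?case
  proof (cases "x = \<epsilon>")
    case False
    then obtain x1 a where x1: "x1 \<in> \<M>" "x = x1 \<odot> \<tau> [a]"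
      using Suc.prems trace_rev_cases by blast
    let ?P = "clique_product (normal_form n y)" and ?R = "(rest ^^ n) y"
    let ?K = "clique_trace I (first_letters ?R)"
    have "x1 \<preceq> x" using x1 leI by simp
    from le_trans[OF x1(1) this Suc.prems(2)] have "x1 \<preceq> ?P"
      using Suc.IH[OF x1(1)] Suc.prems(3) x1 by simp
    then obtain z where z: "z \<in> \<M>" "?P = x1 \<odot> z" by (auto elim: leE)
    have "x1 \<odot> \<tau> [a] \<preceq> x1 \<odot> (z \<odot> ?R)"
      using Suc.prems(2) z x1 normal_form_product[OF assms(2), of n] assms(2) by (simp add: mult_assoc)
    from left_cancel_le[OF x1(1) _ _ this] have "\<tau> [a] \<preceq> z \<odot> ?R"
      using z assms(2) by simp
    from letter_le_mult[OF z(1) rest_funpow_in[OF assms(2)] this]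
    have "\<tau> [a] \<preceq> z \<odot> ?K"
    proof (elim disjE conjE)
      assume "\<tau> [a] \<preceq> z"
      then show ?thesis using le_trans[OF _ _ leI[of z ?K]] z by simp
    next
      assume f: "free_of a z" and "\<tau> [a] \<preceq> ?R"
      then have "\<tau> [a] \<preceq> ?K"
        using first_letters_clique[of ?R] assms(2)
        by (intro letter_le_clique) (auto simp: first_letters_def)
      then have "\<tau> [a] \<preceq> \<tau> [a] \<odot> z" "z \<odot> \<tau> [a] \<preceq> z \<odot> ?K"
        using z by (auto intro: leI mult_mono)
      then show ?thesis using free_of_commute[OF z(1) f] le_trans[of "\<tau> [a]" "z \<odot> \<tau> [a]"] by simp
    qed
    then have "x1 \<odot> \<tau> [a] \<preceq> x1 \<odot> (z \<odot> ?K)"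
      using x1 by (simp add: mult_mono)
    then show ?thesis
      using z x1 by (simp add: normal_form_Suc clique_product_append mult_assoc)
  qed simp
qed

definition clique_chain :: "'a set list \<Rightarrow> bool" where
  "clique_chain cs \<longleftrightarrow> set cs \<subseteq> cliques I \<and> successively (clique_arrow I) cs"

lemma clique_chain_Cons:
  "clique_chain (c # cs) \<longleftrightarrow>
     c \<in> cliques I \<and> clique_chain cs \<and> (cs \<noteq> [] \<longrightarrow> clique_arrow I c (hd cs))"
  by (cases cs) (auto simp: clique_chain_def)

lemma clique_chain_normal_form: "x \<in> \<M> \<Longrightarrow> clique_chain (normal_form n x)"
proof (induction n arbitrary: x)
  case (Suc n)
  have "normal_form n (rest x) = [] \<or> hd (normal_form n (rest x)) = first_letters (rest x)"
    by (cases n) (simp_all add: normal_form_Suc_Cons)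
  then show ?case
    using Suc rest[of x] first_letters_clique[of x] arrow_rest[of x]
    by (auto simp: normal_form_Suc_Cons clique_chain_Cons)
qed (simp add: clique_chain_def)

lemma first_letters_clique_product:
  "clique_chain (c # cs) \<Longrightarrow> first_letters (clique_product (c # cs)) = c"
proof (induction cs arbitrary: c)
  case Nil
  then show ?case by (simp add: first_letters_of_clique clique_chain_Cons)
next
  case (Cons d cs)
  then have c: "c \<in> cliques I" "clique_arrow I c d"
    and d: "first_letters (clique_product (d # cs)) = d"
    by (auto simp: clique_chain_Cons)
  show ?case
  proof (intro equalityI subsetI)
    fix a assume "a \<in> first_letters (clique_product (c # d # cs))"
    then have "\<tau> [a] \<preceq> clique_trace I c \<odot> clique_product (d # cs)"
      by (simp add: first_letters_def)
    then consider "\<tau> [a] \<preceq> clique_trace I c"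
      | "free_of a (clique_trace I c)" "\<tau> [a] \<preceq> clique_product (d # cs)"
      using letter_le_mult[of "clique_trace I c" "clique_product (d # cs)" a] by auto
    then show "a \<in> c"
    proof cases
      case 1
      then show ?thesis using first_letters_of_clique[OF c(1)] by (auto simp: first_letters_def)
    next
      case 2
      then have "a \<in> d" using d by (auto simp: first_letters_def)
      then obtain b where "b \<in> c" "(b, a) \<notin> I" using c(2) by (auto simp: clique_arrow_def)
      with 2(1) show ?thesis using indep_sym[of a b] by (auto simp: free_of_def cnt_clique)
    qed
  next
    fix a assume "a \<in> c"
    with letter_le_clique[OF this c(1)] show "a \<in> first_letters (clique_product (c # d # cs))"
      using le_trans[OF _ _ leI[of "clique_trace I c" "clique_product (d # cs)"]]
      by (simp add: first_letters_def)
  qed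
qed

lemma normal_form_clique_product:
  "clique_chain cs \<Longrightarrow> n \<le> length cs \<Longrightarrow> normal_form n (clique_product cs) = take n cs"
proof (induction cs arbitrary: n)
  case (Cons c cs)
  have f: "first_letters (clique_product (c # cs)) = c"
    using Cons.prems first_letters_clique_product by blast
  then have "rest (clique_product (c # cs)) = clique_product cs"
    by (intro rest_eqI) auto
  with f Cons show ?case
    by (cases n) (auto simp: normal_form_Suc_Cons clique_chain_Cons simp del: clique_product.simps)
qed simp

text \<open>
  Once a clique is empty, nothing remains, so a normal form containing the empty clique belongs to a
  single trace. This is why such normal forms get no mass in the limit below.
\<close>

lemma normal_form_empty_clique:
  assumes "x \<in> \<M>" "{} \<in> set (normal_form n x)"
  shows "x = clique_product (normal_form n x)"
proof -
  from assms(2) obtain i where i: "i < n" "first_letters ((rest ^^ i) x) = {}"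
    by (auto simp: normal_form_def)
  then have "(rest ^^ i) x = \<epsilon>"
    using assms(1) by (simp add: first_letters_eq_empty)
  moreover have "(rest ^^ k) \<epsilon> = \<epsilon>" for k
    by (induction k) (auto simp: rest_one)
  ultimately have "(rest ^^ ((n - i) + i)) x = \<epsilon>"
    unfolding funpow_add by simp
  then have "(rest ^^ n) x = \<epsilon>" using i by simp
  then show ?thesis using normal_form_product[OF assms(1), of n] by simp
qed

lemma clique_prefix_eq: "clique_prefix I \<omega> n = clique_product (map \<omega> [0..<n])"
  by (induction n) (auto simp: clique_product_append)

lemma clique_prefix_in [simp]: "clique_prefix I \<omega> n \<in> \<M>"
  by (simp add: clique_prefix_eq)

lemma clique_prefix_mono: "m \<le> n \<Longrightarrow> clique_prefix I \<omega> m \<preceq> clique_prefix I \<omega> n"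
proof -
  assume "m \<le> n"
  then have "[0..<n] = [0..<m] @ [m..<n]" by (metis le0 le_add_diff_inverse upt_add_eq_append)
  then show ?thesis by (simp add: clique_prefix_eq clique_product_append leI)
qed

lemma clique_chain_prefix: "\<omega> \<in> infinite_traces I \<Longrightarrow> clique_chain (map \<omega> [0..<n])"
  by (auto simp: clique_chain_def infinite_traces_def successively_conv_nth)

text \<open>
  The analogue of \<open>le_normal_form\<close> for infinite traces: the cliques of \<open>\<omega>\<close> are the normal form of
  each sufficiently long prefix.
\<close>

lemma trace_le_inf_iff:
  assumes "\<omega> \<in> infinite_traces I" "x \<in> \<M>"
  shows "trace_le_inf I x \<omega> \<longleftrightarrow> x \<preceq> clique_product (map \<omega> [0..<\<ell> x])"
proof
  assume "trace_le_inf I x \<omega>"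
  then obtain n where n: "x \<preceq> clique_prefix I \<omega> n" by (auto simp: trace_le_inf_def)
  define N where "N = max n (\<ell> x)"
  have "x \<preceq> clique_prefix I \<omega> N"
    using le_trans[OF assms(2) n clique_prefix_mono] by (simp add: N_def)
  then have "x \<preceq> clique_product (normal_form (\<ell> x) (clique_prefix I \<omega> N))"
    using assms by (intro le_normal_form) auto
  moreover have "normal_form (\<ell> x) (clique_prefix I \<omega> N) = map \<omega> [0..<\<ell> x]"
    unfolding clique_prefix_eq using clique_chain_prefix[OF assms(1)]
    by (subst normal_form_clique_product) (auto simp: N_def take_map)
  ultimately show "x \<preceq> clique_product (map \<omega> [0..<\<ell> x])" by simp
next
  assume "x \<preceq> clique_product (map \<omega> [0..<\<ell> x])"
  then show "trace_le_inf I x \<omega>" unfolding trace_le_inf_def clique_prefix_eq by blast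
qed

lemma up_iff_prefix:
  "x \<in> \<M> \<Longrightarrow> \<omega> \<in> up I x \<longleftrightarrow> \<omega> \<in> infinite_traces I \<and> (\<exists>n. x \<preceq> clique_prefix I \<omega> n)"
  by (simp add: up_def trace_le_inf_def)

lemma clique_prefix_in_up: "\<omega> \<in> infinite_traces I \<Longrightarrow> \<omega> \<in> up I (clique_prefix I \<omega> n)"
  using le_refl up_iff_prefix by (metis clique_prefix_in)

lemma up_mono:
  assumes "x \<in> \<M>" "x \<preceq> y" shows "up I y \<subseteq> up I x"
proof
  fix \<omega> assume "\<omega> \<in> up I y"
  then obtain n where "\<omega> \<in> infinite_traces I" "y \<preceq> clique_prefix I \<omega> n"
    using le_in[OF assms] by (auto simp: up_iff_prefix)
  then show "\<omega> \<in> up I x"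
    using assms(1) le_trans[OF assms] up_iff_prefix by blast
qed

lemma up_common:
  assumes "x \<in> \<M>" "y \<in> \<M>" "\<omega> \<in> up I x" "\<omega> \<in> up I y"
  shows "\<exists>z\<in>\<M>. x \<preceq> z \<and> y \<preceq> z \<and> \<omega> \<in> up I z"
proof -
  obtain m n where mn: "x \<preceq> clique_prefix I \<omega> m" "y \<preceq> clique_prefix I \<omega> n"
    and \<omega>: "\<omega> \<in> infinite_traces I"
    using assms by (auto simp: up_iff_prefix)
  let ?z = "clique_prefix I \<omega> (max m n)"
  have "x \<preceq> ?z" "y \<preceq> ?z"
    using le_trans[OF _ mn(1) clique_prefix_mono] le_trans[OF _ mn(2) clique_prefix_mono] assms by auto
  then show ?thesis using clique_prefix_in_up[OF \<omega>] by (intro bexI[of _ ?z]) auto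
qed

lemma up_one [simp]: "up I \<epsilon> = infinite_traces I"
  by (auto simp: up_iff_prefix)

lemma up_subset: "up I x \<subseteq> infinite_traces I"
  by (auto simp: up_def)

lemma length_clique_prefix: "\<omega> \<in> infinite_traces I \<Longrightarrow> n \<le> \<ell> (clique_prefix I \<omega> n)"
proof (induction n)
  case (Suc n)
  then obtain a where "a \<in> \<omega> n" by (auto simp: infinite_traces_def)
  then have "\<tau> [a] \<preceq> clique_trace I (\<omega> n)"
    using Suc.prems by (intro letter_le_clique) (auto simp: infinite_traces_def)
  from le_length[OF _ this] Suc show ?case by simp
qed simp

end

section \<open>Probability measures on infinite traces\<close>

text \<open>
  A probability measure on sequences with prescribed prefix probabilities \<open>p\<close> is obtained as the image of
  Lebesgue measure on the unit interval. The interval is cut into consecutive cells of lengths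
  \<open>p [c]\<close>, each of these into cells of lengths \<open>p [c, d]\<close>, and so on. A point is sent to the sequence
  that lists the cells containing it. The enumeration fixes the order of the cells inside their parent
  cell.
\<close>

definition enum_bij :: "nat \<Rightarrow> 'c::finite" where
  "enum_bij = (SOME h. bij_betw h {..<CARD('c)} UNIV)"

definition rank :: "'c::finite \<Rightarrow> nat" where
  "rank = inv_into {..<CARD('c)} enum_bij"

lemma enum_bij: "bij_betw (enum_bij :: nat \<Rightarrow> 'c::finite) {..<CARD('c)} UNIV"
proof -
  have "\<exists>h :: nat \<Rightarrow> 'c. bij_betw h {..<CARD('c)} UNIV"
    using ex_bij_betw_nat_finite[of "UNIV :: 'c set"] by (simp add: atLeast0LessThan)
  from someI_ex[OF this] show ?thesis by (simp add: enum_bij_def)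
qed

lemma rank_less: "rank (c :: 'c::finite) < CARD('c)"
proof -
  have "c \<in> enum_bij ` {..<CARD('c)}" using enum_bij[where 'c='c] by (simp add: bij_betw_def)
  from inv_into_into[OF this] show ?thesis by (simp add: rank_def)
qed

lemma enum_rank [simp]: "enum_bij (rank c) = (c :: 'c::finite)"
proof -
  have "c \<in> enum_bij ` {..<CARD('c)}" using enum_bij[where 'c='c] by (simp add: bij_betw_def)
  from f_inv_into_f[OF this] show ?thesis by (simp add: rank_def)
qed

lemma rank_enum [simp]: "k < CARD('c) \<Longrightarrow> rank (enum_bij k :: 'c::finite) = k"
  unfolding rank_def using enum_bij[where 'c='c] by (intro inv_into_f_f) (auto simp: bij_betw_def)

definition offset :: "('c::finite \<Rightarrow> real) \<Rightarrow> 'c \<Rightarrow> real" where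
  "offset q c = (\<Sum>i<rank c. q (enum_bij i))"

lemma offset_plus: "offset q c + q c = (\<Sum>i<Suc (rank c). q (enum_bij i))"
  by (simp add: offset_def)

lemma sum_enum: "(\<Sum>i<CARD('c). q (enum_bij i)) = (\<Sum>c\<in>UNIV. q (c :: 'c::finite))"
  by (rule sum.reindex_bij_betw[OF enum_bij])

lemma partial_sum_cell:
  fixes q :: "nat \<Rightarrow> real"
  shows "0 \<le> t \<Longrightarrow> t < (\<Sum>i<n. q i) \<Longrightarrow> \<exists>k<n. (\<Sum>i<k. q i) \<le> t \<and> t < (\<Sum>i<Suc k. q i)"
proof (induction n)
  case (Suc n)
  show ?case
  proof (cases "t < (\<Sum>i<n. q i)")
    case True
    with Suc show ?thesis using less_SucI by blast
  next
    case False
    with Suc show ?thesis by (intro exI[of _ n]) auto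
  qed
qed simp

lemma offset_cell:
  fixes q :: "'c::finite \<Rightarrow> real"
  assumes "\<And>c. 0 \<le> q c" "0 \<le> t" "t < (\<Sum>c\<in>UNIV. q c)"
  shows "\<exists>!c. offset q c \<le> t \<and> t < offset q c + q c"
proof -
  obtain k where k: "k < CARD('c)" "(\<Sum>i<k. q (enum_bij i)) \<le> t" "t < (\<Sum>i<Suc k. q (enum_bij i))"
    using partial_sum_cell[of t "\<lambda>i. q (enum_bij i)" "CARD('c)"] assms sum_enum[of q] by auto
  have "offset q (enum_bij k) \<le> t \<and> t < offset q (enum_bij k) + q (enum_bij k)"
    using k unfolding offset_plus by (simp add: offset_def)
  moreover have "\<not> rank c < rank d"
    if "t < offset q c + q c" "offset q d \<le> t" for c d :: 'c
  proof
    assume "rank c < rank d"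
    then have "(\<Sum>i<Suc (rank c). q (enum_bij i)) \<le> (\<Sum>i<rank d. q (enum_bij i))"
      using assms(1) by (intro sum_mono2) auto
    with that show False unfolding offset_plus by (simp add: offset_def)
  qed
  ultimately show ?thesis
    by (metis enum_rank linorder_neqE_nat)
qed

lemma offset_bounds:
  fixes q :: "'c::finite \<Rightarrow> real"
  assumes "\<And>c. 0 \<le> q c"
  shows "0 \<le> offset q c" "offset q c + q c \<le> (\<Sum>c\<in>UNIV. q c)"
proof -
  show "0 \<le> offset q c" using assms by (simp add: offset_def sum_nonneg)
  have "(\<Sum>i<Suc (rank c). q (enum_bij i)) \<le> (\<Sum>i<CARD('c). q (enum_bij i))"
    using assms rank_less[of c] by (intro sum_mono2) auto
  then show "offset q c + q c \<le> (\<Sum>c\<in>UNIV. q c)"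
    unfolding offset_plus sum_enum .
qed

context
  fixes p :: "'c::finite list \<Rightarrow> real"
begin

text \<open>
  The argument is the reversed word, so that the recursion can go from a cell to its parent cell.
\<close>

primrec left_end :: "'c list \<Rightarrow> real" where
  "left_end [] = 0"
| "left_end (c # v) = left_end v + offset (\<lambda>d. p (rev v @ [d])) c"

definition cell :: "'c list \<Rightarrow> real set" where
  "cell w = {left_end (rev w) ..< left_end (rev w) + p w}"

primrec address :: "real \<Rightarrow> nat \<Rightarrow> 'c list" where
  "address u 0 = []"
| "address u (Suc n) = address u n @ [THE c. u \<in> cell (address u n @ [c])]"

definition itinerary :: "real \<Rightarrow> nat \<Rightarrow> 'c" where
  "itinerary u n = last (address u (Suc n))"

lemma length_address [simp]: "length (address u n) = n"
  by (induction n) auto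

lemma map_itinerary: "map (itinerary u) [0..<n] = address u n"
  by (induction n) (auto simp: itinerary_def)

context
  assumes nonneg: "\<And>w. 0 \<le> p w" and one: "p [] = 1"
    and split: "\<And>w. p w = (\<Sum>c\<in>UNIV. p (w @ [c]))"
begin

lemma cell_split: "u \<in> cell w \<Longrightarrow> \<exists>!c. u \<in> cell (w @ [c])"
  using offset_cell[of "\<lambda>c. p (w @ [c])" "u - left_end (rev w)"] nonneg split[of w]
  by (simp add: cell_def algebra_simps)

lemma cell_subset: "cell (w @ [c]) \<subseteq> cell w"
  using offset_bounds[of "\<lambda>c. p (w @ [c])" c] nonneg split[of w]
  by (auto simp: cell_def)

lemma cell_Nil: "cell [] = {0..<1}"
  by (simp add: cell_def one)

text \<open>
  The cells of words of length \<open>n\<close> partition the unit interval, and \<open>address u n\<close> is the word whose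
  cell contains \<open>u\<close>.
\<close>

lemma cell_iff: "u \<in> {0..<1} \<Longrightarrow> u \<in> cell w \<longleftrightarrow> address u (length w) = w"
proof (induction w rule: rev_induct)
  case Nil
  then show ?case by (simp add: cell_Nil)
next
  case (snoc c w)
  show ?case
  proof
    assume u: "u \<in> cell (w @ [c])"
    then have "u \<in> cell w" using cell_subset by blast
    moreover from this have "(THE c. u \<in> cell (w @ [c])) = c"
      using cell_split u by (intro the1_equality)
    ultimately have "address u (length w) = w" "(THE c. u \<in> cell (w @ [c])) = c"
      using snoc by auto
    then show "address u (length (w @ [c])) = w @ [c]" by simp
  next
    assume *: "address u (length (w @ [c])) = w @ [c]"
    then have "address u (length w) = w" "c = (THE c. u \<in> cell (w @ [c]))" by auto
    moreover from this have "u \<in> cell w" using snoc by simp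
    ultimately show "u \<in> cell (w @ [c])" using theI'[OF cell_split] by metis
  qed
qed

lemma cell_subset_unit: "cell w \<subseteq> {0..<1}"
  by (induction w rule: rev_induct) (use cell_subset cell_Nil in blast)+

lemma itinerary_cylinder:
  "{u \<in> {0..<1}. map (itinerary u) [0..<length w] = w} = cell w"
  unfolding map_itinerary using cell_iff cell_subset_unit[of w] by blast

lemma cell_sets [simp]: "cell w \<in> sets (restrict_space lborel {0..<1})"
  using cell_subset_unit by (auto simp: sets_restrict_space_iff cell_def)

lemma measure_cell: "measure (restrict_space lborel {0..<1}) (cell w) = p w"
  using cell_subset_unit[of w] nonneg[of w] by (simp add: measure_restrict_space cell_def)

end
end

lemma prob_space_unit: "prob_space (restrict_space lborel {0..<1::real})"
  by (rule prob_space_restrict_space) auto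

context independence begin

lemma topspace_infinite_traces: "topspace (infinite_traces_topology I) = infinite_traces I"
  by (auto simp: infinite_traces_topology_def infinite_traces_def)

lemma space_infinite_traces_borel [simp]: "space (infinite_traces_borel I) = infinite_traces I"
  and sets_infinite_traces_borel:
    "sets (infinite_traces_borel I) = sigma_sets (infinite_traces I) {U. openin (infinite_traces_topology I) U}"
proof -
  have "{U. openin (infinite_traces_topology I) U} \<subseteq> Pow (infinite_traces I)"
    using openin_subset[of "infinite_traces_topology I"] by (auto simp: topspace_infinite_traces)
  then show "space (infinite_traces_borel I) = infinite_traces I"
    "sets (infinite_traces_borel I) = sigma_sets (infinite_traces I) {U. openin (infinite_traces_topology I) U}"
    by (simp_all add: infinite_traces_borel_def)
qed

definition cylinder :: "'a set list \<Rightarrow> (nat \<Rightarrow> 'a set) set" where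
  "cylinder w = {\<omega> \<in> infinite_traces I. map \<omega> [0..<length w] = w}"

text \<open>
  The Borel sets are generated by the cylinders: these are open, and each open set is a union of
  cylinders, of which there are only countably many.
\<close>

lemma openin_cylinder: "openin (infinite_traces_topology I) (cylinder w)"
proof -
  let ?D = "\<lambda>_::nat. discrete_topology (cliques I - {{}})"
  let ?X = "\<lambda>i. if i < length w then {w ! i} \<inter> (cliques I - {{}}) else cliques I - {{}}"
  have "openin (product_topology ?D UNIV) (Pi\<^sub>E UNIV ?X)"
    by (rule product_topology_basis) (auto intro: finite_subset[of _ "{..<length w}"])
  moreover have "cylinder w = Pi\<^sub>E UNIV ?X \<inter> infinite_traces I"
  proof (rule Set.set_eqI)
    fix \<omega> :: "nat \<Rightarrow> 'a set"
    have "map \<omega> [0..<length w] = w \<longleftrightarrow> (\<forall>i<length w. \<omega> i = w ! i)"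
      by (subst list_eq_iff_nth_eq) simp
    moreover have "\<omega> i \<in> ?X i \<longleftrightarrow> (i < length w \<longrightarrow> \<omega> i = w ! i)" if "\<omega> \<in> infinite_traces I" for i
    proof -
      have "\<omega> i \<in> cliques I - {{}}" using that by (simp add: infinite_traces_def)
      then show ?thesis by simp
    qed
    ultimately show "\<omega> \<in> cylinder w \<longleftrightarrow> \<omega> \<in> Pi\<^sub>E UNIV ?X \<inter> infinite_traces I"
      unfolding cylinder_def PiE_UNIV_domain Pi_iff Int_iff mem_Collect_eq by blast
  qed
  ultimately show ?thesis
    unfolding infinite_traces_topology_def openin_subtopology by blast
qed

lemma cylinder_sets [simp]: "cylinder w \<in> sets (infinite_traces_borel I)"
  unfolding sets_infinite_traces_borel using openin_cylinder by (intro sigma_sets.Basic) simp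

lemma open_contains_cylinder:
  assumes "openin (infinite_traces_topology I) U" "\<omega> \<in> U"
  shows "\<exists>n. cylinder (map \<omega> [0..<n]) \<subseteq> U"
proof -
  let ?D = "\<lambda>_::nat. discrete_topology (cliques I - {{}})"
  obtain V where V: "openin (product_topology ?D UNIV) V" "U = V \<inter> infinite_traces I"
    using assms(1) unfolding infinite_traces_topology_def openin_subtopology by blast
  then obtain X where X: "finite {i. X i \<noteq> cliques I - {{}}}" "\<omega> \<in> Pi\<^sub>E UNIV X" "Pi\<^sub>E UNIV X \<subseteq> V"
    using product_topology_open_contains_basis[OF V(1), of \<omega>] assms(2) by auto
  obtain n where n: "\<And>i. X i \<noteq> cliques I - {{}} \<Longrightarrow> i < n"
    using X(1) unfolding finite_nat_set_iff_bounded by blast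
  have "\<omega>' \<in> Pi\<^sub>E UNIV X" if "\<omega>' \<in> infinite_traces I" "map \<omega>' [0..<n] = map \<omega> [0..<n]" for \<omega>'
  proof -
    have "\<omega>' i \<in> X i" for i
    proof (cases "i < n")
      case True
      with that(2) have "\<omega>' i = \<omega> i" by simp
      with X(2) show ?thesis by (auto simp: PiE_iff)
    next
      case False
      with n that(1) show ?thesis by (fastforce simp: infinite_traces_def)
    qed
    then show ?thesis by auto
  qed
  with X(3) V(2) have "cylinder (map \<omega> [0..<n]) \<subseteq> U"
    by (auto simp: cylinder_def)
  then show ?thesis ..
qed

lemma open_Union_cylinder:
  assumes "openin (infinite_traces_topology I) U"
  shows "U = (\<Union>w\<in>{w. cylinder w \<subseteq> U}. cylinder w)"
proof -
  have "\<exists>w. cylinder w \<subseteq> U \<and> \<omega> \<in> cylinder w" if \<omega>: "\<omega> \<in> U" for \<omega>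
  proof -
    obtain n where "cylinder (map \<omega> [0..<n]) \<subseteq> U"
      using open_contains_cylinder[OF assms \<omega>] by blast
    moreover have "\<omega> \<in> infinite_traces I"
      using \<omega> openin_subset[OF assms] by (auto simp: topspace_infinite_traces)
    ultimately show ?thesis
      by (intro exI[of _ "map \<omega> [0..<n]"]) (auto simp: cylinder_def)
  qed
  then show ?thesis by blast
qed

lemma measurable_infinite_traces:
  assumes "X \<in> space N \<rightarrow> infinite_traces I"
    "\<And>w. X -` cylinder w \<inter> space N \<in> sets N"
  shows "X \<in> measurable N (infinite_traces_borel I)"
  unfolding infinite_traces_borel_def
proof (rule measurable_measure_of)
  show "{U. openin (infinite_traces_topology I) U} \<subseteq> Pow (infinite_traces I)"
    using openin_subset[of "infinite_traces_topology I"] by (auto simp: topspace_infinite_traces)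
  show "X -` U \<inter> space N \<in> sets N" if "U \<in> {U. openin (infinite_traces_topology I) U}" for U
  proof -
    have "X -` U \<inter> space N = (\<Union>w\<in>{w. cylinder w \<subseteq> U}. X -` cylinder w \<inter> space N)"
      using that open_Union_cylinder[of U] by blast
    also have "\<dots> \<in> sets N"
      using assms(2) by (intro sets.countable_UN') auto
    finally show ?thesis .
  qed
qed (use assms in auto)

lemma up_Union_cylinder:
  assumes "x \<in> \<M>"
  shows "up I x = (\<Union>w\<in>{w. length w = \<ell> x \<and> x \<preceq> clique_product w}. cylinder w)"
proof (intro equalityI subsetI)
  fix \<omega> assume "\<omega> \<in> up I x"
  then have "\<omega> \<in> infinite_traces I" "x \<preceq> clique_product (map \<omega> [0..<\<ell> x])"
    using trace_le_inf_iff[OF _ assms] by (auto simp: up_def)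
  then show "\<omega> \<in> (\<Union>w\<in>{w. length w = \<ell> x \<and> x \<preceq> clique_product w}. cylinder w)"
    by (intro UN_I[of "map \<omega> [0..<\<ell> x]"]) (auto simp: cylinder_def)
next
  fix \<omega> assume "\<omega> \<in> (\<Union>w\<in>{w. length w = \<ell> x \<and> x \<preceq> clique_product w}. cylinder w)"
  then show "\<omega> \<in> up I x"
    using trace_le_inf_iff[OF _ assms] by (auto simp: up_def cylinder_def)
qed

lemma finite_clique_words: "finite {w :: 'a set list. length w = n \<and> P w}"
  using finite_lists_length_eq[of "UNIV :: 'a set set" n] by (rule finite_subset[rotated]) auto

lemma up_sets [simp]: "x \<in> \<M> \<Longrightarrow> up I x \<in> sets (infinite_traces_borel I)"
  unfolding up_Union_cylinder by (intro sets.finite_UN finite_clique_words) auto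

text \<open>
  Every point of a cell of \<open>w\<close> witnesses \<open>p w > 0\<close>; so if \<open>p\<close> vanishes on all words that are not prefixes
  of infinite traces, then all points of the unit interval, not only almost all, are mapped to infinite
  traces.
\<close>

theorem clique_chain_measure:
  assumes "\<And>w. 0 \<le> p w" "p [] = 1" "\<And>w. p w = (\<Sum>c\<in>UNIV. p (w @ [c]))"
    and supp: "\<And>w. p w \<noteq> 0 \<Longrightarrow> clique_chain w \<and> {} \<notin> set w"
  shows "\<exists>m. prob_space m \<and> sets m = sets (infinite_traces_borel I) \<and>
    (\<forall>x\<in>\<M>. measure m (up I x) = (\<Sum>w | length w = \<ell> x \<and> x \<preceq> clique_product w. p w))"
proof -
  let ?N = "restrict_space lborel {0..<1::real}" and ?X = "itinerary p"
  define m where "m = distr ?N (infinite_traces_borel I) ?X"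
  have X: "?X u \<in> infinite_traces I" if u: "u \<in> {0..<1}" for u
  proof -
    have chain: "clique_chain (map (?X u) [0..<n]) \<and> {} \<notin> set (map (?X u) [0..<n])" for n
    proof (rule supp)
      have "u \<in> cell p (address p u n)" using cell_iff[OF assms(1-3) u] by simp
      then show "p (map (?X u) [0..<n]) \<noteq> 0" by (auto simp: map_itinerary cell_def)
    qed
    have "?X u i \<in> cliques I \<and> ?X u i \<noteq> {} \<and> clique_arrow I (?X u i) (?X u (Suc i))" for i
      using chain[of "Suc (Suc i)"]
      by (auto simp: clique_chain_def successively_append_iff)
    then show ?thesis by (simp add: infinite_traces_def)
  qed
  have vim: "?X -` cylinder w \<inter> {0..<1} = cell p w" for w
    unfolding itinerary_cylinder[OF assms(1-3), of w, symmetric] cylinder_def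
    using X by blast
  have space_N: "space ?N = {0..<1}" by (simp add: space_restrict_space)
  have meas: "?X \<in> measurable ?N (infinite_traces_borel I)"
    by (rule measurable_infinite_traces) (use X vim cell_sets[OF assms(1-3)] in \<open>auto simp: space_N\<close>)
  interpret m: prob_space m
    unfolding m_def by (rule prob_space.prob_space_distr[OF prob_space_unit meas])
  have sets_m: "sets m = sets (infinite_traces_borel I)" by (simp add: m_def)
  have cyl: "measure m (cylinder w) = p w" for w
    unfolding m_def using vim[of w] measure_cell[OF assms(1-3), of w]
    by (subst measure_distr[OF meas]) (simp_all add: space_N)
  have "measure m (up I x) = (\<Sum>w | length w = \<ell> x \<and> x \<preceq> clique_product w. p w)" if "x \<in> \<M>" for x
  proof -
    have "measure m (up I x) = (\<Sum>w | length w = \<ell> x \<and> x \<preceq> clique_product w. measure m (cylinder w))"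
      unfolding up_Union_cylinder[OF that]
    proof (rule m.finite_measure_finite_Union)
      show "disjoint_family_on cylinder {w. length w = \<ell> x \<and> x \<preceq> clique_product w}"
        by (auto simp: disjoint_family_on_def cylinder_def)
    qed (use finite_clique_words sets_m in auto)
    then show ?thesis by (simp add: cyl)
  qed
  with m.prob_space_axioms sets_m show ?thesis by blast
qed

end

section \<open>Irreducible systems and valuations\<close>

locale irreducible_system =
  fixes I :: "'a::finite rel" and act :: "'s::finite option \<Rightarrow> 'a list set \<Rightarrow> 's option"
  assumes irreducible: "irreducible_concurrent_system I act"

sublocale irreducible_system \<subseteq> independence I
  using irreducible by unfold_locales
    (auto simp: irreducible_concurrent_system_def concurrent_system_def)

context irreducible_system begin

lemma act_one [simp]: "act s \<epsilon> = s"
  and act_mult: "x \<in> \<M> \<Longrightarrow> y \<in> \<M> \<Longrightarrow> act s (x \<odot> y) = act (act s x) y"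
  and act_None [simp]: "x \<in> \<M> \<Longrightarrow> act None x = None"
  using irreducible unfolding irreducible_concurrent_system_def concurrent_system_def by blast+

lemma reachable: "\<exists>x\<in>\<M>. act (Some \<alpha>) x = Some \<beta>"
proof -
  have "traces_between I act \<alpha> \<beta> \<noteq> {}"
    using irreducible unfolding irreducible_concurrent_system_def transitive_system_def by blast
  then show ?thesis by (auto simp: traces_between_def)
qed

lemma letter_reachable: "\<exists>u\<in>\<M>. act (Some \<alpha>) (u \<odot> \<tau> [a]) \<noteq> None"
  using irreducible unfolding irreducible_concurrent_system_def by blast

lemma dependence_connected: "(a, b) \<in> (UNIV - I)\<^sup>*"
  using irreducible unfolding irreducible_concurrent_system_def irreducible_trace_monoid_def by blast

lemma act_prefix: "x \<in> \<M> \<Longrightarrow> y \<in> \<M> \<Longrightarrow> act s (x \<odot> y) \<noteq> None \<Longrightarrow> act s x \<noteq> None"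
  by (cases "act s x") (auto simp: act_mult)

lemma loop: "\<exists>x\<in>\<M>. act (Some \<alpha>) x = Some \<alpha> \<and> \<ell> x > 0"
proof -
  fix a
  obtain u \<beta> where u: "u \<in> \<M>" "act (Some \<alpha>) (u \<odot> \<tau> [a]) = Some \<beta>"
    using letter_reachable[of \<alpha> a] by blast
  obtain v where v: "v \<in> \<M>" "act (Some \<beta>) v = Some \<alpha>" using reachable by blast
  show ?thesis
    using u v by (intro bexI[of _ "u \<odot> \<tau> [a] \<odot> v"]) (auto simp: act_mult)
qed

text \<open>
  A total version of \<open>f\<^bsub>\<alpha> \<cdot> x\<^esub>\<close> that is zero after a forbidden trace, so that the multiplicativity of
  valuations needs no case distinction.
\<close>

definition at_state :: "('s \<Rightarrow> 'a list set \<Rightarrow> real) \<Rightarrow> 's option \<Rightarrow> 'a list set \<Rightarrow> real" where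
  "at_state f s x = (case s of None \<Rightarrow> 0 | Some \<beta> \<Rightarrow> f \<beta> x)"

lemma at_state_simps [simp]: "at_state f None x = 0" "at_state f (Some \<beta>) x = f \<beta> x"
  by (simp_all add: at_state_def)

lemma valuation_nonneg: "valuation I act f \<Longrightarrow> x \<in> \<M> \<Longrightarrow> 0 \<le> f \<alpha> x"
  and valuation_pos_iff: "valuation I act f \<Longrightarrow> x \<in> \<M> \<Longrightarrow> 0 < f \<alpha> x \<longleftrightarrow> act (Some \<alpha>) x \<noteq> None"
  unfolding valuation_def by blast+

lemma valuation_mult:
  "valuation I act f \<Longrightarrow> x \<in> \<M> \<Longrightarrow> y \<in> \<M> \<Longrightarrow>
    f \<alpha> (x \<odot> y) = f \<alpha> x * at_state f (act (Some \<alpha>) x) y"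
  unfolding valuation_def at_state_def by (auto split: option.split)

lemma valuation_None: "valuation I act f \<Longrightarrow> x \<in> \<M> \<Longrightarrow> act (Some \<alpha>) x = None \<Longrightarrow> f \<alpha> x = 0"
  using valuation_nonneg[of f x \<alpha>] valuation_pos_iff[of f x \<alpha>] by force

lemma valuation_one: "valuation I act f \<Longrightarrow> f \<alpha> \<epsilon> = 1"
  using valuation_mult[of f \<epsilon> \<epsilon> \<alpha>] valuation_pos_iff[of f \<epsilon> \<alpha>] by simp

lemma at_state_nonneg: "valuation I act f \<Longrightarrow> x \<in> \<M> \<Longrightarrow> 0 \<le> at_state f s x"
  by (cases s) (simp_all add: valuation_nonneg)

lemma valuation_twisted:
  assumes "valuation I act f" "0 < r" "positive_cocycle \<Gamma>"
  shows "valuation I act (twisted_valuation act f r \<Gamma>)"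
  unfolding valuation_def
proof (intro conjI allI ballI)
  have \<Gamma>: "\<Gamma> \<alpha> \<beta> > 0" "\<Gamma> \<alpha> \<gamma> = \<Gamma> \<alpha> \<beta> * \<Gamma> \<beta> \<gamma>" for \<alpha> \<beta> \<gamma>
    using assms(3) by (auto simp: positive_cocycle_def cocycle_def)
  fix \<alpha> x assume x: "x \<in> \<M>"
  show nn: "0 \<le> twisted_valuation act f r \<Gamma> \<alpha> x"
    using valuation_nonneg[OF assms(1) x, of \<alpha>] \<Gamma>(1) assms(2)
    by (auto simp: twisted_valuation_def less_imp_le split: option.split)
  show "0 < twisted_valuation act f r \<Gamma> \<alpha> x \<longleftrightarrow> act (Some \<alpha>) x \<noteq> None"
    using valuation_pos_iff[OF assms(1) x, of \<alpha>] \<Gamma>(1) assms(2)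
    by (auto simp: twisted_valuation_def split: option.split)
  fix y assume y: "y \<in> \<M>"
  show "twisted_valuation act f r \<Gamma> \<alpha> (x \<odot> y) =
    (case act (Some \<alpha>) x of None \<Rightarrow> 0
     | Some \<beta> \<Rightarrow> twisted_valuation act f r \<Gamma> \<alpha> x * twisted_valuation act f r \<Gamma> \<beta> y)"
  proof (cases "act (Some \<alpha>) x")
    case None
    then show ?thesis using x y by (simp add: twisted_valuation_def act_mult)
  next
    case (Some \<beta>)
    show ?thesis
    proof (cases "act (Some \<beta>) y")
      case None
      then show ?thesis using x y Some by (simp add: twisted_valuation_def act_mult)
    next
      case (Some \<gamma>)
      then show ?thesis
        using x y \<open>act (Some \<alpha>) x = Some \<beta>\<close> \<Gamma>(2)[of \<alpha> \<gamma> \<beta>] valuation_mult[OF assms(1) x y, of \<alpha>]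
        by (simp add: twisted_valuation_def act_mult power_add)
    qed
  qed
qed

text \<open>
  For a valuation \<open>f\<close>, all other conditions on a Markov measure follow from \<open>m\<^sub>\<alpha>(\<up>x) = f\<^sub>\<alpha>(x)\<close>. In
  particular the infinite traces outside \<open>\<partial>\<M>\<^sub>\<alpha>\<close> form a countable union of sets \<open>\<up>x\<close> with
  \<open>f\<^sub>\<alpha>(x) = 0\<close>.
\<close>

lemma probabilistic_valuationI:
  assumes f: "valuation I act f"
    and m: "\<And>\<alpha>. prob_space (m \<alpha>)" "\<And>\<alpha>. sets (m \<alpha>) = sets (infinite_traces_borel I)"
    and up: "\<And>\<alpha> x. x \<in> \<M> \<Longrightarrow> measure (m \<alpha>) (up I x) = f \<alpha> x"
  shows "probabilistic_valuation I act f"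
proof -
  have "measure (m \<alpha>) (infinite_traces_from I act \<alpha>) = 1" for \<alpha>
  proof -
    interpret prob_space "m \<alpha>" by (rule m)
    let ?B = "{x \<in> \<M>. act (Some \<alpha>) x = None}"
    have sp: "space (m \<alpha>) = infinite_traces I"
      using sets_eq_imp_space_eq[OF m(2)] by simp
    have "up I x \<in> null_sets (m \<alpha>)" if "x \<in> ?B" for x
      using that up[of x \<alpha>] valuation_None[OF f, of x \<alpha>] m(2)[of \<alpha>]
      by (intro null_setsI) (auto simp: emeasure_eq_measure)
    then have null: "(\<Union>x\<in>?B. up I x) \<in> null_sets (m \<alpha>)"
      using countable_subset[OF _ countable_traces, of ?B] by (intro null_sets_UN') auto
    have eq: "infinite_traces_from I act \<alpha> = space (m \<alpha>) - (\<Union>x\<in>?B. up I x)"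
      by (auto simp: infinite_traces_from_def traces_from_def up_def sp)
    show ?thesis
      unfolding eq using null prob_compl[of "\<Union>x\<in>?B. up I x"] by (simp add: null_setsD2 measure_eq_0_null_sets)
  qed
  then have "markov_measure I act m"
    unfolding markov_measure_def
    using m up f valuation_pos_iff[OF f]
    by (auto simp: valuation_def traces_from_def split: option.splits)
  then show ?thesis
    unfolding probabilistic_valuation_def using f up by auto
qed

end

section \<open>Generating series\<close>

lemma summable_if_geometric_block:
  fixes b :: "nat \<Rightarrow> real"
  assumes "\<And>n. 0 \<le> b n" "\<And>n. b (n + N) \<le> c * b n" "0 \<le> c" "c < 1"
  shows "summable b"
proof (rule summableI_nonneg_bounded[OF assms(1)])
  fix n
  let ?T = "\<lambda>n. \<Sum>i<n. b i"
  have "?T n \<le> ?T (n + N)" using assms(1) by (intro sum_mono2) auto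
  also have "\<dots> = ?T N + (\<Sum>i<n. b (i + N))"
    using sum.atLeastLessThan_concat[of 0 N "n + N" b] sum.shift_bounds_nat_ivl[of b 0 N n]
    by (simp add: atLeast0LessThan)
  also have "(\<Sum>i<n. b (i + N)) \<le> c * ?T n"
    unfolding sum_distrib_left by (intro sum_mono assms)
  finally have "(1 - c) * ?T n \<le> ?T N" by (simp add: algebra_simps)
  then show "?T n \<le> ?T N / (1 - c)" using assms by (simp add: field_simps)
qed

locale weighted_system = irreducible_system I act
  for I :: "'a::finite rel" and act :: "'s::finite option \<Rightarrow> 'a list set \<Rightarrow> 's option" +
  fixes f :: "'s \<Rightarrow> 'a list set \<Rightarrow> real"
  assumes valuation: "valuation I act f"
begin

lemmas f_nonneg = valuation_nonneg[OF valuation]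
lemmas f_pos_iff = valuation_pos_iff[OF valuation]
lemmas f_mult = valuation_mult[OF valuation]
lemmas f_None = valuation_None[OF valuation]
lemmas f_one = valuation_one[OF valuation]
lemmas at_state_f_nonneg = at_state_nonneg[OF valuation]

definition coeff :: "'s \<Rightarrow> nat \<Rightarrow> real" where
  "coeff \<alpha> n = (\<Sum>x | x \<in> \<M> \<and> \<ell> x = n. f \<alpha> x)"

lemma gen_series_coeff_eq: "gen_series_coeff I act f \<alpha> = coeff \<alpha>"
  unfolding gen_series_coeff_def coeff_def traces_from_def
  by (intro ext sum.mono_neutral_left) (use f_None in \<open>auto simp: finite_traces_of_length\<close>)

lemma coeff_nonneg: "0 \<le> coeff \<alpha> n"
  unfolding coeff_def by (intro sum_nonneg) (simp add: f_nonneg)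

lemma coeff_ge: "x \<in> \<M> \<Longrightarrow> \<ell> x = n \<Longrightarrow> f \<alpha> x \<le> coeff \<alpha> n"
  unfolding coeff_def
  by (rule member_le_sum) (auto simp: finite_traces_of_length f_nonneg)

text \<open>
  Summing over all states, instead of fixing one, makes the coefficients submultiplicative.
\<close>

definition total :: "nat \<Rightarrow> real" where
  "total n = (\<Sum>\<alpha>\<in>UNIV. coeff \<alpha> n)"

lemma total_nonneg: "0 \<le> total n"
  unfolding total_def by (intro sum_nonneg coeff_nonneg)

lemma coeff_le_total: "coeff \<alpha> n \<le> total n"
  unfolding total_def by (rule member_le_sum) (auto simp: coeff_nonneg)

lemma coeff_add_le: "coeff \<alpha> (m + n) \<le> coeff \<alpha> m * total n"
proof -
  let ?L = "\<lambda>n. {x. x \<in> \<M> \<and> \<ell> x = n}"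
  have fin: "finite (?L n)" for n using finite_traces_of_length by simp
  have sub: "?L (m + n) \<subseteq> (\<lambda>(x, y). x \<odot> y) ` (?L m \<times> ?L n)"
  proof
    fix x assume x: "x \<in> ?L (m + n)"
    then obtain y where y: "y \<in> \<M>" "y \<preceq> x" "\<ell> y = m" using prefix_of_length[of x m] by auto
    then obtain z where "z \<in> \<M>" "x = y \<odot> z" by (auto elim: leE)
    with x y show "x \<in> (\<lambda>(x, y). x \<odot> y) ` (?L m \<times> ?L n)" by (intro image_eqI[of _ _ "(y, z)"]) auto
  qed
  have "coeff \<alpha> (m + n) \<le> (\<Sum>x\<in>(\<lambda>(x, y). x \<odot> y) ` (?L m \<times> ?L n). f \<alpha> x)"
    unfolding coeff_def using fin sub by (intro sum_mono2) (auto simp: f_nonneg)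
  also have "\<dots> \<le> (\<Sum>(x, y)\<in>?L m \<times> ?L n. f \<alpha> (x \<odot> y))"
    using fin by (intro order.trans[OF sum_image_le]) (auto simp: f_nonneg case_prod_unfold)
  also have "\<dots> = (\<Sum>x\<in>?L m. f \<alpha> x * (\<Sum>y\<in>?L n. at_state f (act (Some \<alpha>) x) y))"
    unfolding sum.cartesian_product[symmetric] sum_distrib_left
    by (intro sum.cong refl) (auto simp: f_mult)
  also have "\<dots> \<le> (\<Sum>x\<in>?L m. f \<alpha> x * total n)"
  proof (intro sum_mono mult_left_mono)
    fix x assume "x \<in> ?L m"
    show "(\<Sum>y\<in>?L n. at_state f (act (Some \<alpha>) x) y) \<le> total n"
      using coeff_le_total[of _ n] total_nonneg[of n]
      by (cases "act (Some \<alpha>) x") (simp_all add: coeff_def)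
  qed (auto simp: f_nonneg)
  finally show ?thesis by (simp add: coeff_def sum_distrib_right)
qed

lemma total_add_le: "total (m + n) \<le> total m * total n"
  unfolding total_def[of "m + n"] total_def[of m] sum_distrib_right
  by (intro sum_mono coeff_add_le)

text \<open>
  A single index \<open>N\<close> with \<open>total N * s\<^sup>N < 1\<close> suffices, since submultiplicativity propagates the bound
  to all blocks of length \<open>N\<close>. This gives both a positive radius of convergence and the lower bound
  \<open>total_rad_ge\<close>.
\<close>

lemma summable_if_block:
  assumes "0 \<le> s" "total N * s ^ N < 1"
  shows "summable (\<lambda>n. coeff \<alpha> n * s ^ n)"
proof (rule summable_comparison_test')
  show "summable (\<lambda>n. total n * s ^ n)"
  proof (rule summable_if_geometric_block)
    fix n
    show "0 \<le> total n * s ^ n" using assms total_nonneg by simp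
    have "total (n + N) * s ^ (n + N) \<le> (total n * total N) * s ^ (n + N)"
      using total_add_le assms by (intro mult_right_mono) auto
    then show "total (n + N) * s ^ (n + N) \<le> (total N * s ^ N) * (total n * s ^ n)"
      by (simp add: power_add algebra_simps)
  qed (use assms total_nonneg in auto)
  show "norm (coeff \<alpha> n * s ^ n) \<le> total n * s ^ n" for n
    using coeff_nonneg[of \<alpha> n] coeff_le_total[of \<alpha> n] assms by (simp add: mult_right_mono)
qed

lemma coeff_shift:
  assumes "x \<in> \<M>" "act (Some \<alpha>) x = Some \<beta>"
  shows "f \<alpha> x * coeff \<beta> n \<le> coeff \<alpha> (n + \<ell> x)"
proof -
  let ?L = "\<lambda>n. {x. x \<in> \<M> \<and> \<ell> x = n}"
  have fin: "finite (?L n)" for n using finite_traces_of_length by simp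
  have "f \<alpha> x * coeff \<beta> n = (\<Sum>z\<in>?L n. f \<alpha> (x \<odot> z))"
    unfolding coeff_def sum_distrib_left using assms by (intro sum.cong) (auto simp: f_mult)
  also have "\<dots> = (\<Sum>y\<in>(\<odot>) x ` ?L n. f \<alpha> y)"
    using inj_mult[OF assms(1)] by (subst sum.reindex) (auto intro: inj_on_subset)
  also have "\<dots> \<le> coeff \<alpha> (n + \<ell> x)"
    unfolding coeff_def using fin assms by (intro sum_mono2) (auto simp: f_nonneg)
  finally show ?thesis .
qed

text \<open>
  A trace from \<open>\<alpha>\<close> to \<open>\<beta>\<close> embeds the series of \<open>\<beta>\<close> into that of \<open>\<alpha>\<close>, up to a shift and a constant
  factor. By transitivity the radius of convergence is the same for all states.
\<close>

lemma conv_radius_le: "conv_radius (coeff \<alpha>) \<le> conv_radius (coeff \<beta>)"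
proof (rule conv_radius_geI_ex')
  fix s :: real assume s: "0 < s" "ereal s < conv_radius (coeff \<alpha>)"
  obtain x where x: "x \<in> \<M>" "act (Some \<alpha>) x = Some \<beta>" using reachable by blast
  let ?c = "f \<alpha> x * s ^ \<ell> x"
  have c: "?c > 0" using x s f_pos_iff[of x \<alpha>] by simp
  have "summable (\<lambda>n. coeff \<alpha> n * s ^ n)" using s by (intro summable_in_conv_radius) simp
  then have sm: "summable (\<lambda>n. coeff \<alpha> (n + \<ell> x) * s ^ (n + \<ell> x) / ?c)"
    using summable_iff_shift[of "\<lambda>n. coeff \<alpha> n * s ^ n"] by (intro summable_divide) simp
  show "summable (\<lambda>n. coeff \<beta> n * of_real s ^ n)"
  proof (rule summable_comparison_test'[OF sm])
    fix n
    have "f \<alpha> x * coeff \<beta> n * s ^ (n + \<ell> x) \<le> coeff \<alpha> (n + \<ell> x) * s ^ (n + \<ell> x)"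
      using coeff_shift[OF x, of n] s by (intro mult_right_mono) auto
    then have "coeff \<beta> n * s ^ n * ?c \<le> coeff \<alpha> (n + \<ell> x) * s ^ (n + \<ell> x)"
      by (simp add: power_add algebra_simps)
    then show "norm (coeff \<beta> n * of_real s ^ n) \<le> coeff \<alpha> (n + \<ell> x) * s ^ (n + \<ell> x) / ?c"
      using c s coeff_nonneg[of \<beta> n] by (simp add: pos_le_divide_eq)
  qed
qed

text \<open>
  The state is arbitrary, because the radius does not depend on it.
\<close>

definition rad :: real where
  "rad = real_of_ereal (conv_radius (coeff undefined))"

lemma conv_radius_pos: "0 < conv_radius (coeff \<alpha>)"
proof -
  let ?s = "1 / (total 1 + 1)"
  have s: "0 < ?s" "total 1 * ?s ^ 1 < 1" using total_nonneg[of 1] by auto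
  then have "ereal (norm ?s) \<le> conv_radius (coeff \<alpha>)"
    by (intro conv_radius_geI summable_if_block[of _ 1]) auto
  moreover have "0 < ereal (norm ?s)" using s by simp
  ultimately show ?thesis by (rule less_le_trans[rotated])
qed

lemma loop_power:
  assumes "x \<in> \<M>" "act (Some \<alpha>) x = Some \<alpha>"
  shows "f \<alpha> x ^ k \<le> coeff \<alpha> (k * \<ell> x)"
proof (induction k)
  case 0
  show ?case using coeff_ge[of \<epsilon> 0 \<alpha>] by (simp add: f_one)
next
  case (Suc k)
  have "f \<alpha> x ^ Suc k \<le> f \<alpha> x * coeff \<alpha> (k * \<ell> x)"
    using Suc f_nonneg[OF assms(1), of \<alpha>] by (simp add: mult_left_mono)
  also have "\<dots> \<le> coeff \<alpha> (Suc k * \<ell> x)"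
    using coeff_shift[OF assms, of "k * \<ell> x"] by (simp add: add.commute)
  finally show ?case .
qed

text \<open>
  The powers of a loop contribute a geometric series.
\<close>

lemma conv_radius_finite: "conv_radius (coeff \<alpha>) < \<infinity>"
proof -
  obtain x where x: "x \<in> \<M>" "act (Some \<alpha>) x = Some \<alpha>" "\<ell> x > 0" using loop by blast
  have fx: "f \<alpha> x > 0" using x f_pos_iff[of x \<alpha>] by simp
  define s where "s = max 1 (1 / f \<alpha> x)"
  have "1 / f \<alpha> x \<le> s" by (simp add: s_def)
  also have "s \<le> s ^ \<ell> x" using x(3) by (intro self_le_power) (auto simp: s_def)
  finally have "1 / f \<alpha> x \<le> s ^ \<ell> x" .
  then have fs: "1 \<le> f \<alpha> x * s ^ \<ell> x" using fx by (simp add: field_simps)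
  have "\<not> summable (\<lambda>n. coeff \<alpha> n * s ^ n)"
  proof
    assume "summable (\<lambda>n. coeff \<alpha> n * s ^ n)"
    then have "(\<lambda>n. coeff \<alpha> n * s ^ n) \<longlonglongrightarrow> 0" by (rule summable_LIMSEQ_zero)
    moreover have "filterlim (\<lambda>k. k * \<ell> x) at_top sequentially"
      using x(3) by (intro filterlim_subseq) (auto simp: strict_mono_def)
    ultimately have "(\<lambda>k. coeff \<alpha> (k * \<ell> x) * s ^ (k * \<ell> x)) \<longlonglongrightarrow> 0"
      by (rule filterlim_compose)
    moreover have "1 \<le> coeff \<alpha> (k * \<ell> x) * s ^ (k * \<ell> x)" for k
    proof -
      have "1 \<le> (f \<alpha> x * s ^ \<ell> x) ^ k" using fs by (rule one_le_power)
      also have "\<dots> = f \<alpha> x ^ k * s ^ (k * \<ell> x)"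
        by (simp add: power_mult_distrib power_mult[symmetric] mult.commute)
      also have "\<dots> \<le> coeff \<alpha> (k * \<ell> x) * s ^ (k * \<ell> x)"
        using loop_power[OF x(1,2)] by (intro mult_right_mono) (auto simp: s_def)
      finally show ?thesis .
    qed
    ultimately have "(1::real) \<le> 0" by (intro LIMSEQ_le_const) auto
    then show False by simp
  qed
  then have "conv_radius (coeff \<alpha>) \<le> norm s" by (rule conv_radius_leI')
  then show ?thesis by auto
qed

lemma conv_radius_eq: "conv_radius (coeff \<alpha>) = ereal rad"
proof -
  have "conv_radius (coeff \<alpha>) = conv_radius (coeff undefined)"
    by (intro antisym conv_radius_le)
  then show ?thesis
    using conv_radius_pos[of undefined] conv_radius_finite[of undefined]
    unfolding rad_def by (metis ereal_real less_irrefl abs_ereal_ge0 less_imp_le)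
qed

lemma rad_pos: "0 < rad"
  using conv_radius_pos[of undefined] conv_radius_eq[of undefined] by simp

text \<open>
  Otherwise \<open>summable_if_block\<close> would, by continuity, give convergence slightly beyond the radius.
\<close>

lemma total_rad_ge: "1 \<le> total N * rad ^ N"
proof (rule ccontr)
  assume "\<not> 1 \<le> total N * rad ^ N"
  then have less: "total N * rad ^ N < 1" by simp
  have "isCont (\<lambda>s. total N * s ^ N) rad" by (intro continuous_intros)
  then have "((\<lambda>s. total N * s ^ N) \<longlongrightarrow> total N * rad ^ N) (at_right rad)"
    by (simp add: isCont_def filterlim_at_split)
  then have "eventually (\<lambda>s. total N * s ^ N < 1) (at_right rad)"
    using less by (rule order_tendstoD)
  moreover have "eventually (\<lambda>s. rad < s) (at_right rad)" by (simp add: eventually_at_filter)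
  ultimately have "eventually (\<lambda>s. total N * s ^ N < 1 \<and> rad < s) (at_right rad)"
    by (rule eventually_conj)
  then obtain s where s: "total N * s ^ N < 1" "rad < s"
    using eventually_happens'[OF trivial_limit_at_right_real] by blast
  then have "ereal (norm s) \<le> conv_radius (coeff undefined)"
    using rad_pos by (intro conv_radius_geI summable_if_block[of _ N]) auto
  then show False using s rad_pos by (simp add: conv_radius_eq)
qed

definition weight :: "'s \<Rightarrow> real \<Rightarrow> 'a list set set \<Rightarrow> real" where
  "weight \<alpha> s E = (\<Sum>\<^sub>\<infinity>x\<in>E. f \<alpha> x * s ^ \<ell> x)"

abbreviation G :: "'s \<Rightarrow> real \<Rightarrow> real" where "G \<alpha> s \<equiv> weight \<alpha> s \<M>"

lemma gen_series_eq: "gen_series I act f \<alpha> s = G \<alpha> s"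
  unfolding gen_series_def weight_def traces_from_def
  by (rule infsum_cong_neutral) (use f_None in auto)

lemma finite_length_le: "finite {x. x \<in> \<M> \<and> \<ell> x \<le> N}"
proof -
  have "{x. x \<in> \<M> \<and> \<ell> x \<le> N} = (\<Union>n\<in>{..N}. {x \<in> \<M>. \<ell> x = n})" by blast
  then show ?thesis using finite_traces_of_length by simp
qed

lemma sum_by_length:
  "(\<Sum>n\<le>N. coeff \<alpha> n * s ^ n) = (\<Sum>x | x \<in> \<M> \<and> \<ell> x \<le> N. f \<alpha> x * s ^ \<ell> x)"
proof -
  note fin = finite_length_le[of N]
  have "(\<Sum>x | x \<in> \<M> \<and> \<ell> x \<le> N. f \<alpha> x * s ^ \<ell> x) =
    (\<Sum>n\<le>N. \<Sum>x | x \<in> {x. x \<in> \<M> \<and> \<ell> x \<le> N} \<and> \<ell> x = n. f \<alpha> x * s ^ \<ell> x)"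
    by (rule sum.group[symmetric]) (use fin in auto)
  also have "\<dots> = (\<Sum>n\<le>N. coeff \<alpha> n * s ^ n)"
    unfolding coeff_def sum_distrib_right by (intro sum.cong) auto
  finally show ?thesis by simp
qed

context
  fixes s :: real assumes s: "0 \<le> s" "s < rad"
begin

lemma weight_summable: "E \<subseteq> \<M> \<Longrightarrow> (\<lambda>x. f \<alpha> x * s ^ \<ell> x) summable_on E"
proof (rule summable_on_subset_banach)
  have sm: "summable (\<lambda>n. coeff \<alpha> n * s ^ n)"
    using s by (intro summable_in_conv_radius) (simp add: conv_radius_eq)
  show "(\<lambda>x. f \<alpha> x * s ^ \<ell> x) summable_on \<M>"
  proof (rule nonneg_bdd_above_summable_on)
    show "bdd_above (sum (\<lambda>x. f \<alpha> x * s ^ \<ell> x) ` {F. F \<subseteq> \<M> \<and> finite F})"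
    proof (rule bdd_aboveI2)
      fix F assume F: "F \<in> {F. F \<subseteq> \<M> \<and> finite F}"
      define N where "N = Max (insert 0 (\<ell> ` F))"
      have "F \<subseteq> {x. x \<in> \<M> \<and> \<ell> x \<le> N}" using F by (auto simp: N_def)
      then have "sum (\<lambda>x. f \<alpha> x * s ^ \<ell> x) F \<le> (\<Sum>x | x \<in> \<M> \<and> \<ell> x \<le> N. f \<alpha> x * s ^ \<ell> x)"
        using s finite_length_le by (intro sum_mono2) (auto simp: f_nonneg)
      also have "\<dots> \<le> (\<Sum>n. coeff \<alpha> n * s ^ n)"
        unfolding sum_by_length[symmetric] using s sm coeff_nonneg
        by (intro sum_le_suminf) auto
      finally show "sum (\<lambda>x. f \<alpha> x * s ^ \<ell> x) F \<le> (\<Sum>n. coeff \<alpha> n * s ^ n)" .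
    qed
  qed (use s f_nonneg in auto)
qed

lemma weight_nonneg: "E \<subseteq> \<M> \<Longrightarrow> 0 \<le> weight \<alpha> s E"
  unfolding weight_def using s f_nonneg by (intro infsum_nonneg) auto

lemma weight_mono: "E \<subseteq> F \<Longrightarrow> F \<subseteq> \<M> \<Longrightarrow> weight \<alpha> s E \<le> weight \<alpha> s F"
  unfolding weight_def using s f_nonneg weight_summable
  by (intro infsum_mono2) auto

lemma weight_Union:
  assumes "finite K" "disjoint_family_on E K" "\<And>k. k \<in> K \<Longrightarrow> E k \<subseteq> \<M>"
  shows "weight \<alpha> s (\<Union>k\<in>K. E k) = (\<Sum>k\<in>K. weight \<alpha> s (E k))"
  using assms
proof (induction K)
  case empty
  then show ?case by (simp add: weight_def)
next
  case (insert k K)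
  have "weight \<alpha> s (E k \<union> (\<Union>k\<in>K. E k)) = weight \<alpha> s (E k) + weight \<alpha> s (\<Union>k\<in>K. E k)"
    unfolding weight_def using insert.prems insert.hyps
    by (intro infsum_Un_disjoint weight_summable) (auto simp: disjoint_family_on_def)
  with insert show ?case by (simp add: disjoint_family_on_def)
qed

lemma weight_above:
  assumes "x \<in> \<M>" "act (Some \<alpha>) x = Some \<beta>"
  shows "weight \<alpha> s {y \<in> \<M>. x \<preceq> y} = f \<alpha> x * s ^ \<ell> x * G \<beta> s"
proof -
  have "{y \<in> \<M>. x \<preceq> y} = (\<odot>) x ` \<M>"
    using assms(1) leI by (auto elim!: leE)
  then have "weight \<alpha> s {y \<in> \<M>. x \<preceq> y} = (\<Sum>\<^sub>\<infinity>z\<in>\<M>. f \<alpha> (x \<odot> z) * s ^ \<ell> (x \<odot> z))"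
    unfolding weight_def using inj_mult[OF assms(1)] by (simp add: infsum_reindex o_def)
  also have "\<dots> = (\<Sum>\<^sub>\<infinity>z\<in>\<M>. (f \<alpha> x * s ^ \<ell> x) * (f \<beta> z * s ^ \<ell> z))"
    using assms by (intro infsum_cong) (simp add: f_mult power_add)
  also have "\<dots> = f \<alpha> x * s ^ \<ell> x * G \<beta> s"
    unfolding weight_def by (rule infsum_cmult_right')
  finally show ?thesis .
qed

lemma weight_above_None:
  assumes "x \<in> \<M>" "act (Some \<alpha>) x = None"
  shows "weight \<alpha> s {y \<in> \<M>. x \<preceq> y} = 0"
proof -
  have "f \<alpha> y = 0" if "y \<in> \<M>" "x \<preceq> y" for y
    using that assms by (auto elim!: leE intro!: f_None simp: act_mult)
  then show ?thesis unfolding weight_def by (intro infsum_0) auto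
qed

lemma G_ge_sum: "(\<Sum>n\<le>N. coeff \<alpha> n * s ^ n) \<le> G \<alpha> s"
  unfolding sum_by_length weight_def using s f_nonneg weight_summable finite_length_le
  by (intro finite_sum_le_infsum) auto

lemma G_ge_1: "1 \<le> G \<alpha> s"
  using G_ge_sum[of \<alpha> 0] coeff_ge[of \<epsilon> 0 \<alpha>] by (simp add: f_one)

lemma G_shift:
  assumes "x \<in> \<M>" "act (Some \<alpha>) x = Some \<beta>"
  shows "f \<alpha> x * s ^ \<ell> x * G \<beta> s \<le> G \<alpha> s"
  unfolding weight_above[OF assms, symmetric] by (rule weight_mono) auto

end

text \<open>
  The same embedding as in \<open>conv_radius_le\<close>. Staying away from \<open>s = 0\<close> bounds the constant factor
  from below uniformly in \<open>s\<close>.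
\<close>

lemma G_comparable: "\<exists>\<kappa>>0. \<forall>s. rad / 2 \<le> s \<longrightarrow> s < rad \<longrightarrow> (\<forall>\<alpha> \<beta>. \<kappa> * G \<beta> s \<le> G \<alpha> s)"
proof -
  have "\<forall>\<alpha> \<beta>. \<exists>x. x \<in> \<M> \<and> act (Some \<alpha>) x = Some \<beta>" using reachable by blast
  then obtain X where X: "\<And>\<alpha> \<beta>. X \<alpha> \<beta> \<in> \<M> \<and> act (Some \<alpha>) (X \<alpha> \<beta>) = Some \<beta>" by metis
  define k where "k = (\<lambda>(\<alpha>, \<beta>). f \<alpha> (X \<alpha> \<beta>) * (rad / 2) ^ \<ell> (X \<alpha> \<beta>))"
  define \<kappa> where "\<kappa> = Min (range k)"
  have "k p > 0" for p
    using X[of "fst p" "snd p"] f_pos_iff[of "X (fst p) (snd p)" "fst p"] rad_pos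
    by (simp add: k_def case_prod_unfold)
  then have "\<kappa> > 0" by (simp add: \<kappa>_def)
  moreover have "\<kappa> * G \<beta> s \<le> G \<alpha> s" if s: "rad / 2 \<le> s" "s < rad" for s \<alpha> \<beta>
  proof -
    have s0: "0 \<le> s" using s rad_pos by simp
    have "\<kappa> \<le> k (\<alpha>, \<beta>)" by (simp add: \<kappa>_def)
    also have "\<dots> \<le> f \<alpha> (X \<alpha> \<beta>) * s ^ \<ell> (X \<alpha> \<beta>)"
      unfolding k_def using s rad_pos X f_nonneg by (auto intro!: mult_left_mono power_mono)
    finally have "\<kappa> * G \<beta> s \<le> f \<alpha> (X \<alpha> \<beta>) * s ^ \<ell> (X \<alpha> \<beta>) * G \<beta> s"
      using weight_nonneg[OF s0 s(2) order_refl] by (intro mult_right_mono) auto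
    also have "\<dots> \<le> G \<alpha> s" using X by (intro G_shift[OF s0 s(2)]) auto
    finally show ?thesis .
  qed
  ultimately show ?thesis by blast
qed

text \<open>
  By \<open>total_rad_ge\<close> the partial sums of the series summed over all states are unbounded near \<open>rad\<close>;
  comparability transfers this to each single state.
\<close>

lemma G_at_top: "filterlim (G \<alpha>) at_top (at_left rad)"
proof -
  obtain \<kappa> where \<kappa>: "\<kappa> > 0"
    "\<And>s \<alpha> \<beta>. rad / 2 \<le> s \<Longrightarrow> s < rad \<Longrightarrow> \<kappa> * G \<beta> s \<le> G \<alpha> s"
    using G_comparable by blast
  have ev: "eventually (\<lambda>s. rad / 2 < s \<and> s < rad) (at_left rad)"
    using eventually_at_left_real[of "rad / 2" rad] rad_pos by simp
  have main: "eventually (\<lambda>s. \<kappa> * real N \<le> real CARD('s) * G \<alpha> s) (at_left rad)" for N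
  proof -
    have "isCont (\<lambda>s. \<Sum>n\<le>N. total n * s ^ n) rad" by (intro continuous_intros)
    then have "((\<lambda>s. \<Sum>n\<le>N. total n * s ^ n) \<longlongrightarrow> (\<Sum>n\<le>N. total n * rad ^ n)) (at_left rad)"
      by (simp add: isCont_def filterlim_at_split)
    moreover have "real N < (\<Sum>n\<le>N. total n * rad ^ n)"
    proof -
      have "real (Suc N) = (\<Sum>n\<le>N. 1)" by simp
      also have "\<dots> \<le> (\<Sum>n\<le>N. total n * rad ^ n)" by (intro sum_mono total_rad_ge)
      finally show ?thesis by simp
    qed
    ultimately have "eventually (\<lambda>s. real N < (\<Sum>n\<le>N. total n * s ^ n)) (at_left rad)"
      by (rule order_tendstoD)
    with ev show ?thesis
    proof eventually_elim
      case (elim s)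
      then have s: "0 \<le> s" "s < rad" using rad_pos by auto
      have "\<kappa> * real N \<le> \<kappa> * (\<Sum>n\<le>N. total n * s ^ n)"
        using elim \<kappa> by (intro mult_left_mono) auto
      also have "(\<Sum>n\<le>N. total n * s ^ n) = (\<Sum>\<beta>\<in>UNIV. \<Sum>n\<le>N. coeff \<beta> n * s ^ n)"
        unfolding total_def sum_distrib_right by (rule sum.swap)
      also have "\<kappa> * \<dots> \<le> (\<Sum>\<beta>\<in>UNIV. \<kappa> * G \<beta> s)"
        using \<kappa>(1) by (subst sum_distrib_left) (intro sum_mono mult_left_mono G_ge_sum[OF s], simp)
      also have "\<dots> \<le> (\<Sum>\<beta>\<in>(UNIV :: 's set). G \<alpha> s)"
        using elim by (intro sum_mono \<kappa>(2)) auto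
      finally show ?case by simp
    qed
  qed
  show ?thesis
    unfolding filterlim_at_top
  proof
    fix Z :: real
    obtain N :: nat where N: "Z * real CARD('s) / \<kappa> \<le> real N" using real_arch_simple by blast
    from main[of N] show "eventually (\<lambda>s. Z \<le> G \<alpha> s) (at_left rad)"
    proof eventually_elim
      case (elim s)
      have "Z * real CARD('s) \<le> \<kappa> * real N" using N \<kappa> by (simp add: field_simps)
      with elim have "real CARD('s) * Z \<le> real CARD('s) * G \<alpha> s"
        by (metis mult.commute order_trans)
      then show ?case by (rule mult_left_le_imp_le) simp
    qed
  qed
qed

end

section \<open>Limits of normalised weights\<close>

text \<open>
  Tychonoff's theorem. For a countable index set the product is first countable, hence also
  sequentially compact.
\<close>

lemma compact_unit_functions: "compact (Pi\<^sub>E (UNIV :: 'i set) (\<lambda>_. {0..1::real}))"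
  unfolding compactin_euclidean_iff[symmetric] euclidean_product_topology[symmetric]
  by (simp add: compactin_PiE)

lemma pointwise_convergent_subsequence:
  fixes q :: "nat \<Rightarrow> 'i::countable \<Rightarrow> real"
  assumes "\<And>n i. q n i \<in> {0..1}"
  shows "\<exists>r l. strict_mono r \<and> (\<forall>i. (\<lambda>n. q (r n) i) \<longlonglongrightarrow> l i)"
proof -
  have "seq_compact (Pi\<^sub>E (UNIV :: 'i set) (\<lambda>_. {0..1::real}))"
    by (rule compact_imp_seq_compact[OF compact_unit_functions])
  then obtain r l where r: "strict_mono r" "(q \<circ> r) \<longlonglongrightarrow> l"
    using assms by (elim seq_compactE[of _ q]) auto
  have "(\<lambda>n. q (r n) i) \<longlonglongrightarrow> l i" for i
  proof -
    have "isCont (\<lambda>h :: 'i \<Rightarrow> real. h i) l"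
      using continuous_on_product_coordinates[of i] continuous_on_eq_continuous_at[OF open_UNIV] by blast
    from isCont_tendsto_compose[OF this r(2)] show ?thesis by simp
  qed
  with r(1) show ?thesis by blast
qed

context weighted_system begin

text \<open>
  The probability that the normal form starts with \<open>w\<close>, under the distribution on finite traces with
  weights \<open>f\<^sub>\<alpha>(x) s\<^bsup>|x|\<^esup>\<close>. Normal forms are padded with empty cliques, so that this
  is consistent in \<open>w\<close> even for words longer than the normal form.
\<close>

definition prefix_prob :: "'s \<Rightarrow> real \<Rightarrow> 'a set list \<Rightarrow> real" where
  "prefix_prob \<alpha> s w = weight \<alpha> s {y \<in> \<M>. normal_form (length w) y = w} / G \<alpha> s"

context
  fixes s :: real assumes s: "0 \<le> s" "s < rad"
begin

lemma G_pos: "0 < G \<alpha> s"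
  using G_ge_1[OF s, of \<alpha>] by simp

lemma prefix_prob_bounds: "prefix_prob \<alpha> s w \<in> {0..1}"
  using weight_nonneg[OF s, of "{y \<in> \<M>. normal_form (length w) y = w}" \<alpha>]
    weight_mono[OF s, of "{y \<in> \<M>. normal_form (length w) y = w}" \<M> \<alpha>] G_pos[of \<alpha>]
  by (simp add: prefix_prob_def divide_le_eq_1)

lemma prefix_prob_Nil: "prefix_prob \<alpha> s [] = 1"
  using G_pos[of \<alpha>] by (simp add: prefix_prob_def)

lemma prefix_prob_split: "prefix_prob \<alpha> s w = (\<Sum>c\<in>UNIV. prefix_prob \<alpha> s (w @ [c]))"
proof -
  have "{y \<in> \<M>. normal_form (length w) y = w} =
    (\<Union>c\<in>UNIV. {y \<in> \<M>. normal_form (length (w @ [c])) y = w @ [c]})"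
    by (auto simp: normal_form_Suc)
  moreover have "weight \<alpha> s (\<Union>c\<in>UNIV. {y \<in> \<M>. normal_form (length (w @ [c])) y = w @ [c]}) =
    (\<Sum>c\<in>UNIV. weight \<alpha> s {y \<in> \<M>. normal_form (length (w @ [c])) y = w @ [c]})"
    by (rule weight_Union[OF s]) (auto simp: disjoint_family_on_def)
  ultimately show ?thesis
    by (simp add: prefix_prob_def sum_divide_distrib)
qed

lemma sum_prefix_prob:
  assumes "x \<in> \<M>"
  shows "(\<Sum>w | length w = \<ell> x \<and> x \<preceq> clique_product w. prefix_prob \<alpha> s w) =
    weight \<alpha> s {y \<in> \<M>. x \<preceq> y} / G \<alpha> s"
proof -
  let ?W = "{w. length w = \<ell> x \<and> x \<preceq> clique_product w}"
  have "{y \<in> \<M>. x \<preceq> y} = (\<Union>w\<in>?W. {y \<in> \<M>. normal_form (length w) y = w})"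
  proof (intro equalityI subsetI)
    fix y assume "y \<in> {y \<in> \<M>. x \<preceq> y}"
    then show "y \<in> (\<Union>w\<in>?W. {y \<in> \<M>. normal_form (length w) y = w})"
      using le_normal_form[OF assms, of y "\<ell> x"]
      by (intro UN_I[of "normal_form (\<ell> x) y"]) auto
  next
    fix y assume "y \<in> (\<Union>w\<in>?W. {y \<in> \<M>. normal_form (length w) y = w})"
    then obtain w where w: "x \<preceq> clique_product w" "y \<in> \<M>" "normal_form (length w) y = w"
      by auto
    have "clique_product w \<preceq> y"
      using normal_form_product[OF w(2), of "length w"] w(2,3)
        leI[of "clique_product w" "(rest ^^ length w) y"] by simp
    with le_trans[OF assms w(1)] w(2) show "y \<in> {y \<in> \<M>. x \<preceq> y}" by blast
  qed
  moreover have "weight \<alpha> s (\<Union>w\<in>?W. {y \<in> \<M>. normal_form (length w) y = w}) =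
    (\<Sum>w\<in>?W. weight \<alpha> s {y \<in> \<M>. normal_form (length w) y = w})"
    by (rule weight_Union[OF s]) (auto simp: disjoint_family_on_def finite_clique_words)
  ultimately show ?thesis
    by (simp add: prefix_prob_def sum_divide_distrib)
qed

lemma prefix_prob_not_chain: "\<not> clique_chain w \<Longrightarrow> prefix_prob \<alpha> s w = 0"
proof -
  assume "\<not> clique_chain w"
  then have "{y \<in> \<M>. normal_form (length w) y = w} = {}"
    using clique_chain_normal_form by (metis (mono_tags, lifting) Collect_empty_eq)
  then show ?thesis unfolding prefix_prob_def weight_def by (simp only: infsum_empty div_0)
qed

lemma prefix_prob_empty_clique:
  assumes "{} \<in> set w"
  shows "prefix_prob \<alpha> s w \<le> f \<alpha> (clique_product w) * rad ^ \<ell> (clique_product w) / G \<alpha> s"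
proof -
  have "{y \<in> \<M>. normal_form (length w) y = w} \<subseteq> {clique_product w}"
  proof
    fix y assume "y \<in> {y \<in> \<M>. normal_form (length w) y = w}"
    then have "y \<in> \<M>" "normal_form (length w) y = w" by auto
    then show "y \<in> {clique_product w}"
      using normal_form_empty_clique[of y "length w"] assms by simp
  qed
  then have "weight \<alpha> s {y \<in> \<M>. normal_form (length w) y = w} \<le> weight \<alpha> s {clique_product w}"
    by (intro weight_mono[OF s]) auto
  also have "\<dots> \<le> f \<alpha> (clique_product w) * rad ^ \<ell> (clique_product w)"
    using s f_nonneg[of "clique_product w" \<alpha>]
    by (simp add: weight_def mult_left_mono power_mono)
  finally show ?thesis
    unfolding prefix_prob_def using G_pos[of \<alpha>] by (intro divide_right_mono) auto
qed

end

text \<open>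
  It is enough to make the prefix probabilities converge: the probability of extending a given trace is
  a finite sum of them, hence converges too, and for a trace from \<open>\<alpha>\<close> to \<open>\<beta>\<close> it determines
  the ratio \<open>G\<^sub>\<beta> / G\<^sub>\<alpha>\<close>.
\<close>

theorem subsequential_limit_probabilistic:
  assumes \<sigma>: "\<And>n. rad / 2 \<le> \<sigma> n" "\<And>n. \<sigma> n < rad" "\<sigma> \<longlonglongrightarrow> rad"
  shows "\<exists>r \<Delta>. strict_mono r \<and> (\<forall>\<alpha> \<beta>. (\<lambda>n. G \<beta> (\<sigma> (r n)) / G \<alpha> (\<sigma> (r n))) \<longlonglongrightarrow> \<Delta> \<alpha> \<beta>) \<and>
    positive_cocycle \<Delta> \<and> probabilistic_valuation I act (twisted_valuation act f rad \<Delta>)"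
proof -
  have s0: "0 \<le> \<sigma> n" for n using \<sigma>(1)[of n] rad_pos by simp
  define q where "q = (\<lambda>n (\<alpha>, w). prefix_prob \<alpha> (\<sigma> n) w)"
  have "q n i \<in> {0..1}" for n i
    using prefix_prob_bounds[OF s0 \<sigma>(2)] by (simp add: q_def case_prod_unfold)
  then obtain r l where r: "strict_mono r" and l: "\<And>i. (\<lambda>n. q (r n) i) \<longlonglongrightarrow> l i"
    using pointwise_convergent_subsequence[of q] by blast
  define t where "t = (\<lambda>n. \<sigma> (r n))"
  have t: "0 \<le> t n" "t n < rad" "rad / 2 \<le> t n" "0 < t n" for n
    using s0 \<sigma>(1)[of "r n"] \<sigma>(2) rad_pos by (simp_all add: t_def)
  have t_lim: "t \<longlonglongrightarrow> rad"
    using LIMSEQ_subseq_LIMSEQ[OF \<sigma>(3) r] by (simp add: t_def o_def)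
  define p where "p = (\<lambda>\<alpha> w. l (\<alpha>, w))"
  have p: "(\<lambda>n. prefix_prob \<alpha> (t n) w) \<longlonglongrightarrow> p \<alpha> w" for \<alpha> w
    using l[of "(\<alpha>, w)"] by (simp add: q_def p_def t_def)
  have above: "(\<lambda>n. weight \<alpha> (t n) {y \<in> \<M>. x \<preceq> y} / G \<alpha> (t n))
    \<longlonglongrightarrow> (\<Sum>w | length w = \<ell> x \<and> x \<preceq> clique_product w. p \<alpha> w)" if "x \<in> \<M>" for \<alpha> x
    unfolding sum_prefix_prob[OF t(1,2) that, symmetric] by (intro tendsto_sum p)
  have ratio: "\<exists>d. (\<lambda>n. G \<beta> (t n) / G \<alpha> (t n)) \<longlonglongrightarrow> d" for \<alpha> \<beta>
  proof -
    obtain x where x: "x \<in> \<M>" "act (Some \<alpha>) x = Some \<beta>" using reachable by blast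
    have fx: "f \<alpha> x > 0" using x f_pos_iff[of x \<alpha>] by simp
    have "(\<lambda>n. (weight \<alpha> (t n) {y \<in> \<M>. x \<preceq> y} / G \<alpha> (t n)) / (f \<alpha> x * t n ^ \<ell> x)) \<longlonglongrightarrow>
      (\<Sum>w | length w = \<ell> x \<and> x \<preceq> clique_product w. p \<alpha> w) / (f \<alpha> x * rad ^ \<ell> x)"
      using fx rad_pos by (intro tendsto_divide above[OF x(1)] tendsto_mult tendsto_power t_lim tendsto_const) simp
    moreover have "(weight \<alpha> (t n) {y \<in> \<M>. x \<preceq> y} / G \<alpha> (t n)) / (f \<alpha> x * t n ^ \<ell> x) =
      G \<beta> (t n) / G \<alpha> (t n)" for n
      using fx t(4)[of n] by (simp add: weight_above[OF t(1,2) x])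
    ultimately show ?thesis by auto
  qed
  define \<Delta> where "\<Delta> = (\<lambda>\<alpha> \<beta>. lim (\<lambda>n. G \<beta> (t n) / G \<alpha> (t n)))"
  have \<Delta>: "(\<lambda>n. G \<beta> (t n) / G \<alpha> (t n)) \<longlonglongrightarrow> \<Delta> \<alpha> \<beta>" for \<alpha> \<beta>
  proof -
    obtain d where d: "(\<lambda>n. G \<beta> (t n) / G \<alpha> (t n)) \<longlonglongrightarrow> d" using ratio by blast
    from d limI[OF d] show ?thesis by (simp add: \<Delta>_def)
  qed
  obtain \<kappa> where \<kappa>: "\<kappa> > 0"
    "\<And>s \<alpha> \<beta>. rad / 2 \<le> s \<Longrightarrow> s < rad \<Longrightarrow> \<kappa> * G \<beta> s \<le> G \<alpha> s"
    using G_comparable by blast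
  have Gpos: "0 < G \<alpha> (t n)" for \<alpha> n using G_pos[OF t(1,2)] .
  have \<Delta>_pos: "0 < \<Delta> \<alpha> \<beta>" for \<alpha> \<beta>
  proof -
    have "\<kappa> \<le> G \<beta> (t n) / G \<alpha> (t n)" for n
      using \<kappa>(2)[OF t(3,2)] Gpos by (simp add: pos_le_divide_eq)
    then have "\<kappa> \<le> \<Delta> \<alpha> \<beta>" by (intro LIMSEQ_le_const[OF \<Delta>]) auto
    with \<kappa>(1) show ?thesis by simp
  qed
  have \<Delta>_mult: "\<Delta> \<alpha> \<gamma> = \<Delta> \<alpha> \<beta> * \<Delta> \<beta> \<gamma>" for \<alpha> \<beta> \<gamma>
  proof (rule LIMSEQ_unique[OF \<Delta>])
    have "(\<lambda>n. (G \<beta> (t n) / G \<alpha> (t n)) * (G \<gamma> (t n) / G \<beta> (t n))) \<longlonglongrightarrow> \<Delta> \<alpha> \<beta> * \<Delta> \<beta> \<gamma>"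
      by (intro tendsto_mult \<Delta>)
    moreover have "(G \<beta> (t n) / G \<alpha> (t n)) * (G \<gamma> (t n) / G \<beta> (t n)) = G \<gamma> (t n) / G \<alpha> (t n)" for n
      using Gpos[of \<beta> n] by simp
    ultimately show "(\<lambda>n. G \<gamma> (t n) / G \<alpha> (t n)) \<longlonglongrightarrow> \<Delta> \<alpha> \<beta> * \<Delta> \<beta> \<gamma>" by simp
  qed
  have cocycle: "positive_cocycle \<Delta>"
    unfolding positive_cocycle_def cocycle_def using \<Delta>_pos \<Delta>_mult less_imp_le by blast
  have twisted: "(\<Sum>w | length w = \<ell> x \<and> x \<preceq> clique_product w. p \<alpha> w) =
    twisted_valuation act f rad \<Delta> \<alpha> x" if "x \<in> \<M>" for \<alpha> x
  proof (rule LIMSEQ_unique[OF above[OF that]])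
    show "(\<lambda>n. weight \<alpha> (t n) {y \<in> \<M>. x \<preceq> y} / G \<alpha> (t n)) \<longlonglongrightarrow> twisted_valuation act f rad \<Delta> \<alpha> x"
    proof (cases "act (Some \<alpha>) x")
      case None
      then show ?thesis
        by (simp add: twisted_valuation_def weight_above_None[OF t(1,2) that])
    next
      case (Some \<beta>)
      have "(\<lambda>n. f \<alpha> x * t n ^ \<ell> x * (G \<beta> (t n) / G \<alpha> (t n))) \<longlonglongrightarrow> f \<alpha> x * rad ^ \<ell> x * \<Delta> \<alpha> \<beta>"
        by (intro tendsto_mult tendsto_power t_lim tendsto_const \<Delta>)
      then show ?thesis
        by (simp add: twisted_valuation_def Some weight_above[OF t(1,2) that Some] mult_ac)
    qed
  qed
  have "\<exists>m. prob_space m \<and> sets m = sets (infinite_traces_borel I) \<and>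
    (\<forall>x\<in>\<M>. measure m (up I x) = (\<Sum>w | length w = \<ell> x \<and> x \<preceq> clique_product w. p \<alpha> w))"
    (is "\<exists>m. ?P \<alpha> m") for \<alpha>
  proof (rule clique_chain_measure)
    show "0 \<le> p \<alpha> w" for w
      using prefix_prob_bounds[OF t(1,2)] by (intro LIMSEQ_le_const[OF p]) auto
    show "p \<alpha> [] = 1"
      using p[of \<alpha> "[]"] by (simp add: prefix_prob_Nil[OF t(1,2)] LIMSEQ_const_iff)
    show "p \<alpha> w = (\<Sum>c\<in>UNIV. p \<alpha> (w @ [c]))" for w
    proof (rule LIMSEQ_unique[OF p])
      show "(\<lambda>n. prefix_prob \<alpha> (t n) w) \<longlonglongrightarrow> (\<Sum>c\<in>UNIV. p \<alpha> (w @ [c]))"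
        unfolding prefix_prob_split[OF t(1,2), of \<alpha> _ w] by (intro tendsto_sum p)
    qed
    show "clique_chain w \<and> {} \<notin> set w" if "p \<alpha> w \<noteq> 0" for w
    proof (rule ccontr)
      assume not: "\<not> (clique_chain w \<and> {} \<notin> set w)"
      have "(\<lambda>n. prefix_prob \<alpha> (t n) w) \<longlonglongrightarrow> 0"
      proof (cases "clique_chain w")
        case False
        then show ?thesis by (simp add: prefix_prob_not_chain[OF t(1,2)])
      next
        case True
        with not have e: "{} \<in> set w" by simp
        have "filterlim t (at_left rad) sequentially"
          using t_lim t(2) by (auto simp: filterlim_at intro!: always_eventually less_imp_neq)
        then have "filterlim (\<lambda>n. G \<alpha> (t n)) at_top sequentially"
          by (rule filterlim_compose[OF G_at_top])
        then have lim: "(\<lambda>n. f \<alpha> (clique_product w) * rad ^ \<ell> (clique_product w) / G \<alpha> (t n)) \<longlonglongrightarrow> 0"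
          by (intro real_tendsto_divide_at_top[OF tendsto_const])
        show ?thesis
        proof (rule tendsto_sandwich[OF _ _ tendsto_const lim])
          show "\<forall>\<^sub>F n in sequentially. 0 \<le> prefix_prob \<alpha> (t n) w"
            using prefix_prob_bounds[OF t(1,2)] by auto
          show "\<forall>\<^sub>F n in sequentially. prefix_prob \<alpha> (t n) w
              \<le> f \<alpha> (clique_product w) * rad ^ \<ell> (clique_product w) / G \<alpha> (t n)"
            using prefix_prob_empty_clique[OF t(1,2) e] by auto
        qed
      qed
      from LIMSEQ_unique[OF p this] that show False by simp
    qed
  qed
  then have "\<forall>\<alpha>. \<exists>m. ?P \<alpha> m" by blast
  from choice[OF this] obtain m where m: "\<And>\<alpha>. prob_space (m \<alpha>)" "\<And>\<alpha>. sets (m \<alpha>) = sets (infinite_traces_borel I)"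
    "\<And>\<alpha> x. x \<in> \<M> \<Longrightarrow> measure (m \<alpha>) (up I x) = (\<Sum>w | length w = \<ell> x \<and> x \<preceq> clique_product w. p \<alpha> w)"
    by blast
  have "probabilistic_valuation I act (twisted_valuation act f rad \<Delta>)"
    using m twisted valuation_twisted[OF valuation rad_pos cocycle]
    by (intro probabilistic_valuationI[of _ m]) auto
  with r \<Delta> cocycle show ?thesis unfolding t_def by blast
qed

end

section \<open>Almost sure occurrence of every letter\<close>

context independence begin

text \<open>
  Distinct elements have no common upper bound. Unlike disjointness of the sets \<open>\<up>x\<close>, this
  passes directly to \<open>{x \<odot> y | y. y \<in> A}\<close> by cancellation.
\<close>

definition incompatible :: "'a list set set \<Rightarrow> bool" where
  "incompatible A \<longleftrightarrow> A \<subseteq> \<M> \<and> (\<forall>x\<in>A. \<forall>y\<in>A. \<forall>z. x \<preceq> z \<longrightarrow> y \<preceq> z \<longrightarrow> x = y)"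

lemma incompatible_disjoint: "incompatible A \<Longrightarrow> disjoint_family_on (up I) A"
proof -
  assume A: "incompatible A"
  have "up I x \<inter> up I y = {}" if xy: "x \<in> A" "y \<in> A" "x \<noteq> y" for x y
  proof (rule ccontr)
    assume "up I x \<inter> up I y \<noteq> {}"
    then obtain \<omega> where "\<omega> \<in> up I x" "\<omega> \<in> up I y" by blast
    then obtain z where "x \<preceq> z" "y \<preceq> z"
      using up_common[of x y \<omega>] A xy by (auto simp: incompatible_def)
    then show False using A xy unfolding incompatible_def by blast
  qed
  then show ?thesis by (simp add: disjoint_family_on_def)
qed

lemma incompatible_mult:
  assumes "incompatible A" "x \<in> \<M>" shows "disjoint_family_on (\<lambda>y. up I (x \<odot> y)) A"
proof -
  have "up I (x \<odot> y) \<inter> up I (x \<odot> y') = {}" if yy: "y \<in> A" "y' \<in> A" "y \<noteq> y'" for y y'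
  proof (rule ccontr)
    have M: "y \<in> \<M>" "y' \<in> \<M>" using yy assms(1) by (auto simp: incompatible_def)
    assume "up I (x \<odot> y) \<inter> up I (x \<odot> y') \<noteq> {}"
    then obtain \<omega> where "\<omega> \<in> up I (x \<odot> y)" "\<omega> \<in> up I (x \<odot> y')" by blast
    then obtain z where z: "x \<odot> y \<preceq> z" "x \<odot> y' \<preceq> z"
      using up_common[of "x \<odot> y" "x \<odot> y'" \<omega>] M assms(2) by auto
    obtain v where v: "v \<in> \<M>" "z = x \<odot> (y \<odot> v)"
      using z(1) M assms(2) by (auto elim!: leE simp: mult_assoc)
    have "y \<preceq> y \<odot> v" using M v leI by blast
    moreover have "y' \<preceq> y \<odot> v"
      using left_cancel_le[OF assms(2) M(2), of "y \<odot> v"] z(2) v M by simp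
    ultimately show False using assms(1) yy unfolding incompatible_def by blast
  qed
  then show ?thesis by (simp add: disjoint_family_on_def)
qed

text \<open>
  The traces that end exactly with the \<open>n\<close>-th occurrence of \<open>b\<close>: they contain this occurrence and what
  lies below it, and nothing else. They play the part of a stopping time.
\<close>

definition first_hits :: "'a \<Rightarrow> nat \<Rightarrow> 'a list set set" where
  "first_hits b n = {x \<in> \<M>. cnt b x = n \<and> (\<forall>y\<in>\<M>. y \<preceq> x \<longrightarrow> cnt b y = n \<longrightarrow> y = x)}"

lemma first_hits_incompatible:
  assumes "A \<subseteq> first_hits b n" shows "incompatible A"
  unfolding incompatible_def
proof (intro conjI ballI allI impI)
  show "A \<subseteq> \<M>" using assms by (auto simp: first_hits_def)
  fix x y z assume "x \<in> A" "y \<in> A" "x \<preceq> z" "y \<preceq> z"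
  with assms have xy: "x \<in> first_hits b n" "y \<in> first_hits b n" "x \<preceq> z" "y \<preceq> z" by auto
  then obtain w where "w \<in> \<M>" "w \<preceq> x" "w \<preceq> y" "cnt b w = n"
    using meet[of x y z] by (auto simp: first_hits_def)
  with xy show "x = y" unfolding first_hits_def by blast
qed

lemma first_hits_exists:
  assumes "z \<in> \<M>" "n \<le> cnt b z" shows "\<exists>x\<in>first_hits b n. x \<preceq> z"
proof -
  let ?P = "\<lambda>x. x \<in> \<M> \<and> x \<preceq> z \<and> n \<le> cnt b x"
  have "?P z" using assms by simp
  \<comment> \<open>A shortest candidate has exactly n occurrences: otherwise its last letter could be dropped.\<close>
  then obtain x where x: "?P x" and least: "\<And>y. ?P y \<Longrightarrow> \<ell> x \<le> \<ell> y"
    using ex_has_least_nat[of ?P z \<ell>] by blast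
  have "cnt b x = n"
  proof (rule ccontr)
    assume "cnt b x \<noteq> n"
    with x have gt: "n < cnt b x" by simp
    then have "x \<noteq> \<epsilon>" by auto
    then obtain y a where y: "y \<in> \<M>" "x = y \<odot> \<tau> [a]" using x trace_rev_cases by blast
    then have "y \<preceq> x" using leI by simp
    with x y have "y \<preceq> z" using le_trans[OF y(1)] by blast
    moreover have "n \<le> cnt b y" using gt y by (simp split: if_splits)
    ultimately have "\<ell> x \<le> \<ell> y" using y least by blast
    with y show False by simp
  qed
  moreover have "y = x" if y: "y \<in> \<M>" "y \<preceq> x" "cnt b y = n" for y
  proof -
    have "y \<preceq> z" using le_trans[OF y(1,2)] x by blast
    with least y have "\<ell> x \<le> \<ell> y" by simp
    then show ?thesis using le_length_eq y by blast
  qed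
  ultimately have "x \<in> first_hits b n" using x by (auto simp: first_hits_def)
  with x show ?thesis by blast
qed

text \<open>
  Cutting a trace at its \<open>m\<close>-th occurrence of \<open>b\<close>.
\<close>

lemma first_hits_add:
  assumes "x \<in> first_hits b (m + n)"
  shows "\<exists>y\<in>first_hits b m. \<exists>z\<in>first_hits b n. x = y \<odot> z"
proof -
  have x: "x \<in> \<M>" "cnt b x = m + n"
    and min: "\<And>y. y \<in> \<M> \<Longrightarrow> y \<preceq> x \<Longrightarrow> cnt b y = m + n \<Longrightarrow> y = x"
    using assms by (auto simp: first_hits_def)
  obtain y where y: "y \<in> first_hits b m" "y \<preceq> x" using first_hits_exists[of x m b] x by auto
  then obtain z where z: "z \<in> \<M>" "x = y \<odot> z" by (auto elim: leE)
  have yM: "y \<in> \<M>" "cnt b y = m" using y by (auto simp: first_hits_def)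
  have "z' = z" if "z' \<in> \<M>" "z' \<preceq> z" "cnt b z' = n" for z'
  proof (rule left_cancel[OF yM(1) that(1) z(1)])
    show "y \<odot> z' = y \<odot> z"
      using min[of "y \<odot> z'"] that yM z mult_mono by simp
  qed
  moreover have "cnt b z = n" using x z yM by simp
  ultimately have "z \<in> first_hits b n" using z by (auto simp: first_hits_def)
  with y z show ?thesis by blast
qed

lemma cnt_le_length: "x \<in> \<M> \<Longrightarrow> cnt b x \<le> \<ell> x"
  unfolding length_eq_sum_cnt by (rule member_le_sum) auto

lemma letter_first_hit: "\<tau> [b] \<in> first_hits b 1"
proof -
  have "y = \<tau> [b]" if "y \<in> \<M>" "y \<preceq> \<tau> [b]" "cnt b y = 1" for y
    using that cnt_le_length[of y b] by (intro le_length_eq) auto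
  then show ?thesis by (simp add: first_hits_def)
qed

lemma count_proj: "x \<in> \<M> \<Longrightarrow> (a, b) \<notin> I \<Longrightarrow> count_list (proj a b x) a = cnt a x"
proof (elim trace_cases)
  fix w assume w: "x = \<tau> w" and ab: "(a, b) \<notin> I"
  have "count_list (filter (\<lambda>c. c = a \<or> c = b) w) a = count_list w a" by (induction w) auto
  then show ?thesis using w ab by (simp add: proj_trace_of word_proj_def cnt_trace_of)
qed

text \<open>
  In \<open>y b\<close> the last letter \<open>b\<close> is the \<open>n\<close>-th one and is preceded by an \<open>a\<close>. As \<open>a\<close> and \<open>b\<close> are dependent,
  every trace above \<open>y b\<close> has an \<open>a\<close> before its \<open>n\<close>-th \<open>b\<close>, whereas the \<open>n\<close>-th \<open>b\<close> in a trace above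
  \<open>x\<close> is reached without any \<open>a\<close>.
\<close>

lemma hits_separate:
  assumes ab: "(a, b) \<notin> I" "a \<noteq> b"
    and x: "x \<in> \<M>" "cnt b x = n" "cnt a x = 0"
    and y: "y \<in> \<M>" "cnt b (y \<odot> \<tau> [b]) = n" "0 < cnt a y"
  shows "up I x \<inter> up I (y \<odot> \<tau> [b]) = {}"
proof (rule ccontr)
  assume "up I x \<inter> up I (y \<odot> \<tau> [b]) \<noteq> {}"
  then obtain z where z: "x \<preceq> z" "y \<odot> \<tau> [b] \<preceq> z" 
    using up_common[of x "y \<odot> \<tau> [b]"] x y by auto
  then obtain w where w: "w \<in> \<M>" "w \<preceq> y \<odot> \<tau> [b]" "cnt b w = n" "cnt a w = 0"
    using meet[OF x(1) _ z] x y by auto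
  have ba: "(b, a) \<notin> I" using ab indep_sym by blast
  have "prefix (proj b a w) (proj b a (y \<odot> \<tau> [b]))"
    using le_iff_proj[of w "y \<odot> \<tau> [b]"] w(1,2) y(1) ba by simp
  then have "prefix (proj b a w) (proj b a y @ [b])"
    using y(1) ba by (simp add: proj_mult proj_letter)
  then consider "proj b a w = proj b a y @ [b]" | "prefix (proj b a w) (proj b a y)"
    by (auto simp: prefix_snoc)
  then show False
  proof cases
    case 1
    then have "proj a b w = proj a b y @ [b]" using proj_commute by metis
    then have "cnt a w = cnt a y"
      using count_proj[OF w(1) ab(1)] count_proj[OF y(1) ab(1)] ab(2) by simp
    with w y show False by simp
  next
    case 2
    then have "count_list (proj b a w) b \<le> count_list (proj b a y) b"
      by (auto simp: prefix_def)
    then have "cnt b w \<le> cnt b y"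
      using count_proj[OF w(1) ba] count_proj[OF y(1) ba] by simp
    with w y show False by simp
  qed
qed

definition occurs_at_least :: "'a \<Rightarrow> nat \<Rightarrow> (nat \<Rightarrow> 'a set) set" where
  "occurs_at_least b n = (\<Union>x\<in>first_hits b n. up I x)"

lemma occurs_at_least_iff: "\<omega> \<in> occurs_at_least b n \<longleftrightarrow> (\<exists>x\<in>\<M>. n \<le> cnt b x \<and> \<omega> \<in> up I x)"
proof
  assume "\<omega> \<in> occurs_at_least b n"
  then show "\<exists>x\<in>\<M>. n \<le> cnt b x \<and> \<omega> \<in> up I x"
    by (auto simp: occurs_at_least_def first_hits_def)
next
  assume "\<exists>x\<in>\<M>. n \<le> cnt b x \<and> \<omega> \<in> up I x"
  then obtain z where z: "z \<in> \<M>" "n \<le> cnt b z" "\<omega> \<in> up I z" by blast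
  obtain x where x: "x \<in> first_hits b n" "x \<preceq> z" using first_hits_exists[OF z(1,2)] by blast
  then have "\<omega> \<in> up I x" using up_mono[of x z] z by (auto simp: first_hits_def)
  with x show "\<omega> \<in> occurs_at_least b n" by (auto simp: occurs_at_least_def)
qed

lemma first_hits_subset: "first_hits b n \<subseteq> \<M>"
  by (auto simp: first_hits_def)

lemma Union_up_sets: "A \<subseteq> \<M> \<Longrightarrow> (\<Union>x\<in>A. up I x) \<in> sets (infinite_traces_borel I)"
  using countable_subset[OF _ countable_traces] by (intro sets.countable_UN') auto

lemma Union_up_mult_sets:
  assumes "x \<in> \<M>" "B \<subseteq> \<M>" shows "(\<Union>y\<in>B. up I (x \<odot> y)) \<in> sets (infinite_traces_borel I)"
  using assms countable_subset[OF assms(2) countable_traces]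
  by (intro sets.countable_UN') (auto intro!: up_sets mult_in)

lemma occurs_at_least_sets [simp]: "occurs_at_least b n \<in> sets (infinite_traces_borel I)"
  unfolding occurs_at_least_def by (intro Union_up_sets first_hits_subset)

lemma some_letter_infinitely_often:
  assumes "\<omega> \<in> infinite_traces I" shows "\<exists>b. \<forall>n. \<omega> \<in> occurs_at_least b n"
proof (rule ccontr)
  assume "\<not> ?thesis"
  then have "\<forall>b. \<exists>n. \<omega> \<notin> occurs_at_least b n" by blast
  from choice[OF this] obtain N where N: "\<And>b. \<omega> \<notin> occurs_at_least b (N b)" by blast
  let ?x = "clique_prefix I \<omega> (\<Sum>b\<in>UNIV. N b)"
  have "cnt b ?x < N b" for b
    using N[of b] clique_prefix_in_up[OF assms] unfolding occurs_at_least_iff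
    by (meson clique_prefix_in not_less)
  then have "(\<Sum>b\<in>UNIV. cnt b ?x) < (\<Sum>b\<in>UNIV. N b)"
    by (intro sum_strict_mono) auto
  then show False
    using length_clique_prefix[OF assms, of "\<Sum>b\<in>UNIV. N b"] by (simp add: length_eq_sum_cnt)
qed

end

locale markov_system = weighted_system I act f
  for I :: "'a::finite rel" and act :: "'s::finite option \<Rightarrow> 'a list set \<Rightarrow> 's option"
    and f :: "'s \<Rightarrow> 'a list set \<Rightarrow> real" +
  fixes m :: "'s \<Rightarrow> (nat \<Rightarrow> 'a set) measure"
  assumes prob_space_m: "prob_space (m \<alpha>)"
    and sets_m: "sets (m \<alpha>) = sets (infinite_traces_borel I)"
    and measure_up: "x \<in> \<M> \<Longrightarrow> measure (m \<alpha>) (up I x) = f \<alpha> x"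
begin

sublocale m: prob_space "m \<alpha>" for \<alpha> by (rule prob_space_m)

lemma space_m: "space (m \<alpha>) = infinite_traces I"
  using sets_eq_imp_space_eq[OF sets_m] by simp

lemma emeasure_up: "x \<in> \<M> \<Longrightarrow> emeasure (m \<alpha>) (up I x) = ennreal (f \<alpha> x)"
  by (simp add: m.emeasure_eq_measure measure_up)

lemma emeasure_Union_up:
  assumes "incompatible A"
  shows "emeasure (m \<alpha>) (\<Union>x\<in>A. up I x) = (\<integral>\<^sup>+x. ennreal (f \<alpha> x) \<partial>count_space A)"
proof -
  have A: "A \<subseteq> \<M>" using assms by (simp add: incompatible_def)
  have "emeasure (m \<alpha>) (\<Union>x\<in>A. up I x) = (\<integral>\<^sup>+x. emeasure (m \<alpha>) (up I x) \<partial>count_space A)"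
    using A countable_subset[OF A countable_traces] incompatible_disjoint[OF assms]
    by (intro emeasure_UN_countable) (auto simp: sets_m)
  also have "\<dots> = (\<integral>\<^sup>+x. ennreal (f \<alpha> x) \<partial>count_space A)"
    using A by (intro nn_integral_cong) (auto simp: emeasure_up)
  finally show ?thesis .
qed

lemma emeasure_Union_up_mult:
  assumes "incompatible A" "x \<in> \<M>" and c: "\<And>\<beta>. measure (m \<beta>) (\<Union>y\<in>A. up I y) \<le> c"
  shows "emeasure (m \<alpha>) (\<Union>y\<in>A. up I (x \<odot> y)) \<le> ennreal c * ennreal (f \<alpha> x)"
proof -
  have A: "A \<subseteq> \<M>" using assms(1) by (simp add: incompatible_def)
  have "emeasure (m \<alpha>) (\<Union>y\<in>A. up I (x \<odot> y)) = (\<integral>\<^sup>+y. emeasure (m \<alpha>) (up I (x \<odot> y)) \<partial>count_space A)"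
    using A assms(2) countable_subset[OF A countable_traces] incompatible_mult[OF assms(1,2)]
    by (intro emeasure_UN_countable) (auto simp: sets_m)
  also have "\<dots> = (\<integral>\<^sup>+y. ennreal (f \<alpha> x) * ennreal (at_state f (act (Some \<alpha>) x) y) \<partial>count_space A)"
    using A assms(2)
    by (intro nn_integral_cong) (auto simp: emeasure_up f_mult ennreal_mult f_nonneg at_state_f_nonneg)
  also have "\<dots> = ennreal (f \<alpha> x) * (\<integral>\<^sup>+y. ennreal (at_state f (act (Some \<alpha>) x) y) \<partial>count_space A)"
    by (rule nn_integral_cmult) simp
  also have "\<dots> \<le> ennreal (f \<alpha> x) * ennreal c"
  proof (rule mult_left_mono)
    show "(\<integral>\<^sup>+y. ennreal (at_state f (act (Some \<alpha>) x) y) \<partial>count_space A) \<le> ennreal c"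
    proof (cases "act (Some \<alpha>) x")
      case (Some \<beta>)
      then show ?thesis
        using emeasure_Union_up[OF assms(1), of \<beta>, symmetric] c[of \<beta>]
        by (simp add: m.emeasure_eq_measure ennreal_leI)
    qed simp
  qed simp
  finally show ?thesis by (simp add: mult.commute)
qed

text \<open>
  The strong Markov property, in the form of an upper bound: after a stopping time with values in \<open>A\<close>,
  the remaining infinite trace extends an element of \<open>B\<close> with conditional probability at most \<open>c\<close>.
\<close>

lemma measure_Union_up_mult_le:
  assumes "incompatible A" "incompatible B"
    and c: "\<And>\<beta>. measure (m \<beta>) (\<Union>y\<in>B. up I y) \<le> c"
  shows "measure (m \<alpha>) (\<Union>x\<in>A. \<Union>y\<in>B. up I (x \<odot> y)) \<le> c * measure (m \<alpha>) (\<Union>x\<in>A. up I x)"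
proof -
  have A: "A \<subseteq> \<M>" and B: "B \<subseteq> \<M>" using assms(1,2) by (auto simp: incompatible_def)
  have c0: "0 \<le> c" using c[of undefined] measure_nonneg[of "m undefined" "\<Union>y\<in>B. up I y"] by linarith
  have sub: "(\<Union>y\<in>B. up I (x \<odot> y)) \<subseteq> up I x" if "x \<in> A" for x
    using that A B up_mono[OF _ leI] by blast
  have "disjoint_family_on (\<lambda>x. \<Union>y\<in>B. up I (x \<odot> y)) A"
    unfolding disjoint_family_on_def
  proof (intro ballI impI)
    fix x x' assume x: "x \<in> A" "x' \<in> A" "x \<noteq> x'"
    then have "up I x \<inter> up I x' = {}"
      using incompatible_disjoint[OF assms(1)] by (simp add: disjoint_family_on_def)
    with sub[OF x(1)] sub[OF x(2)] show "(\<Union>y\<in>B. up I (x \<odot> y)) \<inter> (\<Union>y\<in>B. up I (x' \<odot> y)) = {}"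
      by blast
  qed
  moreover have "(\<Union>y\<in>B. up I (x \<odot> y)) \<in> sets (m \<alpha>)" if "x \<in> A" for x
    using that A B Union_up_mult_sets[of x B] by (auto simp: sets_m)
  ultimately have "emeasure (m \<alpha>) (\<Union>x\<in>A. \<Union>y\<in>B. up I (x \<odot> y)) =
      (\<integral>\<^sup>+x. emeasure (m \<alpha>) (\<Union>y\<in>B. up I (x \<odot> y)) \<partial>count_space A)"
    using countable_subset[OF A countable_traces] by (intro emeasure_UN_countable)
  also have "\<dots> \<le> (\<integral>\<^sup>+x. ennreal c * ennreal (f \<alpha> x) \<partial>count_space A)"
    using A by (intro nn_integral_mono) (auto intro!: emeasure_Union_up_mult assms(2) c)
  also have "\<dots> = ennreal c * emeasure (m \<alpha>) (\<Union>x\<in>A. up I x)"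
    unfolding emeasure_Union_up[OF assms(1)] by (rule nn_integral_cmult) simp
  finally show ?thesis
    using c0 by (simp add: m.emeasure_eq_measure ennreal_mult[symmetric])
qed

text \<open>
  For distinct dependent \<open>a\<close> and \<open>b\<close>, the infinite traces above these traces are those whose projection to
  \<open>{a, b}\<close> starts with \<open>b\<^sup>n\<close>.
\<close>

definition avoiding :: "'a \<Rightarrow> 'a \<Rightarrow> nat \<Rightarrow> 'a list set set" where
  "avoiding a b n = {x \<in> first_hits b n. cnt a x = 0}"

lemma avoiding_incompatible: "incompatible (avoiding a b n)"
  by (rule first_hits_incompatible[of _ b n]) (auto simp: avoiding_def)

lemma avoiding_subset: "avoiding a b n \<subseteq> \<M>"
  by (auto simp: avoiding_def first_hits_def)

definition avoid_prob :: "'a \<Rightarrow> 'a \<Rightarrow> nat \<Rightarrow> 's \<Rightarrow> real" where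
  "avoid_prob a b n \<alpha> = measure (m \<alpha>) (\<Union>x\<in>avoiding a b n. up I x)"

lemma avoiding_add:
  "(\<Union>x\<in>avoiding a b (k + n). up I x) \<subseteq> (\<Union>x\<in>avoiding a b k. \<Union>y\<in>avoiding a b n. up I (x \<odot> y))"
proof
  fix \<omega> assume "\<omega> \<in> (\<Union>x\<in>avoiding a b (k + n). up I x)"
  then obtain x where x: "x \<in> first_hits b (k + n)" "cnt a x = 0" "\<omega> \<in> up I x"
    by (auto simp: avoiding_def)
  obtain y z where yz: "y \<in> first_hits b k" "z \<in> first_hits b n" "x = y \<odot> z"
    using first_hits_add[OF x(1)] by blast
  moreover have "cnt a y = 0" "cnt a z = 0"
    using x(2) yz subsetD[OF first_hits_subset yz(1)] subsetD[OF first_hits_subset yz(2)] by auto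
  ultimately show "\<omega> \<in> (\<Union>x\<in>avoiding a b k. \<Union>y\<in>avoiding a b n. up I (x \<odot> y))"
    using x by (auto simp: avoiding_def)
qed

lemma avoiding_mult_sets:
  "A \<subseteq> \<M> \<Longrightarrow> (\<Union>x\<in>A. \<Union>y\<in>avoiding a b n. up I (x \<odot> y)) \<in> sets (m \<alpha>)"
  unfolding sets_m using countable_subset[OF _ countable_traces]
  by (intro sets.countable_UN'[of A]) (auto intro!: Union_up_mult_sets[OF _ avoiding_subset])

lemma avoid_prob_antimono: "k \<le> n \<Longrightarrow> avoid_prob a b n \<alpha> \<le> avoid_prob a b k \<alpha>"
  unfolding avoid_prob_def
proof (rule m.finite_measure_mono)
  assume "k \<le> n"
  then have "(\<Union>x\<in>avoiding a b n. up I x) \<subseteq> (\<Union>x\<in>avoiding a b k. \<Union>y\<in>avoiding a b (n - k). up I (x \<odot> y))"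
    using avoiding_add[of a b k "n - k"] by simp
  also have "\<dots> \<subseteq> (\<Union>x\<in>avoiding a b k. up I x)"
  proof (intro UN_mono UN_least order_refl)
    fix x y assume "x \<in> avoiding a b k" "y \<in> avoiding a b (n - k)"
    then have "x \<in> \<M>" "y \<in> \<M>" using avoiding_subset by auto
    then show "up I (x \<odot> y) \<subseteq> up I x" by (intro up_mono leI)
  qed
  finally show "(\<Union>x\<in>avoiding a b n. up I x) \<subseteq> (\<Union>x\<in>avoiding a b k. up I x)" .
qed (use Union_up_sets[OF avoiding_subset] in \<open>simp add: sets_m\<close>)

lemma avoid_prob_mult:
  assumes "\<And>\<beta>. avoid_prob a b n \<beta> \<le> c"
  shows "avoid_prob a b (k + n) \<alpha> \<le> c * avoid_prob a b k \<alpha>"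
proof -
  have "avoid_prob a b (k + n) \<alpha> \<le> measure (m \<alpha>) (\<Union>x\<in>avoiding a b k. \<Union>y\<in>avoiding a b n. up I (x \<odot> y))"
    unfolding avoid_prob_def
    by (intro m.finite_measure_mono avoiding_add avoiding_mult_sets avoiding_subset)
  also have "\<dots> \<le> c * avoid_prob a b k \<alpha>"
    using assms unfolding avoid_prob_def
    by (intro measure_Union_up_mult_le avoiding_incompatible)
  finally show ?thesis .
qed

text \<open>
  From \<open>\<alpha>\<close> some enabled trace contains first \<open>a\<close> and then ends with \<open>b\<close>. It has positive
  probability, and by \<open>hits_separate\<close> it rules out the event in question.
\<close>

lemma avoid_prob_less_1:
  assumes ab: "(a, b) \<notin> I" "a \<noteq> b"
  shows "\<exists>n. avoid_prob a b n \<alpha> < 1"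
proof -
  obtain u \<beta> where u: "u \<in> \<M>" "act (Some \<alpha>) (u \<odot> \<tau> [a]) = Some \<beta>"
    using letter_reachable[of \<alpha> a] by blast
  obtain v where v: "v \<in> \<M>" "act (Some \<beta>) (v \<odot> \<tau> [b]) \<noteq> None"
    using letter_reachable[of \<beta> b] by blast
  let ?y = "u \<odot> \<tau> [a] \<odot> v"
  let ?n = "cnt b (?y \<odot> \<tau> [b])"
  have y: "?y \<in> \<M>" "0 < cnt a ?y" using u v by auto
  have "act (Some \<alpha>) (?y \<odot> \<tau> [b]) \<noteq> None"
    using u v by (simp add: act_mult)
  then have pos: "0 < measure (m \<alpha>) (up I (?y \<odot> \<tau> [b]))"
    using y f_pos_iff by (simp add: measure_up)
  have "(\<Union>x\<in>avoiding a b ?n. up I x) \<inter> up I (?y \<odot> \<tau> [b]) = {}"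
    using hits_separate[OF ab _ _ _ y(1) HOL.refl y(2)] by (auto simp: avoiding_def first_hits_def)
  then have "avoid_prob a b ?n \<alpha> + measure (m \<alpha>) (up I (?y \<odot> \<tau> [b])) =
    measure (m \<alpha>) ((\<Union>x\<in>avoiding a b ?n. up I x) \<union> up I (?y \<odot> \<tau> [b]))"
    unfolding avoid_prob_def using y(1) Union_up_sets[OF avoiding_subset]
    by (intro m.finite_measure_Union[symmetric]) (auto simp: sets_m)
  also have "\<dots> \<le> 1" by (rule m.prob_le_1)
  finally show ?thesis using pos by (intro exI[of _ ?n]) linarith
qed

text \<open>
  There are finitely many states, so some block length \<open>K\<close> and some \<open>c < 1\<close> bound the probability for
  all of them; the bound is then multiplied for each further block of \<open>K\<close> occurrences of \<open>b\<close>.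
\<close>

lemma avoid_prob_tendsto_0:
  assumes ab: "(a, b) \<notin> I" "a \<noteq> b" and e: "0 < e"
  shows "\<exists>n. \<forall>\<alpha>. avoid_prob a b n \<alpha> \<le> e"
proof -
  have "\<forall>\<alpha>. \<exists>n. avoid_prob a b n \<alpha> < 1" using avoid_prob_less_1[OF ab] by blast
  from choice[OF this] obtain N where N: "\<And>\<alpha>. avoid_prob a b (N \<alpha>) \<alpha> < 1" by blast
  \<comment> \<open>The probabilities are antitone in the number of occurrences, so the largest index serves all states.\<close>
  define K where "K = Max (range N)"
  define c where "c = Max (range (avoid_prob a b K))"
  have less: "avoid_prob a b K \<alpha> < 1" for \<alpha>
    using avoid_prob_antimono[of "N \<alpha>" K a b \<alpha>] N[of \<alpha>] by (simp add: K_def)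
  then have c1: "c < 1" by (simp add: c_def)
  have c: "avoid_prob a b K \<alpha> \<le> c" for \<alpha> by (simp add: c_def)
  have c0: "0 \<le> c" using c[of undefined] measure_nonneg unfolding avoid_prob_def by (rule order_trans[rotated])
  have pow: "avoid_prob a b (j * K) \<alpha> \<le> c ^ j" for j \<alpha>
  proof (induction j)
    case 0
    show ?case by (simp add: avoid_prob_def)
  next
    case (Suc j)
    have "avoid_prob a b (j * K + K) \<alpha> \<le> c * avoid_prob a b (j * K) \<alpha>"
      by (rule avoid_prob_mult[OF c])
    also have "\<dots> \<le> c * c ^ j" using Suc c0 by (intro mult_left_mono)
    finally show ?case by (simp add: add.commute)
  qed
  obtain j where "c ^ j < e" using real_arch_pow_inv[OF e c1] by blast
  then have "avoid_prob a b (j * K) \<alpha> \<le> e" for \<alpha>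
    using pow[of j \<alpha>] by linarith
  then show ?thesis by blast
qed

text \<open>
  If \<open>a\<close> occurs exactly \<open>k\<close> times while \<open>b\<close> occurs infinitely often, then the remainder after the \<open>k\<close>-th \<open>a\<close>
  contains arbitrarily many occurrences of \<open>b\<close> and no \<open>a\<close>.
\<close>

lemma AE_infinitely_often_dependent:
  assumes ab: "(a, b) \<notin> I" "a \<noteq> b"
  shows "AE \<omega> in m \<alpha>. (\<forall>n. \<omega> \<in> occurs_at_least b n) \<longrightarrow> (\<forall>n. \<omega> \<in> occurs_at_least a n)"
proof -
  define E where "E k = {\<omega> \<in> infinite_traces I. (\<forall>n. \<omega> \<in> occurs_at_least b n) \<and> \<omega> \<in> occurs_at_least a k \<and> \<omega> \<notin> occurs_at_least a (Suc k)}" for k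
  have E_eq: "E k = ((\<Inter>n. occurs_at_least b n) \<inter> occurs_at_least a k) - occurs_at_least a (Suc k)" for k
    using up_subset by (auto simp: E_def occurs_at_least_def)
  have E_sets: "E k \<in> sets (m \<alpha>)" for k
    unfolding E_eq by (intro sets.Diff sets.Int sets.countable_INT) (auto simp: sets_m)
  have sub: "E k \<subseteq> (\<Union>x\<in>first_hits a k. \<Union>y\<in>avoiding a b n. up I (x \<odot> y))" for k n
  proof
    fix \<omega> assume \<omega>: "\<omega> \<in> E k"
    then obtain x where x: "x \<in> first_hits a k" "\<omega> \<in> up I x"
      by (auto simp: E_def occurs_at_least_def)
    have xM: "x \<in> \<M>" "cnt a x = k" using x by (auto simp: first_hits_def)
    have "\<omega> \<in> occurs_at_least b (n + cnt b x)" using \<omega> by (simp add: E_def)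
    then obtain z' where z': "z' \<in> \<M>" "n + cnt b x \<le> cnt b z'" "\<omega> \<in> up I z'"
      unfolding occurs_at_least_iff by blast
    then obtain z where z: "z \<in> \<M>" "x \<preceq> z" "z' \<preceq> z" "\<omega> \<in> up I z"
      using up_common[OF xM(1) z'(1) x(2) z'(3)] by blast
    obtain v where v: "v \<in> \<M>" "z = x \<odot> v" using z(2) by (auto elim: leE)
    have "\<not> Suc k \<le> cnt a z" using \<omega> z unfolding E_def occurs_at_least_iff by blast
    then have av: "cnt a v = 0" using v xM by simp
    have "n \<le> cnt b v" using cnt_mono[OF z'(1) z(3), of b] z'(2) v xM by simp
    then obtain y where y: "y \<in> first_hits b n" "y \<preceq> v" using first_hits_exists v by blast
    have yM: "y \<in> \<M>" using y by (auto simp: first_hits_def)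
    have "cnt a y = 0" using cnt_mono[OF yM y(2), of a] av by simp
    moreover have "\<omega> \<in> up I (x \<odot> y)"
      using up_mono[of "x \<odot> y" z] mult_mono[OF xM(1) yM y(2)] xM yM v z by auto
    ultimately show "\<omega> \<in> (\<Union>x\<in>first_hits a k. \<Union>y\<in>avoiding a b n. up I (x \<odot> y))"
      using x y by (auto simp: avoiding_def)
  qed
  have "measure (m \<alpha>) (E k) = 0" for k
  proof (rule antisym[OF _ measure_nonneg], rule field_le_epsilon)
    fix e :: real assume e: "0 < e"
    obtain n where n: "\<And>\<beta>. avoid_prob a b n \<beta> \<le> e"
      using avoid_prob_tendsto_0[OF ab e] by blast
    have "measure (m \<alpha>) (E k) \<le> measure (m \<alpha>) (\<Union>x\<in>first_hits a k. \<Union>y\<in>avoiding a b n. up I (x \<odot> y))"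
      by (intro m.finite_measure_mono sub avoiding_mult_sets first_hits_subset)
    also have "\<dots> \<le> e * measure (m \<alpha>) (\<Union>x\<in>first_hits a k. up I x)"
      using n unfolding avoid_prob_def
      by (intro measure_Union_up_mult_le avoiding_incompatible first_hits_incompatible[OF order_refl])
    also have "\<dots> \<le> e * 1" using e by (intro mult_left_mono m.prob_le_1) simp
    finally show "measure (m \<alpha>) (E k) \<le> 0 + e" by simp
  qed
  then have null: "E k \<in> null_sets (m \<alpha>)" for k
    using E_sets by (intro null_setsI) (auto simp: m.emeasure_eq_measure)
  have "AE \<omega> in m \<alpha>. \<forall>k. \<omega> \<notin> E k"
    unfolding AE_all_countable using AE_not_in[OF null] by blast
  then show ?thesis
  proof (rule AE_mp[OF _ AE_I2], intro impI)
    fix \<omega> assume \<omega>: "\<omega> \<in> space (m \<alpha>)" "\<forall>k. \<omega> \<notin> E k" and b: "\<forall>n. \<omega> \<in> occurs_at_least b n"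
    show "\<forall>n. \<omega> \<in> occurs_at_least a n"
    proof
      fix n show "\<omega> \<in> occurs_at_least a n"
      proof (induction n)
        case 0
        have "\<omega> \<in> up I \<epsilon>" using \<omega>(1) by (simp add: space_m)
        then show ?case unfolding occurs_at_least_iff using one_in by blast
      next
        case (Suc n)
        then show ?case using \<omega> b by (auto simp: E_def space_m)
      qed
    qed
  qed
qed

lemma AE_every_letter: "AE \<omega> in m \<alpha>. \<omega> \<in> occurs_at_least a n"
proof -
  have "AE \<omega> in m \<alpha>. \<forall>p\<in>UNIV - I. (\<forall>n. \<omega> \<in> occurs_at_least (fst p) n) \<longrightarrow> (\<forall>n. \<omega> \<in> occurs_at_least (snd p) n)"
  proof (rule AE_finite_allI)
    fix p assume p: "p \<in> UNIV - I"
    show "AE \<omega> in m \<alpha>. (\<forall>n. \<omega> \<in> occurs_at_least (fst p) n) \<longrightarrow> (\<forall>n. \<omega> \<in> occurs_at_least (snd p) n)"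
    proof (cases "fst p = snd p")
      case False
      have "(snd p, fst p) \<notin> I" using p indep_sym[of "fst p" "snd p"] by auto
      from AE_infinitely_often_dependent[OF this] False show ?thesis by simp
    qed simp
  qed simp
  then show ?thesis
  proof (rule AE_mp[OF _ AE_I2], intro impI)
    fix \<omega> assume \<omega>: "\<omega> \<in> space (m \<alpha>)"
      "\<forall>p\<in>UNIV - I. (\<forall>n. \<omega> \<in> occurs_at_least (fst p) n) \<longrightarrow> (\<forall>n. \<omega> \<in> occurs_at_least (snd p) n)"
    obtain b where b: "\<forall>n. \<omega> \<in> occurs_at_least b n"
      using some_letter_infinitely_often[of \<omega>] \<omega>(1) by (auto simp: space_m)
    have "(b, a) \<in> (UNIV - I)\<^sup>*" by (rule dependence_connected)
    then have "\<forall>n. \<omega> \<in> occurs_at_least a n"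
    proof induction
      case base show ?case by (rule b)
    next
      case (step c d) then show ?case using bspec[OF \<omega>(2) step.hyps(2)] by simp
    qed
    then show "\<omega> \<in> occurs_at_least a n" ..
  qed
qed

text \<open>
  The only fact about Markov measures needed for uniqueness.
\<close>

lemma first_hits_total: "(\<integral>\<^sup>+x. ennreal (f \<alpha> x) \<partial>count_space (first_hits a n)) = 1"
proof -
  have "emeasure (m \<alpha>) (occurs_at_least a n) = 1"
    using AE_every_letter[of a n \<alpha>] by (intro m.emeasure_eq_1_AE) (auto simp: sets_m)
  then show ?thesis
    using emeasure_Union_up[OF first_hits_incompatible[OF order_refl], of \<alpha> a n]
    by (simp add: occurs_at_least_def)
qed

end

section \<open>Uniqueness and convergence\<close>

context irreducible_system begin

lemma probabilistic_markov_system: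
  assumes "probabilistic_valuation I act g" shows "\<exists>m. markov_system I act g m"
proof -
  obtain m where m: "valuation I act g" "markov_measure I act m"
    "\<And>\<alpha> x. x \<in> \<M> \<Longrightarrow> g \<alpha> x = measure (m \<alpha>) (up I x)"
    using assms unfolding probabilistic_valuation_def by blast
  then have "markov_system I act g m"
    by (intro markov_system.intro weighted_system.intro irreducible_system_axioms
        weighted_system_axioms.intro markov_system_axioms.intro)
      (auto simp: markov_measure_def)
  then show ?thesis by blast
qed

lemma enabled_letter: "\<exists>a \<beta>. act (Some \<alpha>) (\<tau> [a]) = Some \<beta>"
proof -
  fix b
  obtain u where u: "u \<in> \<M>" "act (Some \<alpha>) (u \<odot> \<tau> [b]) \<noteq> None"
    using letter_reachable by blast
  obtain v where v: "u = \<tau> v" using u(1) by (rule trace_cases)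
  obtain c w where "v @ [b] = c # w" by (cases "v @ [b]") auto
  then have "u \<odot> \<tau> [b] = \<tau> [c] \<odot> \<tau> w" using v by (simp add: mult_trace_of)
  then have "act (Some \<alpha>) (\<tau> [c]) \<noteq> None"
    using u(2) act_prefix[of "\<tau> [c]" "\<tau> w"] by simp
  then show ?thesis by blast
qed

lemma closed_under_letters:
  assumes step: "\<And>\<alpha> a \<beta>. \<alpha> \<in> S \<Longrightarrow> act (Some \<alpha>) (\<tau> [a]) = Some \<beta> \<Longrightarrow> \<beta> \<in> S"
    and "\<alpha> \<in> S"
  shows "\<beta> \<in> S"
proof -
  have "\<alpha> \<in> S \<Longrightarrow> act (Some \<alpha>) (\<tau> w) = Some \<beta> \<Longrightarrow> \<beta> \<in> S" for w
  proof (induction w arbitrary: \<alpha>)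
    case Nil
    then show ?case by (simp add: one_eq[symmetric])
  next
    case (Cons a w)
    have eq: "act (Some \<alpha>) (\<tau> (a # w)) = act (act (Some \<alpha>) (\<tau> [a])) (\<tau> w)"
      by (simp add: act_mult[symmetric] mult_trace_of)
    then obtain \<gamma> where \<gamma>: "act (Some \<alpha>) (\<tau> [a]) = Some \<gamma>"
      using Cons.prems(2) by (cases "act (Some \<alpha>) (\<tau> [a])") auto
    then show ?case using Cons.IH[OF step[OF Cons.prems(1) \<gamma>]] Cons.prems(2) eq by simp
  qed
  moreover obtain w where "act (Some \<alpha>) (\<tau> w) = Some \<beta>"
    using reachable[of \<alpha> \<beta>] by (metis trace_cases)
  ultimately show ?thesis using assms(2) by blast
qed

text \<open>
  A maximum principle. A positive cocycle is of the form \<open>\<Gamma>(\<alpha>, \<beta>) = \<lambda>(\<beta>) / \<lambda>(\<alpha>)\<close>. At the states where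
  \<open>\<lambda>\<close> is maximal one has \<open>g \<le> f\<close>, while both valuations sum to \<open>1\<close> over \<open>first_hits a 1\<close>; hence they
  agree at \<open>a \<in> first_hits a 1\<close>.
\<close>

theorem twist_between_probabilistic_trivial:
  assumes f: "markov_system I act f mf" and g: "markov_system I act g mg"
    and r: "0 < r" "r \<le> 1" and \<Gamma>: "positive_cocycle \<Gamma>"
    and twist: "\<And>\<alpha> x. x \<in> \<M> \<Longrightarrow> g \<alpha> x = twisted_valuation act f r \<Gamma> \<alpha> x"
  shows "r = 1 \<and> (\<forall>\<alpha> \<beta>. \<Gamma> \<alpha> \<beta> = 1)"
proof -
  interpret F: markov_system I act f mf by (rule f)
  interpret H: markov_system I act g mg by (rule g)
  define lam where "lam = \<Gamma> undefined"
  have lam_pos: "0 < lam \<alpha>" for \<alpha> using \<Gamma> by (simp add: lam_def positive_cocycle_def)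
  have \<Gamma>_eq: "\<Gamma> \<alpha> \<beta> = lam \<beta> / lam \<alpha>" for \<alpha> \<beta>
  proof -
    have "lam \<beta> = lam \<alpha> * \<Gamma> \<alpha> \<beta>"
      using \<Gamma> unfolding lam_def positive_cocycle_def cocycle_def by blast
    then show ?thesis using lam_pos[of \<alpha>] by (simp add: field_simps)
  qed
  define S where "S = {\<alpha>. \<forall>\<beta>. lam \<beta> \<le> lam \<alpha>}"
  have "Max (range lam) \<in> range lam" by (intro Max_in) auto
  then obtain \<alpha>0 where "Max (range lam) = lam \<alpha>0" by blast
  then have \<alpha>0: "\<alpha>0 \<in> S" using Max_ge[of "range lam"] by (auto simp: S_def)
  have key: "r * \<Gamma> \<alpha> \<beta> = 1" if \<alpha>: "\<alpha> \<in> S" and \<beta>: "act (Some \<alpha>) (\<tau> [a]) = Some \<beta>" for \<alpha> a \<beta>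
  proof -
    have le1: "\<Gamma> \<alpha> \<gamma> \<le> 1" for \<gamma> using \<alpha> lam_pos[of \<alpha>] by (simp add: \<Gamma>_eq S_def)
    have le: "g \<alpha> x \<le> f \<alpha> x" if x: "x \<in> \<M>" for x
    proof (cases "act (Some \<alpha>) x")
      case None
      then show ?thesis using x F.f_nonneg by (simp add: twist twisted_valuation_def)
    next
      case (Some \<gamma>)
      have "r ^ \<ell> x * \<Gamma> \<alpha> \<gamma> \<le> 1"
        using r le1[of \<gamma>] power_le_one[of r "\<ell> x"] lam_pos by (intro mult_le_one) (auto simp: \<Gamma>_eq less_imp_le)
      then show ?thesis
        using mult_right_mono[OF _ F.f_nonneg[OF x, of \<alpha>], of "r ^ \<ell> x * \<Gamma> \<alpha> \<gamma>" 1] x Some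
        by (simp add: twist twisted_valuation_def)
    qed
    let ?x = "\<tau> [a]" and ?C = "count_space (first_hits a 1)"
    let ?d = "f \<alpha> ?x - g \<alpha> ?x"
    have d: "0 \<le> ?d" using le by simp
    have "1 + ennreal ?d = (\<integral>\<^sup>+x. ennreal (g \<alpha> x) \<partial>?C) + (\<integral>\<^sup>+x. ennreal ?d * indicator {?x} x \<partial>?C)"
      using letter_first_hit[of a]
      by (subst nn_integral_cmult_indicator) (auto simp: H.first_hits_total[unfolded One_nat_def])
    also have "\<dots> = (\<integral>\<^sup>+x. ennreal (g \<alpha> x) + ennreal ?d * indicator {?x} x \<partial>?C)"
      by (rule nn_integral_add[symmetric]) auto
    also have "\<dots> \<le> (\<integral>\<^sup>+x. ennreal (f \<alpha> x) \<partial>?C)"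
    proof (rule nn_integral_mono)
      fix x assume "x \<in> space ?C"
      then have x: "x \<in> \<M>" using first_hits_subset by auto
      show "ennreal (g \<alpha> x) + ennreal ?d * indicator {?x} x \<le> ennreal (f \<alpha> x)"
      proof (cases "x = ?x")
        case True
        then show ?thesis
          using d H.f_nonneg[of ?x \<alpha>] by (simp add: ennreal_plus[symmetric] del: ennreal_plus)
      next
        case False
        then show ?thesis using le[OF x] by (simp add: ennreal_leI)
      qed
    qed
    also have "\<dots> = 1" by (rule F.first_hits_total)
    finally have "ennreal (1 + ?d) \<le> ennreal 1" using d by simp
    then have "?d \<le> 0" by (subst (asm) ennreal_le_iff) auto
    with d have "f \<alpha> ?x = r * \<Gamma> \<alpha> \<beta> * f \<alpha> ?x"
      using \<beta> twist[of ?x \<alpha>] by (simp add: twisted_valuation_def)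
    moreover have "0 < f \<alpha> ?x" using F.f_pos_iff[of ?x \<alpha>] \<beta> by simp
    ultimately show ?thesis by simp
  qed
  have split: "r = 1 \<and> \<Gamma> \<alpha> \<beta> = 1" if "\<alpha> \<in> S" "act (Some \<alpha>) (\<tau> [a]) = Some \<beta>" for \<alpha> a \<beta>
  proof -
    have \<Gamma>1: "\<Gamma> \<alpha> \<beta> \<le> 1" "0 < \<Gamma> \<alpha> \<beta>" using that(1) lam_pos by (auto simp: \<Gamma>_eq S_def)
    have k: "r * \<Gamma> \<alpha> \<beta> = 1" by (rule key[OF that])
    have "1 \<le> r" using mult_left_mono[OF \<Gamma>1(1), of r] r k by simp
    with r have "r = 1" by simp
    with k show ?thesis by simp
  qed
  have "\<beta> \<in> S" for \<beta>
  proof (rule closed_under_letters[OF _ \<alpha>0])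
    fix \<alpha> a \<beta> assume \<alpha>: "\<alpha> \<in> S" and "act (Some \<alpha>) (\<tau> [a]) = Some \<beta>"
    then have "\<Gamma> \<alpha> \<beta> = 1" using split by blast
    then have "lam \<beta> = lam \<alpha>" using lam_pos[of \<alpha>] by (simp add: \<Gamma>_eq)
    with \<alpha> show "\<beta> \<in> S" by (simp add: S_def)
  qed
  then have "lam \<alpha> = lam \<beta>" for \<alpha> \<beta> by (auto simp: S_def intro: antisym)
  then have "\<Gamma> \<alpha> \<beta> = 1" for \<alpha> \<beta> using lam_pos[of \<alpha>] by (metis \<Gamma>_eq divide_self less_irrefl)
  moreover have "r = 1" using enabled_letter[of \<alpha>0] split[OF \<alpha>0] by blast
  ultimately show ?thesis by blast
qed

lemma positive_cocycle_divide:
  assumes "positive_cocycle \<Gamma>" "positive_cocycle \<Delta>"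
  shows "positive_cocycle (\<lambda>\<alpha> \<beta>. \<Gamma> \<alpha> \<beta> / \<Delta> \<alpha> \<beta>)"
  using assms unfolding positive_cocycle_def cocycle_def
  by (metis divide_nonneg_nonneg divide_pos_pos times_divide_times_eq)

text \<open>
  Each of the two twists of \<open>f\<close> is itself a twist of the other one; the one with the smaller
  real parameter is considered as a twist of the one with the larger parameter.
\<close>

lemma probabilistic_twist_unique:
  assumes "0 < r" "0 < r'" "positive_cocycle \<Gamma>" "positive_cocycle \<Gamma>'"
    and "probabilistic_valuation I act (twisted_valuation act f r \<Gamma>)"
    and "probabilistic_valuation I act (twisted_valuation act f r' \<Gamma>')"
  shows "r = r' \<and> \<Gamma> = \<Gamma>'"
proof -
  have *: "r = r' \<and> \<Gamma> = \<Gamma>'"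
    if r: "0 < r" "0 < r'" "r' \<le> r" and \<Gamma>: "positive_cocycle \<Gamma>" "positive_cocycle \<Gamma>'"
      and p: "probabilistic_valuation I act (twisted_valuation act f r \<Gamma>)"
        "probabilistic_valuation I act (twisted_valuation act f r' \<Gamma>')"
    for r r' \<Gamma> \<Gamma>'
  proof -
    let ?\<Gamma> = "\<lambda>\<alpha> \<beta>. \<Gamma>' \<alpha> \<beta> / \<Gamma> \<alpha> \<beta>"
    have pos: "\<Gamma> \<alpha> \<beta> > 0" for \<alpha> \<beta> using \<Gamma>(1) by (simp add: positive_cocycle_def)
    obtain m m' where m: "markov_system I act (twisted_valuation act f r \<Gamma>) m"
      and m': "markov_system I act (twisted_valuation act f r' \<Gamma>') m'"
      using probabilistic_markov_system p by meson
    have twist: "twisted_valuation act f r' \<Gamma>' \<alpha> x =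
        twisted_valuation act (twisted_valuation act f r \<Gamma>) (r' / r) ?\<Gamma> \<alpha> x" for \<alpha> x
      using r pos by (simp add: twisted_valuation_def power_divide less_imp_neq[symmetric] split: option.split)
    have "r' / r = 1 \<and> (\<forall>\<alpha> \<beta>. ?\<Gamma> \<alpha> \<beta> = 1)"
      using r by (intro twist_between_probabilistic_trivial[OF m m' _ _ positive_cocycle_divide[OF \<Gamma>(2,1)] twist]) auto
    then have "r' = r" "\<Gamma>' \<alpha> \<beta> = \<Gamma> \<alpha> \<beta>" for \<alpha> \<beta>
      using r pos[of \<alpha> \<beta>] by (simp_all add: field_simps)
    then show ?thesis by (simp add: fun_eq_iff)
  qed
  show ?thesis
  proof (cases "r' \<le> r")
    case True
    then show ?thesis using *[of r r' \<Gamma> \<Gamma>'] assms by blast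
  next
    case False
    then show ?thesis using *[of r' r \<Gamma>' \<Gamma>] assms by auto
  qed
qed

end

context weighted_system begin

text \<open>
  By uniqueness every sequence increasing to \<open>rad\<close> has a subsequence along which the ratios tend to the same
  cocycle \<open>\<Delta>\<close>.
\<close>

lemma G_ratio_tendsto:
  "\<exists>\<Delta>. positive_cocycle \<Delta> \<and> probabilistic_valuation I act (twisted_valuation act f rad \<Delta>) \<and>
    (\<forall>\<alpha> \<beta>. ((\<lambda>s. G \<beta> s / G \<alpha> s) \<longlongrightarrow> \<Delta> \<alpha> \<beta>) (at_left rad))"
proof -
  \<comment> \<open>Any sequence will do here; it only serves to produce one candidate for the limit.\<close>
  define \<sigma> where "\<sigma> n = rad - rad / 2 / real (Suc n)" for n
  have "rad / 2 / real (Suc n) \<le> rad / 2 / 1" for n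
    using rad_pos by (intro divide_left_mono) auto
  then have 1: "rad / 2 \<le> \<sigma> n" for n unfolding \<sigma>_def by (smt (verit) field_sum_of_halves div_by_1)
  have 2: "\<sigma> n < rad" for n using rad_pos by (simp add: \<sigma>_def)
  have "(\<lambda>n. rad / 2 / real (Suc n)) \<longlonglongrightarrow> 0"
    by (rule LIMSEQ_Suc[OF lim_const_over_n])
  then have 3: "\<sigma> \<longlonglongrightarrow> rad"
    unfolding \<sigma>_def using tendsto_diff[OF tendsto_const] by fastforce
  obtain \<Delta> where \<Delta>: "positive_cocycle \<Delta>"
    "probabilistic_valuation I act (twisted_valuation act f rad \<Delta>)"
    using subsequential_limit_probabilistic[OF 1 2 3] by blast
  have "((\<lambda>s. G \<beta> s / G \<alpha> s) \<longlongrightarrow> \<Delta> \<alpha> \<beta>) (at_left rad)" for \<alpha> \<beta>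
  proof (rule tendsto_at_left_sequentially)
    show "rad / 2 < rad" using rad_pos by simp
    fix S :: "nat \<Rightarrow> real"
    assume S: "\<And>n. S n < rad" "\<And>n. rad / 2 < S n" "incseq S" "S \<longlonglongrightarrow> rad"
    show "(\<lambda>n. G \<beta> (S n) / G \<alpha> (S n)) \<longlonglongrightarrow> \<Delta> \<alpha> \<beta>"
    proof (rule tendstoI, rule ccontr)
      fix e :: real assume e: "0 < e"
      assume "\<not> (\<forall>\<^sub>F n in sequentially. dist (G \<beta> (S n) / G \<alpha> (S n)) (\<Delta> \<alpha> \<beta>) < e)"
      then obtain k where k: "strict_mono (k :: nat \<Rightarrow> nat)"
        "\<And>n. \<not> dist (G \<beta> (S (k n)) / G \<alpha> (S (k n))) (\<Delta> \<alpha> \<beta>) < e"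
        using not_eventually_sequentiallyD by blast
      have Sk: "(\<lambda>n. S (k n)) \<longlonglongrightarrow> rad"
        using LIMSEQ_subseq_LIMSEQ[OF S(4) k(1)] by (simp add: o_def)
      obtain j \<Delta>' where j: "(\<lambda>n. G \<beta> (S (k (j n))) / G \<alpha> (S (k (j n)))) \<longlonglongrightarrow> \<Delta>' \<alpha> \<beta>"
        and \<Delta>': "positive_cocycle \<Delta>'"
          "probabilistic_valuation I act (twisted_valuation act f rad \<Delta>')"
        using subsequential_limit_probabilistic[OF less_imp_le[OF S(2)] S(1) Sk] by blast
      have "\<Delta>' = \<Delta>"
        using probabilistic_twist_unique[OF rad_pos rad_pos \<Delta>'(1) \<Delta>(1) \<Delta>'(2) \<Delta>(2)] by blast
      with j have "\<forall>\<^sub>F n in sequentially. dist (G \<beta> (S (k (j n))) / G \<alpha> (S (k (j n)))) (\<Delta> \<alpha> \<beta>) < e"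
        using e by (simp add: tendstoD)
      with k(2) show False by simp
    qed
  qed
  with \<Delta> show ?thesis by blast
qed

end

theorem theorem4p4:
  fixes I :: "'a::finite rel"
    and act :: "'s::finite option \<Rightarrow> 'a list set \<Rightarrow> 's option"
    and f :: "'s \<Rightarrow> 'a list set \<Rightarrow> real"
  assumes "irreducible_concurrent_system I act"
    and "valuation I act f"
  shows "(\<exists>!(p :: real \<times> ('s \<Rightarrow> 's \<Rightarrow> real)).
            fst p > 0 \<and> positive_cocycle (snd p) \<and>
            probabilistic_valuation I act (twisted_valuation act f (fst p) (snd p))) \<and>
         (\<exists>(\<rho>::real) (\<Delta> :: 's \<Rightarrow> 's \<Rightarrow> real).
            (\<forall>\<alpha>. conv_radius (gen_series_coeff I act f \<alpha>) = ereal \<rho>) \<and>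
            (\<forall>\<alpha> \<beta>. ((\<lambda>s. gen_series I act f \<beta> s / gen_series I act f \<alpha> s)
                      \<longlongrightarrow> \<Delta> \<alpha> \<beta>) (at_left \<rho>)) \<and>
            \<rho> > 0 \<and> positive_cocycle \<Delta> \<and>
            probabilistic_valuation I act (twisted_valuation act f \<rho> \<Delta>))"
proof -
  interpret weighted_system I act f
    using assms by unfold_locales
  obtain \<Delta> where \<Delta>: "positive_cocycle \<Delta>"
    "probabilistic_valuation I act (twisted_valuation act f rad \<Delta>)"
    "\<And>\<alpha> \<beta>. ((\<lambda>s. G \<beta> s / G \<alpha> s) \<longlongrightarrow> \<Delta> \<alpha> \<beta>) (at_left rad)"
    using G_ratio_tendsto by blast
  show ?thesis
  proof
    show "\<exists>!p. fst p > 0 \<and> positive_cocycle (snd p) \<and>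
      probabilistic_valuation I act (twisted_valuation act f (fst p) (snd p))"
    proof (rule ex1I[of _ "(rad, \<Delta>)"])
      show "p = (rad, \<Delta>)" if "fst p > 0 \<and> positive_cocycle (snd p) \<and>
        probabilistic_valuation I act (twisted_valuation act f (fst p) (snd p))" for p
        using that probabilistic_twist_unique[of "fst p" rad "snd p" \<Delta> f] rad_pos \<Delta>(1,2)
        by (simp add: prod_eq_iff)
    qed (use rad_pos \<Delta> in simp)
  next
    show "\<exists>\<rho> \<Delta>. (\<forall>\<alpha>. conv_radius (gen_series_coeff I act f \<alpha>) = ereal \<rho>) \<and>
      (\<forall>\<alpha> \<beta>. ((\<lambda>s. gen_series I act f \<beta> s / gen_series I act f \<alpha> s) \<longlongrightarrow> \<Delta> \<alpha> \<beta>) (at_left \<rho>)) \<and>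
      \<rho> > 0 \<and> positive_cocycle \<Delta> \<and>
      probabilistic_valuation I act (twisted_valuation act f \<rho> \<Delta>)"
      using \<Delta> rad_pos conv_radius_eq
      by (intro exI[of _ rad] exI[of _ \<Delta>]) (simp add: gen_series_coeff_eq gen_series_eq)
  qed
qed

end
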